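(* Let $(\mathcal{C},\mathbb{E},\mathfrak{s})$ be an $n$-exangulated category and let $\xi$ be a class of distinguished $n$-exangles in $(\mathcal{C},\mathbb{E},\mathfrak{s})$ which is closed under weak isomorphisms. Set $\mathbb{E}_\xi:=\mathbb{E}|_\xi$, that is, $$\mathbb{E}_\xi(C,A)=\{\delta\in\mathbb{E}(C,A)\mid \delta\text{ is realized as a distinguished } n\text{-exangle } \langle X^\bullet,\delta\rangle \text{ in } \xi \text{ with } X^0=A,\ X^{n+1}=C\}$$ for any $A,C\in\mathcal{C}$, and $\mathfrak{s}_\xi:=\mathfrak{s}|_{\mathbb{E}_\xi}$. Then $\xi$ is an $n$-proper class if and only if $(\mathcal{C},\mathbb{E}_\xi,\mathfrak{s}_\xi)$ is an $n$-exangulated category.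
   Context: Throughout, $n\ge 1$ is an integer, $\mathcal{C}$ is an additive category and $\mathbb{E}:\mathcal{C}^{\mathrm{op}}\times\mathcal{C}\to\mathrm{Ab}$ is an additive bifunctor. **Extensions.** An element $\delta\in\mathbb{E}(C,A)$ is called an extension. For $a\in\mathcal{C}(A,A')$, $c\in\mathcal{C}(C',C)$ write $a_*\delta=\mathbb{E}(C,a)(\delta)$ and $c^*\delta=\mathbb{E}(c,A)(\delta)$. A morphism of extensions from $\delta\in\mathbb{E}(C,A)$ to $\delta'\in\mathbb{E}(C',A')$ is a pair $(a,c)$ with $a\in\mathcal{C}(A,A')$, $c\in\mathcal{C}(C,C')$ and $a_*\delta=c^*\delta'$. $\delta\oplus\delta'\in\mathbb{E}(C\oplus C',A\oplus A')$ is the element corresponding to $(\delta,0,0,\delta')$. **Complexes.** $\mathbf{C}^{n+2}_{\mathcal{C}}$ is the category of complexes $X^\bullet=(X^0\xrightarrow{d_X^0}X^1\to\cdots\xrightarrow{d_X^n}X^{n+1})$ in $\mathcal{C}$ concentrated in degrees $0,\dots,n+1$. For objects $A,C$, $\mathbf{C}^{n+2}_{(A,C)}$ is the subcategory of those $X^\bullet$ with $X^0=A$, $X^{n+1}=C$, with morphisms those $f^\bullet$ with $f^0=1_A$, $f^{n+1}=1_C$; its quotient by the usual homotopy relation is $\mathbf{K}^{n+2}_{(A,C)}$, and $[X^\bullet]$ denotes the homotopy equivalence class of $X^\bullet$ there. **$n$-exangles.** An $n$-exangle is a pair $\langle X^\bullet,\delta\rangle$ with $X^\bullet\in\mathbf{C}^{n+2}_{\mathcal{C}}$,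 $\delta\in\mathbb{E}(X^{n+1},X^0)$ such that the sequences of functors $\mathcal{C}(-,X^0)\to\mathcal{C}(-,X^1)\to\cdots\to\mathcal{C}(-,X^{n+1})\xrightarrow{f\mapsto f^*\delta}\mathbb{E}(-,X^0)$ and $\mathcal{C}(X^{n+1},-)\to\mathcal{C}(X^n,-)\to\cdots\to\mathcal{C}(X^0,-)\xrightarrow{g\mapsto g_*\delta}\mathbb{E}(X^{n+1},-)$ are exact (at the intermediate terms). A morphism $\langle X^\bullet,\delta\rangle\to\langle Y^\bullet,\rho\rangle$ of $n$-exangles is a chain map $f^\bullet$ with $(f^0)_*\delta=(f^{n+1})^*\rho$. **Exact realizations.** A realization $\mathfrak{s}$ of $\mathbb{E}$ assigns to each $\delta\in\mathbb{E}(C,A)$ a homotopy equivalence class $\mathfrak{s}(\delta)=[X^\bullet]$ with $X^\bullet\in\mathbf{C}^{n+2}_{(A,C)}$ such that: (R0) if $\mathfrak{s}(\delta)=[X^\bullet]$, $\mathfrak{s}(\rho)=[Y^\bullet]$, every morphism of extensions $(a,c):\delta\to\rho$ has a lift, i.e. a chain map $f^\bullet:X^\bullet\to Y^\bullet$ with $f^0=a$, $f^{n+1}=c$. It is exact if moreover: (R1) whenever $\mathfrak{s}(\delta)=[X^\bullet]$, $\langle X^\bullet,\delta\rangle$ is an $n$-exangle; (R2) for every $A$, the zero element of $\mathbb{E}(0,A)$ is sent to $[A\xrightarrow{1}A\to0\to\cdots\to0]$ and the zero element of $\mathbb{E}(A,0)$ to $[0\to\cdots\to0\to A\xrightarrow{1}A]$.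 If $\mathfrak{s}(\delta)=[X^\bullet]$, $\langle X^\bullet,\delta\rangle$ is called a distinguished $n$-exangle, $X^\bullet$ a conflation, $d_X^0$ an inflation and $d_X^n$ a deflation. **Mapping (co)cones.** For $f^\bullet:X^\bullet\to Y^\bullet$ with $f^0=1$, the mapping cone $M_f^\bullet$ is $X^1\to X^2\oplus Y^1\to\cdots\to X^{n+1}\oplus Y^n\to Y^{n+1}$ with differentials $\begin{bmatrix}-d_X^1\\ f^1\end{bmatrix}$, $\begin{bmatrix}-d_X^{i+1}&0\\ f^{i+1}&d_Y^i\end{bmatrix}$ ($1\le i\le n-1$), $\begin{bmatrix}f^{n+1}&d_Y^n\end{bmatrix}$. Dually, for $h^\bullet:X^\bullet\to Y^\bullet$ with $h^{n+1}=1$, the mapping cocone $N_h^\bullet$ is $X^0\to X^1\oplus Y^0\to\cdots\to X^n\oplus Y^{n-1}\to Y^n$ with the analogous differentials. **$n$-exangulated category.** A triplet $(\mathcal{C},\mathbb{E},\mathfrak{s})$ of an additive category, an additive bifunctor $\mathbb{E}$ and an exact realization $\mathfrak{s}$ of $\mathbb{E}$ such that: (EA1) inflations are closed under composition and deflations are closed under composition; (EA2) for $\rho\in\mathbb{E}(D,A)$, $c\in\mathcal{C}(C,D)$ and distinguished $n$-exangles $\langle X^\bullet,c^*\rho\rangle$, $\langle Y^\bullet,\rho\rangle$, the pair $(1_A,c)$ has a lift $f^\bullet$ such that $\langle M_f^\bullet,(d_X^0)_*\rho\rangle$ is a distinguished $n$-exangle; (EA2$^{\mathrm{op}}$) dually,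 for $\rho\in\mathbb{E}(C,A)$, $a\in\mathcal{C}(A,B)$ and distinguished $n$-exangles $\langle X^\bullet,\rho\rangle$, $\langle Y^\bullet,a_*\rho\rangle$, the pair $(a,1_C)$ has a lift $h^\bullet$ such that $\langle N_h^\bullet,(d_Y^n)^*\rho\rangle$ is a distinguished $n$-exangle. **Classes of distinguished $n$-exangles.** A weak isomorphism is a morphism $f^\bullet:\langle X^\bullet,\delta\rangle\to\langle Y^\bullet,\rho\rangle$ of distinguished $n$-exangles such that $f^0$ and $f^{n+1}$ are isomorphisms. A distinguished $n$-exangle $\langle X^\bullet,\delta\rangle$ is split if $\delta=0$; $\Delta_0$ is the class of split ones. Let $\xi$ be a class of distinguished $n$-exangles. A $\xi$-distinguished $n$-exangle is a member of $\xi$; $f$ is a $\xi$-inflation (resp. $\xi$-deflation) if $f=d_X^0$ (resp. $f=d_X^n$) for some $\langle X^\bullet,\delta\rangle\in\xi$. - $\xi$ is closed under base change if for every $\langle X^\bullet,\delta\rangle\in\xi$ and $c:C'\to X^{n+1}$, every distinguished $n$-exangle $\langle Y^\bullet,c^*\delta\rangle$ belongs to $\xi$; closed under cobase change if for every $\langle X^\bullet,\delta\rangle\in\xi$ and $a:X^0\to A'$, every distinguished $n$-exangle $\langle Y^\bullet,a_*\delta\rangle$ belongs to $\xi$. - $\xi$ is saturated if for every commutative square $ba=dc$ in $\mathcal{C}$ with $a:A\to B$, $b:B\to D$, $c:A\to C$, $d:C\to D$ in which $a,b,d$ are deflations: if $a$ and $b$ are $\xi$-deflations, then so is $d$. - $\xi$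 is an $n$-proper class if (1) $\Delta_0\subseteq\xi$ and $\xi$ is closed under weak isomorphisms and finite coproducts (i.e. finite direct sums $\langle X^\bullet\oplus Y^\bullet,\delta\oplus\rho\rangle$); (2) $\xi$ is closed under base change and cobase change; (3) $\xi$ is saturated. In the statement, $\mathbb{E}_\xi$ carries the structure restricted from $\mathbb{E}$; that $(\mathcal{C},\mathbb{E}_\xi,\mathfrak{s}_\xi)$ is $n$-exangulated includes that $\mathbb{E}_\xi$ is, with this restricted structure, an additive bifunctor. *)

theory Defs
  imports "HOL-Algebra.Group"
begin

text \<open>
  All abelian groups are commutative groups of HOL-Algebra, whose notation is multiplicative:
  in a group of morphisms or of extensions, \<open>\<otimes>\<close> is the sum, \<open>\<one>\<close> is zero and \<open>inv\<close> is the
  additive inverse.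
\<close>

section \<open>Additive categories\<close>

text \<open>\<open>Hom C A B\<close> is the abelian group of morphisms from \<open>A\<close> to \<open>B\<close>.\<close>

record ('o, 'm) acat =
  Ob :: "'o set"
  Hom :: "'o \<Rightarrow> 'o \<Rightarrow> 'm monoid"
  Idm :: "'o \<Rightarrow> 'm"
  Comp :: "'m \<Rightarrow> 'm \<Rightarrow> 'm"  (infixl \<open>\<cdot>\<index>\<close> 75)

record ('o, 'm) biprod =
  apex :: 'o
  in1 :: 'm
  in2 :: 'm
  pr1 :: 'm
  pr2 :: 'm

definition zero_object :: "('o, 'm) acat \<Rightarrow> 'o \<Rightarrow> bool" where
  "zero_object C Z \<longleftrightarrow> Z \<in> Ob C \<and>
     (\<forall>A\<in>Ob C. carrier (Hom C A Z) = {\<one>\<^bsub>Hom C A Z\<^esub>} \<and> carrier (Hom C Z A) = {\<one>\<^bsub>Hom C Z A\<^esub>})"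

definition biproduct :: "('o, 'm) acat \<Rightarrow> 'o \<Rightarrow> 'o \<Rightarrow> ('o, 'm) biprod \<Rightarrow> bool" where
  "biproduct C A B b \<longleftrightarrow> apex b \<in> Ob C \<and>
     in1 b \<in> carrier (Hom C A (apex b)) \<and> in2 b \<in> carrier (Hom C B (apex b)) \<and>
     pr1 b \<in> carrier (Hom C (apex b) A) \<and> pr2 b \<in> carrier (Hom C (apex b) B) \<and>
     pr1 b \<cdot>\<^bsub>C\<^esub> in1 b = Idm C A \<and> pr2 b \<cdot>\<^bsub>C\<^esub> in2 b = Idm C B \<and>
     pr1 b \<cdot>\<^bsub>C\<^esub> in2 b = \<one>\<^bsub>Hom C B A\<^esub> \<and> pr2 b \<cdot>\<^bsub>C\<^esub> in1 b = \<one>\<^bsub>Hom C A B\<^esub> \<and>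
     (in1 b \<cdot>\<^bsub>C\<^esub> pr1 b) \<otimes>\<^bsub>Hom C (apex b) (apex b)\<^esub> (in2 b \<cdot>\<^bsub>C\<^esub> pr2 b) = Idm C (apex b)"

text \<open>
  Objects are the members of \<open>Ob C\<close>; nothing is required of \<open>Hom C A B\<close> for other \<open>A\<close>, \<open>B\<close>.
  Since composition takes only the two morphisms as arguments, a morphism has to determine its
  source and target.
\<close>

locale additive_category =
  fixes C :: "('o, 'm) acat"
  assumes Hom_group: "\<lbrakk>A \<in> Ob C; B \<in> Ob C\<rbrakk> \<Longrightarrow> comm_group (Hom C A B)"
    and Hom_disjoint: "\<lbrakk>A \<in> Ob C; B \<in> Ob C; A' \<in> Ob C; B' \<in> Ob C;
          f \<in> carrier (Hom C A B); f \<in> carrier (Hom C A' B')\<rbrakk> \<Longrightarrow> A = A' \<and> B = B'"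
    and Id_in_Hom: "A \<in> Ob C \<Longrightarrow> Idm C A \<in> carrier (Hom C A A)"
    and Comp_in_Hom: "\<lbrakk>A \<in> Ob C; B \<in> Ob C; D \<in> Ob C;
          f \<in> carrier (Hom C A B); g \<in> carrier (Hom C B D)\<rbrakk> \<Longrightarrow> g \<cdot>\<^bsub>C\<^esub> f \<in> carrier (Hom C A D)"
    and Comp_Id: "\<lbrakk>A \<in> Ob C; B \<in> Ob C; f \<in> carrier (Hom C A B)\<rbrakk> \<Longrightarrow> f \<cdot>\<^bsub>C\<^esub> Idm C A = f"
    and Id_Comp: "\<lbrakk>A \<in> Ob C; B \<in> Ob C; f \<in> carrier (Hom C A B)\<rbrakk> \<Longrightarrow> Idm C B \<cdot>\<^bsub>C\<^esub> f = f"
    and Comp_assoc: "\<lbrakk>A \<in> Ob C; B \<in> Ob C; D \<in> Ob C; F \<in> Ob C; f \<in> carrier (Hom C A B);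
          g \<in> carrier (Hom C B D); h \<in> carrier (Hom C D F)\<rbrakk>
          \<Longrightarrow> h \<cdot>\<^bsub>C\<^esub> (g \<cdot>\<^bsub>C\<^esub> f) = (h \<cdot>\<^bsub>C\<^esub> g) \<cdot>\<^bsub>C\<^esub> f"
    and Comp_add_left: "\<lbrakk>A \<in> Ob C; B \<in> Ob C; D \<in> Ob C; f \<in> carrier (Hom C A B);
          g \<in> carrier (Hom C B D); h \<in> carrier (Hom C B D)\<rbrakk>
          \<Longrightarrow> (g \<otimes>\<^bsub>Hom C B D\<^esub> h) \<cdot>\<^bsub>C\<^esub> f = (g \<cdot>\<^bsub>C\<^esub> f) \<otimes>\<^bsub>Hom C A D\<^esub> (h \<cdot>\<^bsub>C\<^esub> f)"
    and Comp_add_right: "\<lbrakk>A \<in> Ob C; B \<in> Ob C; D \<in> Ob C; f \<in> carrier (Hom C A B);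
          g \<in> carrier (Hom C A B); h \<in> carrier (Hom C B D)\<rbrakk>
          \<Longrightarrow> h \<cdot>\<^bsub>C\<^esub> (f \<otimes>\<^bsub>Hom C A B\<^esub> g) = (h \<cdot>\<^bsub>C\<^esub> f) \<otimes>\<^bsub>Hom C A D\<^esub> (h \<cdot>\<^bsub>C\<^esub> g)"
    and ex_zero_object: "\<exists>Z. zero_object C Z"
    and ex_biproduct: "\<lbrakk>A \<in> Ob C; B \<in> Ob C\<rbrakk> \<Longrightarrow> \<exists>b. biproduct C A B b"

text \<open>
  \<open>A \<oplus> B\<close> is an arbitrarily chosen biproduct. The choice is immaterial: the middle terms of
  mapping (co)cones only matter up to isomorphism of complexes with fixed ends, and finite
  coproducts are only formed in classes closed under weak isomorphisms.
\<close>

definition bip :: "('o, 'm) acat \<Rightarrow> 'o \<Rightarrow> 'o \<Rightarrow> ('o, 'm) biprod" where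
  "bip C A B = (SOME b. biproduct C A B b)"

definition osum :: "('o, 'm) acat \<Rightarrow> 'o \<Rightarrow> 'o \<Rightarrow> 'o" where
  "osum C A B = apex (bip C A B)"

text \<open>
  Matrix notation for morphisms. \<open>col2 C W A B f g\<close> is the column
  \<open>[f; g] : W \<rightarrow> A \<oplus> B\<close>, \<open>row2 C A B W f g\<close> is the row \<open>[f g] : A \<oplus> B \<rightarrow> W\<close>, and
  \<open>mat22 C A B A' B' f g h k\<close> is the matrix with rows \<open>[f g]\<close>, \<open>[h k]\<close> from \<open>A \<oplus> B\<close> to
  \<open>A' \<oplus> B'\<close>.
\<close>

definition col2 :: "('o, 'm) acat \<Rightarrow> 'o \<Rightarrow> 'o \<Rightarrow> 'o \<Rightarrow> 'm \<Rightarrow> 'm \<Rightarrow> 'm" where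
  "col2 C W A B f g =
     (in1 (bip C A B) \<cdot>\<^bsub>C\<^esub> f) \<otimes>\<^bsub>Hom C W (osum C A B)\<^esub> (in2 (bip C A B) \<cdot>\<^bsub>C\<^esub> g)"

definition row2 :: "('o, 'm) acat \<Rightarrow> 'o \<Rightarrow> 'o \<Rightarrow> 'o \<Rightarrow> 'm \<Rightarrow> 'm \<Rightarrow> 'm" where
  "row2 C A B W f g =
     (f \<cdot>\<^bsub>C\<^esub> pr1 (bip C A B)) \<otimes>\<^bsub>Hom C (osum C A B) W\<^esub> (g \<cdot>\<^bsub>C\<^esub> pr2 (bip C A B))"

definition mat22 ::
  "('o, 'm) acat \<Rightarrow> 'o \<Rightarrow> 'o \<Rightarrow> 'o \<Rightarrow> 'o \<Rightarrow> 'm \<Rightarrow> 'm \<Rightarrow> 'm \<Rightarrow> 'm \<Rightarrow> 'm" where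
  "mat22 C A B A' B' f g h k =
     col2 C (osum C A B) A' B' (row2 C A B A' f g) (row2 C A B B' h k)"

definition isomorphism :: "('o, 'm) acat \<Rightarrow> 'o \<Rightarrow> 'o \<Rightarrow> 'm \<Rightarrow> bool" where
  "isomorphism C A B f \<longleftrightarrow> f \<in> carrier (Hom C A B) \<and>
     (\<exists>g\<in>carrier (Hom C B A). g \<cdot>\<^bsub>C\<^esub> f = Idm C A \<and> f \<cdot>\<^bsub>C\<^esub> g = Idm C B)"


section \<open>Additive bifunctors\<close>

text \<open>
  \<open>Ext E Z A\<close> is the group \<open>\<E>(Z, A)\<close> (contravariant argument first), and
  \<open>Emap E c a : \<E>(Z, A) \<rightarrow> \<E>(Z', A')\<close> is \<open>\<E>(c, a)\<close> for \<open>c : Z' \<rightarrow> Z\<close> and \<open>a : A \<rightarrow> A'\<close>.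
\<close>

record ('o, 'm, 'e) bifun =
  Ext :: "'o \<Rightarrow> 'o \<Rightarrow> 'e monoid"
  Emap :: "'m \<Rightarrow> 'm \<Rightarrow> 'e \<Rightarrow> 'e"

locale additive_bifunctor = additive_category C
  for C :: "('o, 'm) acat" +
  fixes E :: "('o, 'm, 'e) bifun"
  assumes Ext_group: "\<lbrakk>Z \<in> Ob C; A \<in> Ob C\<rbrakk> \<Longrightarrow> comm_group (Ext E Z A)"
    and Emap_hom: "\<lbrakk>Z \<in> Ob C; Z' \<in> Ob C; A \<in> Ob C; A' \<in> Ob C;
          c \<in> carrier (Hom C Z' Z); a \<in> carrier (Hom C A A')\<rbrakk>
          \<Longrightarrow> Emap E c a \<in> hom (Ext E Z A) (Ext E Z' A')"
    and Emap_Id: "\<lbrakk>Z \<in> Ob C; A \<in> Ob C; \<delta> \<in> carrier (Ext E Z A)\<rbrakk>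
          \<Longrightarrow> Emap E (Idm C Z) (Idm C A) \<delta> = \<delta>"
    and Emap_Comp: "\<lbrakk>Z \<in> Ob C; Z' \<in> Ob C; Z'' \<in> Ob C; A \<in> Ob C; A' \<in> Ob C; A'' \<in> Ob C;
          c \<in> carrier (Hom C Z' Z); c' \<in> carrier (Hom C Z'' Z');
          a \<in> carrier (Hom C A A'); a' \<in> carrier (Hom C A' A''); \<delta> \<in> carrier (Ext E Z A)\<rbrakk>
          \<Longrightarrow> Emap E (c \<cdot>\<^bsub>C\<^esub> c') (a' \<cdot>\<^bsub>C\<^esub> a) \<delta> = Emap E c' a' (Emap E c a \<delta>)"
    and Emap_add_left: "\<lbrakk>Z \<in> Ob C; Z' \<in> Ob C; A \<in> Ob C; A' \<in> Ob C;
          c \<in> carrier (Hom C Z' Z); c' \<in> carrier (Hom C Z' Z);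
          a \<in> carrier (Hom C A A'); \<delta> \<in> carrier (Ext E Z A)\<rbrakk>
          \<Longrightarrow> Emap E (c \<otimes>\<^bsub>Hom C Z' Z\<^esub> c') a \<delta> = Emap E c a \<delta> \<otimes>\<^bsub>Ext E Z' A'\<^esub> Emap E c' a \<delta>"
    and Emap_add_right: "\<lbrakk>Z \<in> Ob C; Z' \<in> Ob C; A \<in> Ob C; A' \<in> Ob C;
          c \<in> carrier (Hom C Z' Z); a \<in> carrier (Hom C A A');
          a' \<in> carrier (Hom C A A'); \<delta> \<in> carrier (Ext E Z A)\<rbrakk>
          \<Longrightarrow> Emap E c (a \<otimes>\<^bsub>Hom C A A'\<^esub> a') \<delta> = Emap E c a \<delta> \<otimes>\<^bsub>Ext E Z' A'\<^esub> Emap E c a' \<delta>"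

text \<open>\<open>push C E Z a \<delta>\<close> is \<open>a\<^sub>* \<delta> = \<E>(Z, a)(\<delta>)\<close> and \<open>pull C E A c \<delta>\<close> is \<open>c\<^sup>* \<delta> = \<E>(c, A)(\<delta>)\<close>.\<close>

definition push :: "('o, 'm) acat \<Rightarrow> ('o, 'm, 'e) bifun \<Rightarrow> 'o \<Rightarrow> 'm \<Rightarrow> 'e \<Rightarrow> 'e" where
  "push C E Z a \<delta> = Emap E (Idm C Z) a \<delta>"

definition pull :: "('o, 'm) acat \<Rightarrow> ('o, 'm, 'e) bifun \<Rightarrow> 'o \<Rightarrow> 'm \<Rightarrow> 'e \<Rightarrow> 'e" where
  "pull C E A c \<delta> = Emap E c (Idm C A) \<delta>"

definition ext_mor :: "('o, 'm) acat \<Rightarrow> ('o, 'm, 'e) bifun \<Rightarrow> 'o \<Rightarrow> 'o \<Rightarrow> 'e \<Rightarrow> 'o \<Rightarrow> 'o \<Rightarrow> 'e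
    \<Rightarrow> 'm \<Rightarrow> 'm \<Rightarrow> bool" where
  "ext_mor C E Z A \<delta> Z' A' \<delta>' a c \<longleftrightarrow>
     a \<in> carrier (Hom C A A') \<and> c \<in> carrier (Hom C Z Z') \<and> push C E Z a \<delta> = pull C E A' c \<delta>'"

text \<open>
  \<open>ext_sum C E Z A \<delta> Z' A' \<delta>'\<close> is \<open>\<delta> \<oplus> \<delta>'\<close>: the components of an element of
  \<open>\<E>(Z \<oplus> Z', A \<oplus> A')\<close> are obtained by restricting along the injections of \<open>Z \<oplus> Z'\<close> and
  projecting along those of \<open>A \<oplus> A'\<close>, so the element with components \<open>(\<delta>, 0, 0, \<delta>')\<close>
  is the following sum.
\<close>

definition ext_sum :: "('o, 'm) acat \<Rightarrow> ('o, 'm, 'e) bifun \<Rightarrow> 'o \<Rightarrow> 'o \<Rightarrow> 'e \<Rightarrow> 'o \<Rightarrow> 'o \<Rightarrow> 'e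
    \<Rightarrow> 'e" where
  "ext_sum C E Z A \<delta> Z' A' \<delta>' =
     Emap E (pr1 (bip C Z Z')) (in1 (bip C A A')) \<delta>
       \<otimes>\<^bsub>Ext E (osum C Z Z') (osum C A A')\<^esub>
     Emap E (pr2 (bip C Z Z')) (in2 (bip C A A')) \<delta>'"


section \<open>Complexes\<close>

text \<open>
  \<open>ob X i\<close> is \<open>X\<^sup>i\<close> and \<open>df X i : X\<^sup>i \<rightarrow> X\<^sup>i\<^sup>+\<^sup>1\<close> is the differential. The values \<open>ob X i\<close> for
  \<open>i > n + 1\<close> and \<open>df X i\<close> for \<open>i > n\<close> are junk that no definition inspects; homotopy classes, and
  classes closed under weak isomorphisms, contain with \<open>X\<close> all its variants with different junk.
\<close>

record ('o, 'm) cpx =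
  ob :: "nat \<Rightarrow> 'o"
  df :: "nat \<Rightarrow> 'm"

definition is_cpx :: "nat \<Rightarrow> ('o, 'm) acat \<Rightarrow> ('o, 'm) cpx \<Rightarrow> bool" where
  "is_cpx n C X \<longleftrightarrow> (\<forall>i\<le>n+1. ob X i \<in> Ob C) \<and>
     (\<forall>i\<le>n. df X i \<in> carrier (Hom C (ob X i) (ob X (i+1)))) \<and>
     (\<forall>i<n. df X (i+1) \<cdot>\<^bsub>C\<^esub> df X i = \<one>\<^bsub>Hom C (ob X i) (ob X (i+2))\<^esub>)"

definition cpx_mor :: "nat \<Rightarrow> ('o, 'm) acat \<Rightarrow> ('o, 'm) cpx \<Rightarrow> ('o, 'm) cpx \<Rightarrow> (nat \<Rightarrow> 'm) \<Rightarrow> bool"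
  where
  "cpx_mor n C X Y f \<longleftrightarrow> (\<forall>i\<le>n+1. f i \<in> carrier (Hom C (ob X i) (ob Y i))) \<and>
     (\<forall>i\<le>n. df Y i \<cdot>\<^bsub>C\<^esub> f i = f (i+1) \<cdot>\<^bsub>C\<^esub> df X i)"

definition homotopic :: "nat \<Rightarrow> ('o, 'm) acat \<Rightarrow> ('o, 'm) cpx \<Rightarrow> ('o, 'm) cpx \<Rightarrow> (nat \<Rightarrow> 'm)
    \<Rightarrow> (nat \<Rightarrow> 'm) \<Rightarrow> bool" where
  "homotopic n C X Y f g \<longleftrightarrow> (\<exists>h.
     (\<forall>i. 1 \<le> i \<and> i \<le> n+1 \<longrightarrow> h i \<in> carrier (Hom C (ob X i) (ob Y (i-1)))) \<and>
     f 0 = g 0 \<otimes>\<^bsub>Hom C (ob X 0) (ob Y 0)\<^esub> (h 1 \<cdot>\<^bsub>C\<^esub> df X 0) \<and>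
     (\<forall>i. 1 \<le> i \<and> i \<le> n \<longrightarrow>
        f i = g i \<otimes>\<^bsub>Hom C (ob X i) (ob Y i)\<^esub>
          ((df Y (i-1) \<cdot>\<^bsub>C\<^esub> h i) \<otimes>\<^bsub>Hom C (ob X i) (ob Y i)\<^esub> (h (i+1) \<cdot>\<^bsub>C\<^esub> df X i))) \<and>
     f (n+1) = g (n+1) \<otimes>\<^bsub>Hom C (ob X (n+1)) (ob Y (n+1))\<^esub> (df Y n \<cdot>\<^bsub>C\<^esub> h (n+1)))"

text \<open>Complexes and morphisms of the category \<open>\<^bold>C\<close> with fixed ends \<open>X\<^sup>0 = A\<close> and \<open>X\<^sup>n\<^sup>+\<^sup>1 = Z\<close>.\<close>

definition cpx_between :: "nat \<Rightarrow> ('o, 'm) acat \<Rightarrow> 'o \<Rightarrow> 'o \<Rightarrow> ('o, 'm) cpx set" where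
  "cpx_between n C A Z = {X. is_cpx n C X \<and> ob X 0 = A \<and> ob X (n+1) = Z}"

definition cpx_mor_between :: "nat \<Rightarrow> ('o, 'm) acat \<Rightarrow> 'o \<Rightarrow> 'o \<Rightarrow> ('o, 'm) cpx \<Rightarrow> ('o, 'm) cpx
    \<Rightarrow> (nat \<Rightarrow> 'm) \<Rightarrow> bool" where
  "cpx_mor_between n C A Z X Y f \<longleftrightarrow> cpx_mor n C X Y f \<and> f 0 = Idm C A \<and> f (n+1) = Idm C Z"

definition homotopy_equivalent :: "nat \<Rightarrow> ('o, 'm) acat \<Rightarrow> 'o \<Rightarrow> 'o \<Rightarrow> ('o, 'm) cpx
    \<Rightarrow> ('o, 'm) cpx \<Rightarrow> bool" where
  "homotopy_equivalent n C A Z X Y \<longleftrightarrow>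
     (\<exists>f g. cpx_mor_between n C A Z X Y f \<and> cpx_mor_between n C A Z Y X g \<and>
        homotopic n C X X (\<lambda>i. g i \<cdot>\<^bsub>C\<^esub> f i) (\<lambda>i. Idm C (ob X i)) \<and>
        homotopic n C Y Y (\<lambda>i. f i \<cdot>\<^bsub>C\<^esub> g i) (\<lambda>i. Idm C (ob Y i)))"

definition hclass :: "nat \<Rightarrow> ('o, 'm) acat \<Rightarrow> 'o \<Rightarrow> 'o \<Rightarrow> ('o, 'm) cpx \<Rightarrow> ('o, 'm) cpx set" where
  "hclass n C A Z X = {Y \<in> cpx_between n C A Z. homotopy_equivalent n C A Z X Y}"

definition cpx_sum :: "('o, 'm) acat \<Rightarrow> ('o, 'm) cpx \<Rightarrow> ('o, 'm) cpx \<Rightarrow> ('o, 'm) cpx" where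
  "cpx_sum C X Y =
     \<lparr>ob = \<lambda>i. osum C (ob X i) (ob Y i),
      df = \<lambda>i. mat22 C (ob X i) (ob Y i) (ob X (i+1)) (ob Y (i+1))
                (df X i) \<one>\<^bsub>Hom C (ob Y i) (ob X (i+1))\<^esub>
                \<one>\<^bsub>Hom C (ob X i) (ob Y (i+1))\<^esub> (df Y i)\<rparr>"

definition mapping_cone :: "nat \<Rightarrow> ('o, 'm) acat \<Rightarrow> ('o, 'm) cpx \<Rightarrow> ('o, 'm) cpx \<Rightarrow> (nat \<Rightarrow> 'm)
    \<Rightarrow> ('o, 'm) cpx" where
  "mapping_cone n C X Y f =
     \<lparr>ob = \<lambda>i. if i = 0 then ob X 1
               else if i \<le> n then osum C (ob X (i+1)) (ob Y i)
               else ob Y (n+1),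
      df = \<lambda>i. if i = 0 then
                 col2 C (ob X 1) (ob X 2) (ob Y 1) (inv\<^bsub>Hom C (ob X 1) (ob X 2)\<^esub> df X 1) (f 1)
               else if i < n then
                 mat22 C (ob X (i+1)) (ob Y i) (ob X (i+2)) (ob Y (i+1))
                   (inv\<^bsub>Hom C (ob X (i+1)) (ob X (i+2))\<^esub> df X (i+1)) \<one>\<^bsub>Hom C (ob Y i) (ob X (i+2))\<^esub>
                   (f (i+1)) (df Y i)
               else row2 C (ob X (n+1)) (ob Y n) (ob Y (n+1)) (f (n+1)) (df Y n)\<rparr>"

definition mapping_cocone :: "nat \<Rightarrow> ('o, 'm) acat \<Rightarrow> ('o, 'm) cpx \<Rightarrow> ('o, 'm) cpx \<Rightarrow> (nat \<Rightarrow> 'm)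
    \<Rightarrow> ('o, 'm) cpx" where
  "mapping_cocone n C X Y h =
     \<lparr>ob = \<lambda>i. if i = 0 then ob X 0
               else if i \<le> n then osum C (ob X i) (ob Y (i-1))
               else ob Y n,
      df = \<lambda>i. if i = 0 then
                 col2 C (ob X 0) (ob X 1) (ob Y 0) (inv\<^bsub>Hom C (ob X 0) (ob X 1)\<^esub> df X 0) (h 0)
               else if i < n then
                 mat22 C (ob X i) (ob Y (i-1)) (ob X (i+1)) (ob Y i)
                   (inv\<^bsub>Hom C (ob X i) (ob X (i+1))\<^esub> df X i) \<one>\<^bsub>Hom C (ob Y (i-1)) (ob X (i+1))\<^esub>
                   (h i) (df Y (i-1))
               else row2 C (ob X n) (ob Y (n-1)) (ob Y n) (h n) (df Y (n-1))\<rparr>"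


section \<open>Exact realizations\<close>

text \<open>
  The equations between sets are exactness of the two sequences, evaluated at an object \<open>W\<close>,
  at each term other than the first and the last.
\<close>

definition n_exangle :: "nat \<Rightarrow> ('o, 'm) acat \<Rightarrow> ('o, 'm, 'e) bifun \<Rightarrow> ('o, 'm) cpx \<Rightarrow> 'e \<Rightarrow> bool"
  where
  "n_exangle n C E X \<delta> \<longleftrightarrow> is_cpx n C X \<and> \<delta> \<in> carrier (Ext E (ob X (n+1)) (ob X 0)) \<and>
     (\<forall>W\<in>Ob C.
        (\<forall>i. 1 \<le> i \<and> i \<le> n \<longrightarrow>
           {f \<in> carrier (Hom C W (ob X i)). df X i \<cdot>\<^bsub>C\<^esub> f = \<one>\<^bsub>Hom C W (ob X (i+1))\<^esub>} =
           (\<lambda>g. df X (i-1) \<cdot>\<^bsub>C\<^esub> g) ` carrier (Hom C W (ob X (i-1)))) \<and>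
        {f \<in> carrier (Hom C W (ob X (n+1))). pull C E (ob X 0) f \<delta> = \<one>\<^bsub>Ext E W (ob X 0)\<^esub>} =
          (\<lambda>g. df X n \<cdot>\<^bsub>C\<^esub> g) ` carrier (Hom C W (ob X n)) \<and>
        (\<forall>i. 1 \<le> i \<and> i \<le> n \<longrightarrow>
           {f \<in> carrier (Hom C (ob X i) W). f \<cdot>\<^bsub>C\<^esub> df X (i-1) = \<one>\<^bsub>Hom C (ob X (i-1)) W\<^esub>} =
           (\<lambda>g. g \<cdot>\<^bsub>C\<^esub> df X i) ` carrier (Hom C (ob X (i+1)) W)) \<and>
        {f \<in> carrier (Hom C (ob X 0) W).
             push C E (ob X (n+1)) f \<delta> = \<one>\<^bsub>Ext E (ob X (n+1)) W\<^esub>} =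
          (\<lambda>g. g \<cdot>\<^bsub>C\<^esub> df X 0) ` carrier (Hom C (ob X 1) W))"

definition exangle_mor :: "nat \<Rightarrow> ('o, 'm) acat \<Rightarrow> ('o, 'm, 'e) bifun \<Rightarrow> ('o, 'm) cpx \<Rightarrow> 'e
    \<Rightarrow> ('o, 'm) cpx \<Rightarrow> 'e \<Rightarrow> (nat \<Rightarrow> 'm) \<Rightarrow> bool" where
  "exangle_mor n C E X \<delta> Y \<rho> f \<longleftrightarrow> cpx_mor n C X Y f \<and>
     push C E (ob X (n+1)) (f 0) \<delta> = pull C E (ob Y 0) (f (n+1)) \<rho>"

text \<open>
  A realization is a function \<open>s\<close> with \<open>s Z A \<delta>\<close> the homotopy class assigned to
  \<open>\<delta> \<in> \<E>(Z, A)\<close>. \<open>distinguished n C E s\<close> is the class of all pairs \<open>(X, \<delta>)\<close> with \<open>s(\<delta>) = [X]\<close>.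
\<close>

type_synonym ('o, 'm, 'e) realiz = "'o \<Rightarrow> 'o \<Rightarrow> 'e \<Rightarrow> ('o, 'm) cpx set"

definition distinguished :: "nat \<Rightarrow> ('o, 'm) acat \<Rightarrow> ('o, 'm, 'e) bifun \<Rightarrow> ('o, 'm, 'e) realiz
    \<Rightarrow> (('o, 'm) cpx \<times> 'e) set" where
  "distinguished n C E s = {(X, \<delta>). is_cpx n C X \<and> \<delta> \<in> carrier (Ext E (ob X (n+1)) (ob X 0)) \<and>
     s (ob X (n+1)) (ob X 0) \<delta> = hclass n C (ob X 0) (ob X (n+1)) X}"

definition inflations :: "(('o, 'm) cpx \<times> 'e) set \<Rightarrow> 'm set" where
  "inflations \<xi> = {df X 0 | X \<delta>. (X, \<delta>) \<in> \<xi>}"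

definition deflations :: "nat \<Rightarrow> (('o, 'm) cpx \<times> 'e) set \<Rightarrow> 'm set" where
  "deflations n \<xi> = {df X n | X \<delta>. (X, \<delta>) \<in> \<xi>}"

text \<open>The complexes \<open>A = A \<rightarrow> 0 \<rightarrow> \<dots> \<rightarrow> 0\<close> and \<open>0 \<rightarrow> \<dots> \<rightarrow> 0 \<rightarrow> A = A\<close> for a zero object \<open>Z\<close>.\<close>

definition triv_left :: "('o, 'm) acat \<Rightarrow> 'o \<Rightarrow> 'o \<Rightarrow> ('o, 'm) cpx" where
  "triv_left C A Z =
     (let Q = (\<lambda>i. if i \<le> 1 then A else Z)
      in \<lparr>ob = Q, df = \<lambda>i. if i = 0 then Idm C A else \<one>\<^bsub>Hom C (Q i) (Q (i+1))\<^esub>\<rparr>)"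

definition triv_right :: "nat \<Rightarrow> ('o, 'm) acat \<Rightarrow> 'o \<Rightarrow> 'o \<Rightarrow> ('o, 'm) cpx" where
  "triv_right n C A Z =
     (let Q = (\<lambda>i. if i < n then Z else A)
      in \<lparr>ob = Q, df = \<lambda>i. if i = n then Idm C A else \<one>\<^bsub>Hom C (Q i) (Q (i+1))\<^esub>\<rparr>)"

locale realization = additive_bifunctor C E
  for C :: "('o, 'm) acat" and E :: "('o, 'm, 'e) bifun" +
  fixes n :: nat and s :: "('o, 'm, 'e) realiz"
  assumes realizes: "\<lbrakk>A \<in> Ob C; Z \<in> Ob C; \<delta> \<in> carrier (Ext E Z A)\<rbrakk>
        \<Longrightarrow> \<exists>X\<in>cpx_between n C A Z. s Z A \<delta> = hclass n C A Z X"
    and R0: "\<lbrakk>(X, \<delta>) \<in> distinguished n C E s; (Y, \<rho>) \<in> distinguished n C E s;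
        ext_mor C E (ob X (n+1)) (ob X 0) \<delta> (ob Y (n+1)) (ob Y 0) \<rho> a c\<rbrakk>
        \<Longrightarrow> \<exists>f. cpx_mor n C X Y f \<and> f 0 = a \<and> f (n+1) = c"

locale exact_realization = realization C E n s
  for C :: "('o, 'm) acat" and E :: "('o, 'm, 'e) bifun" and n :: nat
    and s :: "('o, 'm, 'e) realiz" +
  assumes R1: "(X, \<delta>) \<in> distinguished n C E s \<Longrightarrow> n_exangle n C E X \<delta>"
    and R2_left: "\<lbrakk>A \<in> Ob C; zero_object C Z\<rbrakk>
        \<Longrightarrow> s Z A \<one>\<^bsub>Ext E Z A\<^esub> = hclass n C A Z (triv_left C A Z)"
    and R2_right: "\<lbrakk>A \<in> Ob C; zero_object C Z\<rbrakk>
        \<Longrightarrow> s A Z \<one>\<^bsub>Ext E A Z\<^esub> = hclass n C Z A (triv_right n C A Z)"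


section \<open>\<open>n\<close>-exangulated categories\<close>

locale n_exangulated_category = exact_realization C E n s
  for C :: "('o, 'm) acat" and E :: "('o, 'm, 'e) bifun" and n :: nat
    and s :: "('o, 'm, 'e) realiz" +
  assumes EA1_inflation: "\<lbrakk>A \<in> Ob C; B \<in> Ob C; D \<in> Ob C;
        f \<in> carrier (Hom C A B); g \<in> carrier (Hom C B D);
        f \<in> inflations (distinguished n C E s); g \<in> inflations (distinguished n C E s)\<rbrakk>
        \<Longrightarrow> g \<cdot>\<^bsub>C\<^esub> f \<in> inflations (distinguished n C E s)"
    and EA1_deflation: "\<lbrakk>A \<in> Ob C; B \<in> Ob C; D \<in> Ob C;
        f \<in> carrier (Hom C A B); g \<in> carrier (Hom C B D);
        f \<in> deflations n (distinguished n C E s); g \<in> deflations n (distinguished n C E s)\<rbrakk>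
        \<Longrightarrow> g \<cdot>\<^bsub>C\<^esub> f \<in> deflations n (distinguished n C E s)"
    and EA2: "\<lbrakk>(X, pull C E (ob Y 0) c \<rho>) \<in> distinguished n C E s; (Y, \<rho>) \<in> distinguished n C E s;
        ob X 0 = ob Y 0; c \<in> carrier (Hom C (ob X (n+1)) (ob Y (n+1)))\<rbrakk>
        \<Longrightarrow> \<exists>f. cpx_mor n C X Y f \<and> f 0 = Idm C (ob X 0) \<and> f (n+1) = c \<and>
              (mapping_cone n C X Y f, push C E (ob Y (n+1)) (df X 0) \<rho>) \<in> distinguished n C E s"
    and EA2_op: "\<lbrakk>(X, \<rho>) \<in> distinguished n C E s; (Y, push C E (ob X (n+1)) a \<rho>) \<in> distinguished n C E s;
        ob X (n+1) = ob Y (n+1); a \<in> carrier (Hom C (ob X 0) (ob Y 0))\<rbrakk>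
        \<Longrightarrow> \<exists>h. cpx_mor n C X Y h \<and> h 0 = a \<and> h (n+1) = Idm C (ob X (n+1)) \<and>
              (mapping_cocone n C X Y h, pull C E (ob X 0) (df Y n) \<rho>) \<in> distinguished n C E s"


section \<open>\<open>n\<close>-proper classes\<close>

definition weak_isomorphism :: "nat \<Rightarrow> ('o, 'm) acat \<Rightarrow> ('o, 'm, 'e) bifun \<Rightarrow> ('o, 'm) cpx \<Rightarrow> 'e
    \<Rightarrow> ('o, 'm) cpx \<Rightarrow> 'e \<Rightarrow> (nat \<Rightarrow> 'm) \<Rightarrow> bool" where
  "weak_isomorphism n C E X \<delta> Y \<rho> f \<longleftrightarrow> exangle_mor n C E X \<delta> Y \<rho> f \<and>
     isomorphism C (ob X 0) (ob Y 0) (f 0) \<and> isomorphism C (ob X (n+1)) (ob Y (n+1)) (f (n+1))"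

definition closed_under_weak_isos :: "nat \<Rightarrow> ('o, 'm) acat \<Rightarrow> ('o, 'm, 'e) bifun
    \<Rightarrow> ('o, 'm, 'e) realiz \<Rightarrow> (('o, 'm) cpx \<times> 'e) set \<Rightarrow> bool" where
  "closed_under_weak_isos n C E s \<xi> \<longleftrightarrow>
     (\<forall>X \<delta> Y \<rho> f. (X, \<delta>) \<in> distinguished n C E s \<and> (Y, \<rho>) \<in> distinguished n C E s \<and>
        weak_isomorphism n C E X \<delta> Y \<rho> f \<longrightarrow> ((X, \<delta>) \<in> \<xi> \<longleftrightarrow> (Y, \<rho>) \<in> \<xi>))"

definition split_exangles :: "nat \<Rightarrow> ('o, 'm) acat \<Rightarrow> ('o, 'm, 'e) bifun \<Rightarrow> ('o, 'm, 'e) realiz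
    \<Rightarrow> (('o, 'm) cpx \<times> 'e) set" where
  "split_exangles n C E s = {(X, \<delta>) \<in> distinguished n C E s. \<delta> = \<one>\<^bsub>Ext E (ob X (n+1)) (ob X 0)\<^esub>}"

text \<open>The empty coproduct is the zero exangle, which is split.\<close>

definition closed_under_coproducts :: "nat \<Rightarrow> ('o, 'm) acat \<Rightarrow> ('o, 'm, 'e) bifun
    \<Rightarrow> (('o, 'm) cpx \<times> 'e) set \<Rightarrow> bool" where
  "closed_under_coproducts n C E \<xi> \<longleftrightarrow>
     (\<forall>X \<delta> Y \<rho>. (X, \<delta>) \<in> \<xi> \<and> (Y, \<rho>) \<in> \<xi> \<longrightarrow>
        (cpx_sum C X Y, ext_sum C E (ob X (n+1)) (ob X 0) \<delta> (ob Y (n+1)) (ob Y 0) \<rho>) \<in> \<xi>)"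

definition closed_under_base_change :: "nat \<Rightarrow> ('o, 'm) acat \<Rightarrow> ('o, 'm, 'e) bifun
    \<Rightarrow> ('o, 'm, 'e) realiz \<Rightarrow> (('o, 'm) cpx \<times> 'e) set \<Rightarrow> bool" where
  "closed_under_base_change n C E s \<xi> \<longleftrightarrow>
     (\<forall>X \<delta> Y c. (X, \<delta>) \<in> \<xi> \<and> c \<in> carrier (Hom C (ob Y (n+1)) (ob X (n+1))) \<and>
        ob Y 0 = ob X 0 \<and> (Y, pull C E (ob X 0) c \<delta>) \<in> distinguished n C E s \<longrightarrow>
        (Y, pull C E (ob X 0) c \<delta>) \<in> \<xi>)"

definition closed_under_cobase_change :: "nat \<Rightarrow> ('o, 'm) acat \<Rightarrow> ('o, 'm, 'e) bifun
    \<Rightarrow> ('o, 'm, 'e) realiz \<Rightarrow> (('o, 'm) cpx \<times> 'e) set \<Rightarrow> bool" where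
  "closed_under_cobase_change n C E s \<xi> \<longleftrightarrow>
     (\<forall>X \<delta> Y a. (X, \<delta>) \<in> \<xi> \<and> a \<in> carrier (Hom C (ob X 0) (ob Y 0)) \<and>
        ob Y (n+1) = ob X (n+1) \<and> (Y, push C E (ob X (n+1)) a \<delta>) \<in> distinguished n C E s \<longrightarrow>
        (Y, push C E (ob X (n+1)) a \<delta>) \<in> \<xi>)"

definition saturated :: "nat \<Rightarrow> ('o, 'm) acat \<Rightarrow> ('o, 'm, 'e) bifun
    \<Rightarrow> ('o, 'm, 'e) realiz \<Rightarrow> (('o, 'm) cpx \<times> 'e) set \<Rightarrow> bool" where
  "saturated n C E s \<xi> \<longleftrightarrow>
     (\<forall>A\<in>Ob C. \<forall>B\<in>Ob C. \<forall>K\<in>Ob C. \<forall>D\<in>Ob C.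
      \<forall>a\<in>carrier (Hom C A B). \<forall>b\<in>carrier (Hom C B D).
      \<forall>c\<in>carrier (Hom C A K). \<forall>d\<in>carrier (Hom C K D).
        b \<cdot>\<^bsub>C\<^esub> a = d \<cdot>\<^bsub>C\<^esub> c \<and> {a, b, d} \<subseteq> deflations n (distinguished n C E s) \<and>
        a \<in> deflations n \<xi> \<and> b \<in> deflations n \<xi> \<longrightarrow> d \<in> deflations n \<xi>)"

definition n_proper_class :: "nat \<Rightarrow> ('o, 'm) acat \<Rightarrow> ('o, 'm, 'e) bifun
    \<Rightarrow> ('o, 'm, 'e) realiz \<Rightarrow> (('o, 'm) cpx \<times> 'e) set \<Rightarrow> bool" where
  "n_proper_class n C E s \<xi> \<longleftrightarrow> \<xi> \<subseteq> distinguished n C E s \<and>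
     split_exangles n C E s \<subseteq> \<xi> \<and>
     closed_under_weak_isos n C E s \<xi> \<and> closed_under_coproducts n C E \<xi> \<and>
     closed_under_base_change n C E s \<xi> \<and> closed_under_cobase_change n C E s \<xi> \<and>
     saturated n C E s \<xi>"

text \<open>
  The restrictions \<open>\<E>|\<^sub>\<xi>\<close> and \<open>\<s>|\<^sub>\<xi>\<close>. The group operation, the zero element and the action of morphisms
  are those of \<open>\<E>\<close>; only the carriers shrink.
\<close>

definition restrict_bifun :: "nat \<Rightarrow> ('o, 'm, 'e) bifun \<Rightarrow> (('o, 'm) cpx \<times> 'e) set
    \<Rightarrow> ('o, 'm, 'e) bifun" where
  "restrict_bifun n E \<xi> =
     E\<lparr>Ext := \<lambda>Z A. (Ext E Z A)\<lparr>carrier :=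
         {\<delta> \<in> carrier (Ext E Z A). \<exists>X. (X, \<delta>) \<in> \<xi> \<and> ob X 0 = A \<and> ob X (n+1) = Z}\<rparr>\<rparr>"

definition restrict_realiz :: "nat \<Rightarrow> ('o, 'm, 'e) bifun \<Rightarrow> ('o, 'm, 'e) realiz
    \<Rightarrow> (('o, 'm) cpx \<times> 'e) set \<Rightarrow> ('o, 'm, 'e) realiz" where
  "restrict_realiz n E s \<xi> = (\<lambda>Z A. restrict (s Z A) (carrier (Ext (restrict_bifun n E \<xi>) Z A)))"

end

theory Submission
  imports Defs
begin

text \<open>
  Only the groups \<open>\<E>(Z, A)\<close> shrink under the restriction, and the distinguished exangles of
  \<open>(\<C>, \<E>\<^sub>\<xi>, \<s>\<^sub>\<xi>)\<close> are exactly the members of \<open>\<xi>\<close> (lemma \<open>distinguished_restrict\<close>):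
  two realizations of one extension with the same ends are weakly isomorphic, so membership of
  \<open>\<langle>X, \<delta>\<rangle>\<close> in \<open>\<xi>\<close> depends on \<open>\<delta>\<close> alone. Most conditions then translate directly. Closure under
  base and cobase change says that \<open>\<E>\<^sub>\<xi>\<close> is stable under the action of morphisms. Together with direct
  sums, it also gives closure under addition, since
  \<open>\<delta> + \<epsilon>\<close> is \<open>\<delta> \<oplus> \<epsilon>\<close> pulled back along the diagonal and pushed forward along the codiagonal. The
  axioms (EA2) are inherited because the extension of a mapping (co)cone is a pushforward (pullback)
  of the given one.

  What remains is to compare saturation with (EA1), and to know that \<open>X \<oplus> Y\<close> realizes
  \<open>\<delta> \<oplus> \<rho>\<close>.

  Saturation is linked to compositions by the exactness of
  \<open>\<C>(X\<^sup>0, -) \<rightarrow> \<E>(X\<^sup>n\<^sup>+\<^sup>1, -) \<rightarrow> \<E>(X\<^sup>n, -)\<close> for a distinguished exangle (lemma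
  \<open>ext_killed_by_deflation\<close>): if \<open>d\<close> is a deflation of \<open>\<langle>V, \<nu>\<rangle>\<close> and some composite \<open>d c\<close> is a
  \<open>\<xi>\<close>-deflation of \<open>\<langle>U, \<mu>\<rangle>\<close>, then \<open>\<nu>\<close> dies under \<open>(d c)\<^sup>*\<close>, hence it is a pushforward of \<open>\<mu>\<close> and
  lies in \<open>\<E>\<^sub>\<xi>\<close> (lemma \<open>deflation_factor_in_class\<close>). So composition of \<open>\<xi>\<close>-deflations implies
  saturation. Conversely, saturation for the square \<open>g f = (g f) 1\<close> gives composition of
  \<open>\<xi>\<close>-deflations. For \<open>\<xi>\<close>-inflations \<open>f\<close> of \<open>\<langle>X, \<delta>\<rangle>\<close> and \<open>g\<close> of \<open>\<langle>Y, \<rho>\<rangle>\<close> whose composite starts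
  \<open>\<langle>Z, \<tau>\<rangle>\<close>, the dual exact sequence yields \<open>c\<close> with \<open>\<delta> = c\<^sup>* \<tau>\<close> and \<open>e\<close> with
  \<open>f\<^sub>* \<tau> = e\<^sup>* \<rho>\<close>; by (EA2) the last map \<open>[c  d\<^sub>Z]\<close> of the cone of a lift of \<open>(1, c)\<close> is a
  \<open>\<xi>\<close>-deflation, and composing it with \<open>d\<^sub>X \<oplus> 1\<close> gives a map that factors through \<open>d\<^sub>Z\<close>.
  Saturation makes \<open>d\<^sub>Z\<close> a \<open>\<xi>\<close>-deflation (lemma \<open>inflation_cmp_in_class\<close>).

  Direct sums are settled by homotopy theory (lemma \<open>cpx_sum_distinguished\<close>). If \<open>W\<close> realizes
  \<open>\<delta> \<oplus> \<rho>\<close>, lifting the injections and projections gives chain maps between \<open>X \<oplus> Y\<close> and \<open>W\<close>, in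
  both directions, that are identities at the ends. For complexes whose image under \<open>\<C>(-, T)\<close> is exact in
  the middle degrees for every object \<open>T\<close>, this already forces a homotopy equivalence: an endomorphism vanishing at both ends
  has null-homotopic square, so a composite \<open>u\<close> of the two maps satisfies \<open>2 u - u\<^sup>2 \<simeq> 1\<close>.
\<close>

section \<open>One-sorted calculus of morphisms\<close>

text \<open>
  A morphism determines its source \<open>dm\<close> and its target \<open>cd\<close>. Writing sums with the group read off
  from the summands makes all typing conditions equations between objects, which the
  simplifier discharges; the laws below are conditional rewrite rules of this form.
\<close>

context additive_category
begin

abbreviation cmp :: "'m \<Rightarrow> 'm \<Rightarrow> 'm"  (infixl \<open>\<bullet>\<close> 75) where
  "g \<bullet> f \<equiv> g \<cdot>\<^bsub>C\<^esub> f"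

definition arr :: "'m \<Rightarrow> bool" where
  "arr f \<longleftrightarrow> (\<exists>A\<in>Ob C. \<exists>B\<in>Ob C. f \<in> carrier (Hom C A B))"

definition dm :: "'m \<Rightarrow> 'o" where
  "dm f = (THE A. A \<in> Ob C \<and> (\<exists>B\<in>Ob C. f \<in> carrier (Hom C A B)))"

definition cd :: "'m \<Rightarrow> 'o" where
  "cd f = (THE B. B \<in> Ob C \<and> (\<exists>A\<in>Ob C. f \<in> carrier (Hom C A B)))"

definition pl :: "'m \<Rightarrow> 'm \<Rightarrow> 'm"  (infixl \<open>\<boxplus>\<close> 65) where
  "f \<boxplus> g = f \<otimes>\<^bsub>Hom C (dm f) (cd f)\<^esub> g"

definition mi :: "'m \<Rightarrow> 'm" where
  "mi f = inv\<^bsub>Hom C (dm f) (cd f)\<^esub> f"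

abbreviation zr :: "'o \<Rightarrow> 'o \<Rightarrow> 'm" where
  "zr A B \<equiv> \<one>\<^bsub>Hom C A B\<^esub>"

lemma dm_cd_eq:
  assumes "A \<in> Ob C" "B \<in> Ob C" "f \<in> carrier (Hom C A B)"
  shows "arr f" "dm f = A" "cd f = B"
proof -
  show "arr f" using assms by (auto simp: arr_def)
  show "dm f = A" unfolding dm_def
    by (rule the_equality) (use assms Hom_disjoint in blast)+
  show "cd f = B" unfolding cd_def
    by (rule the_equality) (use assms Hom_disjoint in blast)+
qed

lemma arrE:
  assumes "arr f"
  shows "dm f \<in> Ob C" "cd f \<in> Ob C" "f \<in> carrier (Hom C (dm f) (cd f))"
  using assms dm_cd_eq unfolding arr_def by metis+

lemmas dm_Ob [simp] = arrE(1) and cd_Ob [simp] = arrE(2)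

lemma in_Hom_iff:
  "\<lbrakk>A \<in> Ob C; B \<in> Ob C\<rbrakk> \<Longrightarrow> f \<in> carrier (Hom C A B) \<longleftrightarrow> arr f \<and> dm f = A \<and> cd f = B"
  using dm_cd_eq[of A B f] arrE(3)[of f] by auto

lemma mult_Hom [simp]:
  "\<lbrakk>dm f = A; cd f = B\<rbrakk> \<Longrightarrow> f \<otimes>\<^bsub>Hom C A B\<^esub> g = f \<boxplus> g"
  by (simp add: pl_def)

lemma inv_Hom [simp]:
  "\<lbrakk>dm f = A; cd f = B\<rbrakk> \<Longrightarrow> inv\<^bsub>Hom C A B\<^esub> f = mi f"
  by (simp add: mi_def)

lemma Hom_comm_group: "arr f \<Longrightarrow> comm_group (Hom C (dm f) (cd f))"
  by (simp add: Hom_group)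

lemma arr_simps [simp]:
  "A \<in> Ob C \<Longrightarrow> arr (Idm C A)" "A \<in> Ob C \<Longrightarrow> dm (Idm C A) = A" "A \<in> Ob C \<Longrightarrow> cd (Idm C A) = A"
  "\<lbrakk>A \<in> Ob C; B \<in> Ob C\<rbrakk> \<Longrightarrow> arr (zr A B)"
  "\<lbrakk>A \<in> Ob C; B \<in> Ob C\<rbrakk> \<Longrightarrow> dm (zr A B) = A"
  "\<lbrakk>A \<in> Ob C; B \<in> Ob C\<rbrakk> \<Longrightarrow> cd (zr A B) = B"
proof -
  show "A \<in> Ob C \<Longrightarrow> arr (Idm C A)" "A \<in> Ob C \<Longrightarrow> dm (Idm C A) = A" "A \<in> Ob C \<Longrightarrow> cd (Idm C A) = A"
    using dm_cd_eq Id_in_Hom by blast+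
  have "\<lbrakk>A \<in> Ob C; B \<in> Ob C\<rbrakk> \<Longrightarrow> zr A B \<in> carrier (Hom C A B)"
    using Hom_group by (simp add: comm_group_def group_def comm_monoid_def monoid.one_closed)
  then show "\<lbrakk>A \<in> Ob C; B \<in> Ob C\<rbrakk> \<Longrightarrow> arr (zr A B)"
    "\<lbrakk>A \<in> Ob C; B \<in> Ob C\<rbrakk> \<Longrightarrow> dm (zr A B) = A"
    "\<lbrakk>A \<in> Ob C; B \<in> Ob C\<rbrakk> \<Longrightarrow> cd (zr A B) = B"
    using dm_cd_eq by blast+
qed

lemma cmp_simps [simp]:
  assumes "arr f" "arr g" "dm g = cd f"
  shows "arr (g \<bullet> f)" "dm (g \<bullet> f) = dm f" "cd (g \<bullet> f) = cd g"
proof -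
  have "g \<bullet> f \<in> carrier (Hom C (dm f) (cd g))"
    using Comp_in_Hom[of "dm f" "cd f" "cd g" f g] assms arrE by metis
  then show "arr (g \<bullet> f)" "dm (g \<bullet> f) = dm f" "cd (g \<bullet> f) = cd g"
    using dm_cd_eq assms by (meson dm_Ob cd_Ob)+
qed

lemma pl_simps [simp]:
  assumes "arr f" "arr g" "dm f = dm g" "cd f = cd g"
  shows "arr (f \<boxplus> g)" "dm (f \<boxplus> g) = dm g" "cd (f \<boxplus> g) = cd g"
proof -
  interpret G: comm_group "Hom C (dm g) (cd g)" using Hom_comm_group assms by blast
  have "f \<boxplus> g \<in> carrier (Hom C (dm g) (cd g))"
    using assms arrE(3)[of f] arrE(3)[of g] G.m_closed[of f g] unfolding pl_def by metis
  then show "arr (f \<boxplus> g)" "dm (f \<boxplus> g) = dm g" "cd (f \<boxplus> g) = cd g"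
    using dm_cd_eq assms by (meson dm_Ob cd_Ob)+
qed

lemma mi_simps [simp]:
  assumes "arr f"
  shows "arr (mi f)" "dm (mi f) = dm f" "cd (mi f) = cd f"
proof -
  interpret G: comm_group "Hom C (dm f) (cd f)" using Hom_comm_group assms by blast
  have "mi f \<in> carrier (Hom C (dm f) (cd f))"
    using assms arrE(3)[of f] G.inv_closed[of f] unfolding mi_def by metis
  then show "arr (mi f)" "dm (mi f) = dm f" "cd (mi f) = cd f"
    using dm_cd_eq assms by (meson dm_Ob cd_Ob)+
qed

lemma pl_assoc:
  assumes "arr f" "arr g" "arr h" "dm f = dm g" "cd f = cd g" "dm h = dm g" "cd h = cd g"
  shows "(f \<boxplus> g) \<boxplus> h = f \<boxplus> (g \<boxplus> h)"
proof -
  interpret G: comm_group "Hom C (dm g) (cd g)" using Hom_comm_group assms by blast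
  have "f \<in> carrier (Hom C (dm g) (cd g))" "g \<in> carrier (Hom C (dm g) (cd g))"
    "h \<in> carrier (Hom C (dm g) (cd g))"
    using assms arrE(3)[of f] arrE(3)[of g] arrE(3)[of h] by simp_all
  from G.m_assoc[OF this] assms show ?thesis by simp
qed

lemma pl_comm:
  assumes "arr f" "arr g" "dm f = dm g" "cd f = cd g"
  shows "f \<boxplus> g = g \<boxplus> f"
proof -
  interpret G: comm_group "Hom C (dm g) (cd g)" using Hom_comm_group assms by blast
  have "f \<in> carrier (Hom C (dm g) (cd g))" "g \<in> carrier (Hom C (dm g) (cd g))"
    using assms arrE(3)[of f] arrE(3)[of g] by simp_all
  from G.m_comm[OF this] assms show ?thesis by simp
qed

lemma pl_left_comm:
  assumes "arr f" "arr g" "arr h" "dm f = dm g" "cd f = cd g" "dm h = dm g" "cd h = cd g"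
  shows "f \<boxplus> (g \<boxplus> h) = g \<boxplus> (f \<boxplus> h)"
proof -
  have "f \<boxplus> (g \<boxplus> h) = (g \<boxplus> f) \<boxplus> h"
    using assms by (simp add: pl_assoc[symmetric] pl_comm[of f g])
  with assms show ?thesis by (simp add: pl_assoc)
qed

lemma pl_zr [simp]:
  assumes "arr f" "dm f = A" "cd f = B"
  shows "f \<boxplus> zr A B = f" "zr A B \<boxplus> f = f"
proof -
  interpret G: comm_group "Hom C (dm f) (cd f)" using Hom_comm_group assms by blast
  have "f \<in> carrier (Hom C A B)" using arrE(3) assms by blast
  then show "f \<boxplus> zr A B = f" "zr A B \<boxplus> f = f" using assms
    G.r_one G.l_one pl_def
    by (metis arrE(1,2) arr_simps(5,6))+
qed

lemma pl_mi [simp]: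
  assumes "arr f"
  shows "f \<boxplus> mi f = zr (dm f) (cd f)" "mi f \<boxplus> f = zr (dm f) (cd f)"
proof -
  interpret G: comm_group "Hom C (dm f) (cd f)" using Hom_comm_group assms by blast
  show "f \<boxplus> mi f = zr (dm f) (cd f)" "mi f \<boxplus> f = zr (dm f) (cd f)"
    using assms arrE(3)[of f] G.r_inv[of f] G.l_inv[of f]
    unfolding pl_def by (simp_all add: mi_def[symmetric])
qed

lemma pl_mi_cancel [simp]:
  assumes "arr f" "arr g" "dm f = dm g" "cd f = cd g"
  shows "f \<boxplus> (mi f \<boxplus> g) = g" "mi f \<boxplus> (f \<boxplus> g) = g"
  using assms by (simp_all add: pl_assoc[symmetric])

lemma mi_unique:
  assumes "arr f" "arr g" "dm f = dm g" "cd f = cd g" "f \<boxplus> g = zr (dm g) (cd g)"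
  shows "mi f = g"
proof -
  have "mi f = mi f \<boxplus> (f \<boxplus> g)" using assms by simp
  also have "\<dots> = g" using assms(1-4) by (simp only: pl_mi_cancel)
  finally show ?thesis .
qed

lemma mi_mi [simp]: "arr f \<Longrightarrow> mi (mi f) = f"
  by (rule mi_unique) simp_all

lemma mi_zr [simp]: "\<lbrakk>A \<in> Ob C; B \<in> Ob C\<rbrakk> \<Longrightarrow> mi (zr A B) = zr A B"
  by (rule mi_unique) simp_all

lemma mi_pl [simp]:
  assumes "arr f" "arr g" "dm f = dm g" "cd f = cd g"
  shows "mi (f \<boxplus> g) = mi f \<boxplus> mi g"
proof (rule mi_unique)
  have "g \<boxplus> (mi f \<boxplus> mi g) = mi f"
    using assms pl_left_comm[of g "mi f" "mi g"] by simp
  then show "f \<boxplus> g \<boxplus> (mi f \<boxplus> mi g) = zr (dm (mi f \<boxplus> mi g)) (cd (mi f \<boxplus> mi g))"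
    using assms by (simp add: pl_assoc)
qed (use assms in simp_all)

lemma cmp_assoc [simp]:
  assumes "arr f" "arr g" "arr h" "dm g = cd f" "dm h = cd g"
  shows "(h \<bullet> g) \<bullet> f = h \<bullet> (g \<bullet> f)"
  using Comp_assoc[of "dm f" "cd f" "cd g" "cd h" f g h] assms arrE by metis

lemma cmp_Id [simp]:
  "\<lbrakk>arr f; dm f = A\<rbrakk> \<Longrightarrow> f \<bullet> Idm C A = f" "\<lbrakk>arr f; cd f = A\<rbrakk> \<Longrightarrow> Idm C A \<bullet> f = f"
  using Comp_Id[of "dm f" "cd f" f] Id_Comp[of "dm f" "cd f" f] arrE by metis+

lemma cmp_pl_left [simp]:
  assumes "arr f" "arr g" "arr h" "dm g = cd f" "dm h = cd f" "cd g = cd h"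
  shows "(g \<boxplus> h) \<bullet> f = (g \<bullet> f) \<boxplus> (h \<bullet> f)"
  using Comp_add_left[of "dm f" "cd f" "cd g" f g h] assms arrE(3)[of f] arrE(3)[of g] arrE(3)[of h]
  by simp

lemma cmp_pl_right [simp]:
  assumes "arr f" "arr g" "arr h" "cd f = dm h" "cd g = dm h" "dm g = dm f"
  shows "h \<bullet> (f \<boxplus> g) = (h \<bullet> f) \<boxplus> (h \<bullet> g)"
  using Comp_add_right[of "dm f" "cd f" "cd h" f g h] assms arrE(3)[of f] arrE(3)[of g] arrE(3)[of h]
  by simp

lemma pl_idem:
  assumes "arr f" "f \<boxplus> f = f" shows "f = zr (dm f) (cd f)"
proof -
  have "f = mi f \<boxplus> (f \<boxplus> f)" using assms(1) by (simp only: pl_mi_cancel)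
  also have "\<dots> = zr (dm f) (cd f)" using assms by simp
  finally show ?thesis .
qed

lemma cmp_zr [simp]:
  assumes "arr f" "B \<in> Ob C"
  shows "dm f = A \<Longrightarrow> f \<bullet> zr B A = zr B (cd f)" "cd f = A \<Longrightarrow> zr A B \<bullet> f = zr (dm f) B"
proof -
  show "f \<bullet> zr B A = zr B (cd f)" if "dm f = A"
  proof -
    have A: "A \<in> Ob C" using that assms by auto
    have "f \<bullet> zr B A \<boxplus> f \<bullet> zr B A = f \<bullet> (zr B A \<boxplus> zr B A)"
      using assms that A by (simp del: pl_zr)
    then show ?thesis using pl_idem[of "f \<bullet> zr B A"] assms that A by simp
  qed
  show "zr A B \<bullet> f = zr (dm f) B" if "cd f = A"
  proof -
    have A: "A \<in> Ob C" using that assms by auto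
    have "zr A B \<bullet> f \<boxplus> zr A B \<bullet> f = (zr A B \<boxplus> zr A B) \<bullet> f"
      using assms that A by (simp del: pl_zr)
    then show ?thesis using pl_idem[of "zr A B \<bullet> f"] assms that A by simp
  qed
qed

lemma cmp_mi [simp]:
  assumes "arr f" "arr g" "dm g = cd f"
  shows "g \<bullet> mi f = mi (g \<bullet> f)" "mi g \<bullet> f = mi (g \<bullet> f)"
proof -
  have "g \<bullet> f \<boxplus> g \<bullet> mi f = g \<bullet> (f \<boxplus> mi f)" using assms by (simp del: pl_mi)
  then show "g \<bullet> mi f = mi (g \<bullet> f)" using mi_unique[of "g \<bullet> f" "g \<bullet> mi f"] assms by simp
  have "g \<bullet> f \<boxplus> mi g \<bullet> f = (g \<boxplus> mi g) \<bullet> f" using assms by (simp del: pl_mi)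
  then show "mi g \<bullet> f = mi (g \<bullet> f)" using mi_unique[of "g \<bullet> f" "mi g \<bullet> f"] assms by simp
qed

text \<open>
  Composites are normalized to the right, so an equation for \<open>g \<bullet> f\<close> does not match inside
  \<open>g \<bullet> (f \<bullet> h)\<close>; this is its form for such contexts.
\<close>

lemma cmp_rewrite:
  assumes "g \<bullet> f = k" "arr f" "arr g" "arr h" "dm g = cd f" "dm f = cd h"
  shows "g \<bullet> (f \<bullet> h) = k \<bullet> h"
  using assms cmp_assoc[of h f g] by simp

subsection \<open>Biproducts\<close>

lemma bip: "\<lbrakk>A \<in> Ob C; B \<in> Ob C\<rbrakk> \<Longrightarrow> biproduct C A B (bip C A B)"
  unfolding bip_def using ex_biproduct by (rule someI_ex)

lemma osum_Ob [simp]: "\<lbrakk>A \<in> Ob C; B \<in> Ob C\<rbrakk> \<Longrightarrow> osum C A B \<in> Ob C"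
  using bip by (simp add: biproduct_def osum_def)

abbreviation "i1 A B \<equiv> in1 (bip C A B)"
abbreviation "i2 A B \<equiv> in2 (bip C A B)"
abbreviation "p1 A B \<equiv> pr1 (bip C A B)"
abbreviation "p2 A B \<equiv> pr2 (bip C A B)"

lemma bip_simps [simp]:
  assumes "A \<in> Ob C" "B \<in> Ob C"
  shows "arr (i1 A B)" "dm (i1 A B) = A" "cd (i1 A B) = osum C A B"
    "arr (i2 A B)" "dm (i2 A B) = B" "cd (i2 A B) = osum C A B"
    "arr (p1 A B)" "dm (p1 A B) = osum C A B" "cd (p1 A B) = A"
    "arr (p2 A B)" "dm (p2 A B) = osum C A B" "cd (p2 A B) = B"
    "p1 A B \<bullet> i1 A B = Idm C A" "p2 A B \<bullet> i2 A B = Idm C B"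
    "p1 A B \<bullet> i2 A B = zr B A" "p2 A B \<bullet> i1 A B = zr A B"
    "i1 A B \<bullet> p1 A B \<boxplus> i2 A B \<bullet> p2 A B = Idm C (osum C A B)"
proof -
  have b: "biproduct C A B (bip C A B)" and S: "osum C A B \<in> Ob C" using assms bip by auto
  note b = b[unfolded biproduct_def, folded osum_def]
  from b assms S show *: "arr (i1 A B)" "dm (i1 A B) = A" "cd (i1 A B) = osum C A B"
    "arr (i2 A B)" "dm (i2 A B) = B" "cd (i2 A B) = osum C A B"
    "arr (p1 A B)" "dm (p1 A B) = osum C A B" "cd (p1 A B) = A"
    "arr (p2 A B)" "dm (p2 A B) = osum C A B" "cd (p2 A B) = B"
    "p1 A B \<bullet> i1 A B = Idm C A" "p2 A B \<bullet> i2 A B = Idm C B"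
    "p1 A B \<bullet> i2 A B = zr B A" "p2 A B \<bullet> i1 A B = zr A B"
    by (simp_all add: in_Hom_iff)
  show "i1 A B \<bullet> p1 A B \<boxplus> i2 A B \<bullet> p2 A B = Idm C (osum C A B)"
    using b * by simp
qed

lemma bip_comp_simps [simp]:
  assumes "A \<in> Ob C" "B \<in> Ob C" "arr f"
  shows "cd f = A \<Longrightarrow> p1 A B \<bullet> (i1 A B \<bullet> f) = f" "cd f = B \<Longrightarrow> p2 A B \<bullet> (i2 A B \<bullet> f) = f"
    "cd f = B \<Longrightarrow> p1 A B \<bullet> (i2 A B \<bullet> f) = zr (dm f) A"
    "cd f = A \<Longrightarrow> p2 A B \<bullet> (i1 A B \<bullet> f) = zr (dm f) B"
  using assms cmp_rewrite[OF bip_simps(13), of A B f] cmp_rewrite[OF bip_simps(14), of A B f]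
    cmp_rewrite[OF bip_simps(15), of A B f] cmp_rewrite[OF bip_simps(16), of A B f] by simp_all

lemma row2_eq [simp]:
  "\<lbrakk>A \<in> Ob C; B \<in> Ob C; arr f; arr g; dm f = A; dm g = B; cd f = W; cd g = W\<rbrakk>
    \<Longrightarrow> row2 C A B W f g = f \<bullet> p1 A B \<boxplus> g \<bullet> p2 A B"
  by (simp add: row2_def)

lemma col2_eq [simp]:
  "\<lbrakk>A \<in> Ob C; B \<in> Ob C; arr f; arr g; cd f = A; cd g = B; dm f = W; dm g = W\<rbrakk>
    \<Longrightarrow> col2 C W A B f g = i1 A B \<bullet> f \<boxplus> i2 A B \<bullet> g"
  by (simp add: col2_def)

lemma from_osum_eqI:
  assumes "arr f" "arr g" "A \<in> Ob C" "B \<in> Ob C" "dm f = osum C A B" "dm g = osum C A B"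
    and "f \<bullet> i1 A B = g \<bullet> i1 A B" "f \<bullet> i2 A B = g \<bullet> i2 A B" "cd f = cd g"
  shows "f = g"
proof -
  have *: "h = (h \<bullet> i1 A B) \<bullet> p1 A B \<boxplus> (h \<bullet> i2 A B) \<bullet> p2 A B" if "arr h" "dm h = osum C A B" for h
  proof -
    have "h = h \<bullet> (i1 A B \<bullet> p1 A B \<boxplus> i2 A B \<bullet> p2 A B)" using that assms(3,4) by simp
    also have "\<dots> = (h \<bullet> i1 A B) \<bullet> p1 A B \<boxplus> (h \<bullet> i2 A B) \<bullet> p2 A B"
      using that assms(3,4) by (simp del: bip_simps(17))
    finally show ?thesis .
  qed
  from *[of f] *[of g] assms show ?thesis by metis
qed

section \<open>Complexes up to homotopy\<close>

definition graded :: "nat \<Rightarrow> ('o, 'm) cpx \<Rightarrow> ('o, 'm) cpx \<Rightarrow> (nat \<Rightarrow> 'm) \<Rightarrow> bool" where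
  "graded n X Y f \<longleftrightarrow> (\<forall>i\<le>Suc n. arr (f i) \<and> dm (f i) = ob X i \<and> cd (f i) = ob Y i)"

text \<open>
  Families \<open>h\<^sup>i : X\<^sup>i \<rightarrow> Y\<^sup>i\<^sup>-\<^sup>1\<close> for \<open>1 \<le> i \<le> n + 1\<close>, indexed through \<open>Suc\<close> to avoid truncated
  subtraction.
\<close>

definition graded_down :: "nat \<Rightarrow> ('o, 'm) cpx \<Rightarrow> ('o, 'm) cpx \<Rightarrow> (nat \<Rightarrow> 'm) \<Rightarrow> bool" where
  "graded_down n X Y h \<longleftrightarrow>
     (\<forall>i\<le>n. arr (h (Suc i)) \<and> dm (h (Suc i)) = ob X (Suc i) \<and> cd (h (Suc i)) = ob Y i)"

text \<open>
  \<open>bd n X Y h\<close> is the boundary \<open>d h + h d\<close>; at the two ends the missing summand is zero. Uniform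
  formulas in \<open>i\<close> replace the three clauses of the homotopy relation.
\<close>

definition bd :: "nat \<Rightarrow> ('o, 'm) cpx \<Rightarrow> ('o, 'm) cpx \<Rightarrow> (nat \<Rightarrow> 'm) \<Rightarrow> nat \<Rightarrow> 'm" where
  "bd n X Y h i =
     (if i = 0 then zr (ob X 0) (ob Y 0) else df Y (i - 1) \<bullet> h i) \<boxplus>
     (if i = Suc n then zr (ob X i) (ob Y i) else h (Suc i) \<bullet> df X i)"

lemma is_cpx_iff:
  "is_cpx n C X \<longleftrightarrow> (\<forall>i\<le>Suc n. ob X i \<in> Ob C) \<and>
     (\<forall>i\<le>n. arr (df X i) \<and> dm (df X i) = ob X i \<and> cd (df X i) = ob X (Suc i)) \<and>
     (\<forall>i<n. df X (Suc i) \<bullet> df X i = zr (ob X i) (ob X (Suc (Suc i))))"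
  unfolding is_cpx_def by (auto simp: in_Hom_iff)

lemma is_cpxD:
  assumes "is_cpx n C X"
  shows "i \<le> Suc n \<Longrightarrow> ob X i \<in> Ob C" "i \<le> n \<Longrightarrow> arr (df X i)" "i \<le> n \<Longrightarrow> dm (df X i) = ob X i"
    "i \<le> n \<Longrightarrow> cd (df X i) = ob X (Suc i)"
    "i < n \<Longrightarrow> df X (Suc i) \<bullet> df X i = zr (ob X i) (ob X (Suc (Suc i)))"
  using assms by (auto simp: is_cpx_iff)

lemma gradedD:
  assumes "graded n X Y f"
  shows "i \<le> Suc n \<Longrightarrow> arr (f i)" "i \<le> Suc n \<Longrightarrow> dm (f i) = ob X i" "i \<le> Suc n \<Longrightarrow> cd (f i) = ob Y i"
  using assms by (auto simp: graded_def)

lemma graded_downD: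
  assumes "graded_down n X Y h"
  shows "i \<le> n \<Longrightarrow> arr (h (Suc i))" "i \<le> n \<Longrightarrow> dm (h (Suc i)) = ob X (Suc i)"
    "i \<le> n \<Longrightarrow> cd (h (Suc i)) = ob Y i"
  using assms by (auto simp: graded_down_def)

lemma cpx_mor_iff:
  assumes "is_cpx n C X" "is_cpx n C Y"
  shows "cpx_mor n C X Y f \<longleftrightarrow> graded n X Y f \<and> (\<forall>i\<le>n. df Y i \<bullet> f i = f (Suc i) \<bullet> df X i)"
  using is_cpxD(1)[OF assms(1)] is_cpxD(1)[OF assms(2)]
  unfolding cpx_mor_def graded_def by (auto simp: in_Hom_iff)

lemma cpx_morD:
  assumes "cpx_mor n C X Y f" "is_cpx n C X" "is_cpx n C Y"
  shows "i \<le> Suc n \<Longrightarrow> arr (f i)" "i \<le> Suc n \<Longrightarrow> dm (f i) = ob X i" "i \<le> Suc n \<Longrightarrow> cd (f i) = ob Y i"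
    "i \<le> n \<Longrightarrow> df Y i \<bullet> f i = f (Suc i) \<bullet> df X i" "graded n X Y f"
  using assms by (auto simp: cpx_mor_iff graded_def)

lemma cpx_mor_cmp:
  assumes "cpx_mor n C X Y f" "cpx_mor n C Y V g" "is_cpx n C X" "is_cpx n C Y" "is_cpx n C V"
  shows "cpx_mor n C X V (\<lambda>i. g i \<bullet> f i)"
proof -
  note [simp] = is_cpxD[OF assms(3)] is_cpxD[OF assms(4)] is_cpxD[OF assms(5)]
    cpx_morD[OF assms(1,3,4)] cpx_morD[OF assms(2,4,5)]
  have "df V i \<bullet> (g i \<bullet> f i) = g (Suc i) \<bullet> (f (Suc i) \<bullet> df X i)" if "i \<le> n" for i
  proof -
    have "df V i \<bullet> (g i \<bullet> f i) = (g (Suc i) \<bullet> df Y i) \<bullet> f i"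
      using that by (intro cmp_rewrite) simp_all
    then show ?thesis using that by simp
  qed
  then show ?thesis using assms(3,5) by (simp add: cpx_mor_iff graded_def)
qed

lemma graded_bd:
  assumes "is_cpx n C X" "is_cpx n C Y" "graded_down n X Y h"
  shows "graded n X Y (bd n X Y h)"
  unfolding graded_def
proof (intro allI impI)
  fix i assume "i \<le> Suc n"
  note [simp] = is_cpxD[OF assms(1)] is_cpxD[OF assms(2)] graded_downD[OF assms(3)]
  show "arr (bd n X Y h i) \<and> dm (bd n X Y h i) = ob X i \<and> cd (bd n X Y h i) = ob Y i"
    using \<open>i \<le> Suc n\<close> by (cases i) (auto simp: bd_def)
qed

lemma homotopic_iff:
  assumes X: "is_cpx n C X" and Y: "is_cpx n C Y" and g: "graded n X Y g"
  shows "homotopic n C X Y f g \<longleftrightarrow>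
    (\<exists>h. graded_down n X Y h \<and> (\<forall>i\<le>Suc n. f i = g i \<boxplus> bd n X Y h i))"
  unfolding homotopic_def
proof (rule ex_cong1)
  fix h
  note [simp] = is_cpxD[OF X] is_cpxD[OF Y] gradedD[OF g]
  have h: "(\<forall>i. 1 \<le> i \<and> i \<le> n + 1 \<longrightarrow> h i \<in> carrier (Hom C (ob X i) (ob Y (i - 1))))
    \<longleftrightarrow> graded_down n X Y h" (is "?l \<longleftrightarrow> _")
  proof
    assume ?l
    then have "h (Suc i) \<in> carrier (Hom C (ob X (Suc i)) (ob Y i))" if "i \<le> n" for i
      using that by (metis Suc_eq_plus1 Suc_le_mono add_leD2 diff_Suc_1 le_add2 plus_1_eq_Suc)
    then show "graded_down n X Y h" by (simp add: graded_down_def in_Hom_iff)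
  next
    assume "graded_down n X Y h"
    then have "h (Suc i) \<in> carrier (Hom C (ob X (Suc i)) (ob Y i))" if "i \<le> n" for i
      using that by (simp add: graded_down_def in_Hom_iff)
    then show ?l by (metis Suc_eq_plus1 Suc_le_mono diff_Suc_1 not0_implies_Suc not_one_le_zero)
  qed
  have split: "(\<forall>i\<le>Suc n. P i) \<longleftrightarrow> P 0 \<and> (\<forall>i. 1 \<le> i \<and> i \<le> n \<longrightarrow> P i) \<and> P (n + 1)" for P
    by (metis Suc_eq_plus1 le_SucE le_Suc_eq less_one linorder_not_le zero_le)
  show "(\<forall>i. 1 \<le> i \<and> i \<le> n + 1 \<longrightarrow> h i \<in> carrier (Hom C (ob X i) (ob Y (i - 1)))) \<and>
     f 0 = g 0 \<otimes>\<^bsub>Hom C (ob X 0) (ob Y 0)\<^esub> (h 1 \<bullet> df X 0) \<and>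
     (\<forall>i. 1 \<le> i \<and> i \<le> n \<longrightarrow>
        f i = g i \<otimes>\<^bsub>Hom C (ob X i) (ob Y i)\<^esub>
          ((df Y (i-1) \<bullet> h i) \<otimes>\<^bsub>Hom C (ob X i) (ob Y i)\<^esub> (h (i+1) \<bullet> df X i))) \<and>
     f (n+1) = g (n+1) \<otimes>\<^bsub>Hom C (ob X (n+1)) (ob Y (n+1))\<^esub> (df Y n \<bullet> h (n+1)) \<longleftrightarrow>
     graded_down n X Y h \<and> (\<forall>i\<le>Suc n. f i = g i \<boxplus> bd n X Y h i)" (is "?a \<and> ?b \<longleftrightarrow> _ \<and> ?c")
    unfolding h
  proof (rule conj_cong[OF refl])
    assume d: "graded_down n X Y h"
    note [simp] = graded_downD[OF d]
    have h1: "arr (h 1)" "dm (h 1) = ob X (Suc 0)" "cd (h 1) = ob Y 0"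
      using graded_downD[OF d, of 0] by simp_all
    have mid: "(df Y (i - Suc 0) \<bullet> h i) \<otimes>\<^bsub>Hom C (ob X i) (ob Y i)\<^esub> (h (Suc i) \<bullet> df X i)
        = bd n X Y h i" if "Suc 0 \<le> i" "i \<le> n" for i
      using that by (cases i) (auto simp: bd_def)
    have "?b \<longleftrightarrow> f 0 = g 0 \<boxplus> bd n X Y h 0 \<and>
       (\<forall>i. 1 \<le> i \<and> i \<le> n \<longrightarrow> f i = g i \<boxplus> bd n X Y h i) \<and> f (n+1) = g (n+1) \<boxplus> bd n X Y h (n+1)"
      using h1 by (simp add: mid) (simp add: bd_def)
    also have "\<dots> \<longleftrightarrow> ?c" using split[of "\<lambda>i. f i = g i \<boxplus> bd n X Y h i"] by simp
    finally show "?b \<longleftrightarrow> ?c" .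
  qed
qed

lemma bd_pl:
  assumes "is_cpx n C X" "is_cpx n C Y" "graded_down n X Y h" "graded_down n X Y k" "i \<le> Suc n"
  shows "bd n X Y (\<lambda>i. h i \<boxplus> k i) i = bd n X Y h i \<boxplus> bd n X Y k i"
proof -
  note [simp] = is_cpxD[OF assms(1)] is_cpxD[OF assms(2)] graded_downD[OF assms(3)]
    graded_downD[OF assms(4)]
  show ?thesis using \<open>i \<le> Suc n\<close> by (cases i) (auto simp: bd_def pl_assoc pl_left_comm)
qed

lemma bd_mi:
  assumes "is_cpx n C X" "is_cpx n C Y" "graded_down n X Y h" "i \<le> Suc n"
  shows "bd n X Y (\<lambda>i. mi (h i)) i = mi (bd n X Y h i)"
proof -
  note [simp] = is_cpxD[OF assms(1)] is_cpxD[OF assms(2)] graded_downD[OF assms(3)]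
  show ?thesis using \<open>i \<le> Suc n\<close> by (cases i) (auto simp: bd_def)
qed

lemma bd_cmp_left:
  assumes "is_cpx n C X" "is_cpx n C Y" "is_cpx n C V" "graded_down n X Y h" "cpx_mor n C Y V p"
    "i \<le> Suc n"
  shows "bd n X V (\<lambda>i. p (i - 1) \<bullet> h i) i = p i \<bullet> bd n X Y h i"
proof -
  note [simp] = is_cpxD[OF assms(1)] is_cpxD[OF assms(2)] is_cpxD[OF assms(3)]
    graded_downD[OF assms(4)] cpx_morD[OF assms(5,2,3)]
  have *: "df V j \<bullet> (p j \<bullet> h (Suc j)) = p (Suc j) \<bullet> (df Y j \<bullet> h (Suc j))" if "j \<le> n" for j
  proof -
    have "df V j \<bullet> (p j \<bullet> h (Suc j)) = (p (Suc j) \<bullet> df Y j) \<bullet> h (Suc j)"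
      using that by (intro cmp_rewrite) simp_all
    then show ?thesis using that by simp
  qed
  show ?thesis using \<open>i \<le> Suc n\<close> by (cases i) (auto simp: bd_def *)
qed

lemma bd_cmp_right:
  assumes "is_cpx n C X" "is_cpx n C Y" "is_cpx n C V" "graded_down n X Y h" "cpx_mor n C V X p"
    "i \<le> Suc n"
  shows "bd n V Y (\<lambda>i. h i \<bullet> p i) i = bd n X Y h i \<bullet> p i"
proof -
  note [simp] = is_cpxD[OF assms(1)] is_cpxD[OF assms(2)] is_cpxD[OF assms(3)]
    graded_downD[OF assms(4)] cpx_morD[OF assms(5,3,1)]
  have *: "p (Suc j) \<bullet> df V j = df X j \<bullet> p j" if "j \<le> n" for j
    using that by simp
  show ?thesis using \<open>i \<le> Suc n\<close> by (cases i) (auto simp: bd_def * simp del: cpx_morD(4)[OF assms(5,3,1)])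
qed

lemma homotopic_trans:
  assumes X: "is_cpx n C X" and Y: "is_cpx n C Y" and g: "graded n X Y g" and k: "graded n X Y k"
    and "homotopic n C X Y f g" "homotopic n C X Y g k"
  shows "homotopic n C X Y f k"
proof -
  obtain h where h: "graded_down n X Y h" "\<And>i. i \<le> Suc n \<Longrightarrow> f i = g i \<boxplus> bd n X Y h i"
    using assms homotopic_iff[OF X Y g] by blast
  obtain l where l: "graded_down n X Y l" "\<And>i. i \<le> Suc n \<Longrightarrow> g i = k i \<boxplus> bd n X Y l i"
    using assms homotopic_iff[OF X Y k] by blast
  have "f i = k i \<boxplus> bd n X Y (\<lambda>i. l i \<boxplus> h i) i" if i: "i \<le> Suc n" for i
    using i gradedD[OF k i] gradedD[OF graded_bd[OF X Y h(1)] i] gradedD[OF graded_bd[OF X Y l(1)] i]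
    by (simp add: h l bd_pl[OF X Y l(1) h(1)] pl_assoc)
  moreover have "graded_down n X Y (\<lambda>i. l i \<boxplus> h i)"
    using graded_downD[OF h(1)] graded_downD[OF l(1)] by (simp add: graded_down_def)
  ultimately show ?thesis using homotopic_iff[OF X Y k] by blast
qed

lemma homotopic_cmp_left:
  assumes X: "is_cpx n C X" and Y: "is_cpx n C Y" and V: "is_cpx n C V" and g: "graded n X Y g"
    and p: "cpx_mor n C Y V p" and "homotopic n C X Y f g"
  shows "homotopic n C X V (\<lambda>i. p i \<bullet> f i) (\<lambda>i. p i \<bullet> g i)"
proof -
  obtain h where h: "graded_down n X Y h" "\<And>i. i \<le> Suc n \<Longrightarrow> f i = g i \<boxplus> bd n X Y h i"
    using assms homotopic_iff[OF X Y g] by blast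
  note [simp] = graded_downD[OF h(1)] cpx_morD[OF p Y V] is_cpxD(1)[OF X] is_cpxD(1)[OF Y]
    is_cpxD(1)[OF V] gradedD[OF g] gradedD[OF graded_bd[OF X Y h(1)]]
  have "p i \<bullet> f i = p i \<bullet> g i \<boxplus> bd n X V (\<lambda>i. p (i - 1) \<bullet> h i) i" if i: "i \<le> Suc n" for i
    using i by (simp add: h bd_cmp_left[OF X Y V h(1) p, unfolded One_nat_def])
  moreover have "graded_down n X V (\<lambda>i. p (i - 1) \<bullet> h i)"
    by (simp add: graded_down_def)
  moreover have "graded n X V (\<lambda>i. p i \<bullet> g i)" by (simp add: graded_def)
  ultimately show ?thesis using homotopic_iff[OF X V] by blast
qed

lemma homotopic_cmp_right:
  assumes X: "is_cpx n C X" and Y: "is_cpx n C Y" and V: "is_cpx n C V" and g: "graded n X Y g"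
    and p: "cpx_mor n C V X p" and "homotopic n C X Y f g"
  shows "homotopic n C V Y (\<lambda>i. f i \<bullet> p i) (\<lambda>i. g i \<bullet> p i)"
proof -
  obtain h where h: "graded_down n X Y h" "\<And>i. i \<le> Suc n \<Longrightarrow> f i = g i \<boxplus> bd n X Y h i"
    using assms homotopic_iff[OF X Y g] by blast
  note [simp] = graded_downD[OF h(1)] cpx_morD[OF p V X] is_cpxD(1)[OF X] is_cpxD(1)[OF Y]
    is_cpxD(1)[OF V] gradedD[OF g] gradedD[OF graded_bd[OF X Y h(1)]]
  have "f i \<bullet> p i = g i \<bullet> p i \<boxplus> bd n V Y (\<lambda>i. h i \<bullet> p i) i" if i: "i \<le> Suc n" for i
    using i by (simp add: h bd_cmp_right[OF X Y V h(1) p])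
  moreover have "graded_down n V Y (\<lambda>i. h i \<bullet> p i)"
    by (simp add: graded_down_def)
  moreover have "graded n V Y (\<lambda>i. g i \<bullet> p i)" by (simp add: graded_def)
  ultimately show ?thesis using homotopic_iff[OF V Y] by blast
qed

lemma homotopic_cong:
  assumes X: "is_cpx n C X" and Y: "is_cpx n C Y" and g: "graded n X Y g"
    and "\<And>i. i \<le> Suc n \<Longrightarrow> f i = f' i" "\<And>i. i \<le> Suc n \<Longrightarrow> g i = g' i" "homotopic n C X Y f g"
  shows "homotopic n C X Y f' g'"
proof -
  have "graded n X Y g'" using assms(3,5) by (simp add: graded_def)
  then show ?thesis using assms homotopic_iff[OF X Y] by simp
qed

subsection \<open>Homotopy equivalence with fixed ends\<close>

lemma cpx_mor_between_cmp:
  assumes "X \<in> cpx_between n C A Z" "Y \<in> cpx_between n C A Z" "V \<in> cpx_between n C A Z"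
    and "cpx_mor_between n C A Z X Y f" "cpx_mor_between n C A Z Y V g"
  shows "cpx_mor_between n C A Z X V (\<lambda>i. g i \<bullet> f i)"
proof -
  have "A \<in> Ob C" "Z \<in> Ob C"
    using assms(1) is_cpxD(1)[of n X 0] is_cpxD(1)[of n X "Suc n"] by (auto simp: cpx_between_def)
  then show ?thesis
    using assms cpx_mor_cmp[of n X Y f V g] by (simp add: cpx_mor_between_def cpx_between_def)
qed

text \<open>
  Cancelling the inner round trip \<open>g' f' \<simeq> 1\<close> and then the outer one \<open>g f \<simeq> 1\<close> is the reason why
  homotopy equivalences compose.
\<close>

lemma homotopic_roundtrip:
  assumes X: "is_cpx n C X" and Y: "is_cpx n C Y" and V: "is_cpx n C V"
    and f: "cpx_mor n C X Y f" and g: "cpx_mor n C Y X g"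
    and f': "cpx_mor n C Y V f'" and g': "cpx_mor n C V Y g'"
    and 1: "homotopic n C X X (\<lambda>i. g i \<bullet> f i) (\<lambda>i. Idm C (ob X i))"
    and 2: "homotopic n C Y Y (\<lambda>i. g' i \<bullet> f' i) (\<lambda>i. Idm C (ob Y i))"
  shows "homotopic n C X X (\<lambda>i. (g i \<bullet> g' i) \<bullet> (f' i \<bullet> f i)) (\<lambda>i. Idm C (ob X i))"
proof -
  note [simp] = cpx_morD[OF f X Y] cpx_morD[OF g Y X] cpx_morD[OF f' Y V] cpx_morD[OF g' V Y]
    is_cpxD(1)[OF X] is_cpxD(1)[OF Y] is_cpxD(1)[OF V]
  have gY: "graded n Y Y (\<lambda>i. Idm C (ob Y i))" and gX: "graded n X X (\<lambda>i. Idm C (ob X i))"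
    by (simp_all add: graded_def)
  have *: "homotopic n C X Y (\<lambda>i. (g' i \<bullet> f' i) \<bullet> f i) (\<lambda>i. Idm C (ob Y i) \<bullet> f i)"
    by (rule homotopic_cmp_right[OF Y Y X gY f 2])
  have "graded n X Y (\<lambda>i. Idm C (ob Y i) \<bullet> f i)" by (simp add: graded_def)
  from homotopic_cmp_left[OF X Y X this g *]
  have "homotopic n C X X (\<lambda>i. g i \<bullet> ((g' i \<bullet> f' i) \<bullet> f i)) (\<lambda>i. g i \<bullet> (Idm C (ob Y i) \<bullet> f i))" .
  then have "homotopic n C X X (\<lambda>i. (g i \<bullet> g' i) \<bullet> (f' i \<bullet> f i)) (\<lambda>i. g i \<bullet> f i)"
    by (rule homotopic_cong[OF X X, rotated -1]) (simp_all add: graded_def)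
  moreover have "graded n X X (\<lambda>i. g i \<bullet> f i)" by (simp add: graded_def)
  ultimately show ?thesis using homotopic_trans[OF X X _ gX _ 1] by blast
qed

lemma homotopy_equivalent_sym:
  "homotopy_equivalent n C A Z X Y \<Longrightarrow> homotopy_equivalent n C A Z Y X"
  unfolding homotopy_equivalent_def by blast

lemma homotopy_equivalent_trans:
  assumes X: "X \<in> cpx_between n C A Z" and Y: "Y \<in> cpx_between n C A Z"
    and V: "V \<in> cpx_between n C A Z"
    and "homotopy_equivalent n C A Z X Y" "homotopy_equivalent n C A Z Y V"
  shows "homotopy_equivalent n C A Z X V"
proof -
  have c: "is_cpx n C X" "is_cpx n C Y" "is_cpx n C V" using X Y V by (auto simp: cpx_between_def)
  obtain f g where f: "cpx_mor_between n C A Z X Y f" "cpx_mor_between n C A Z Y X g"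
    "homotopic n C X X (\<lambda>i. g i \<bullet> f i) (\<lambda>i. Idm C (ob X i))"
    "homotopic n C Y Y (\<lambda>i. f i \<bullet> g i) (\<lambda>i. Idm C (ob Y i))"
    using assms(4) unfolding homotopy_equivalent_def by blast
  obtain f' g' where f': "cpx_mor_between n C A Z Y V f'" "cpx_mor_between n C A Z V Y g'"
    "homotopic n C Y Y (\<lambda>i. g' i \<bullet> f' i) (\<lambda>i. Idm C (ob Y i))"
    "homotopic n C V V (\<lambda>i. f' i \<bullet> g' i) (\<lambda>i. Idm C (ob V i))"
    using assms(5) unfolding homotopy_equivalent_def by blast
  have m: "cpx_mor n C X Y f" "cpx_mor n C Y X g" "cpx_mor n C Y V f'" "cpx_mor n C V Y g'"
    using f f' by (auto simp: cpx_mor_between_def)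
  show ?thesis unfolding homotopy_equivalent_def
    using cpx_mor_between_cmp[OF X Y V f(1) f'(1)] cpx_mor_between_cmp[OF V Y X f'(2) f(2)]
      homotopic_roundtrip[OF c m f(3) f'(3)]
      homotopic_roundtrip[OF c(3,2,1) m(4,3,2,1) f'(4) f(4)]
    by blast
qed

lemma hclass_eqI:
  assumes "X \<in> cpx_between n C A Z" "Y \<in> cpx_between n C A Z" "homotopy_equivalent n C A Z X Y"
  shows "hclass n C A Z X = hclass n C A Z Y"
  unfolding hclass_def
  using assms homotopy_equivalent_sym homotopy_equivalent_trans by blast

subsection \<open>Complexes with exact Hom sequences\<close>

text \<open>
  \<open>Hom(X\<^sup>i\<^sup>+\<^sup>2, -) \<rightarrow> Hom(X\<^sup>i\<^sup>+\<^sup>1, -) \<rightarrow> Hom(X\<^sup>i, -)\<close> is exact at all middle terms. This is the part of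
  the definition of an exangle that does not involve the extension, and it suffices to
  compare realizations up to homotopy.
\<close>

definition coexact :: "nat \<Rightarrow> ('o, 'm) cpx \<Rightarrow> bool" where
  "coexact n X \<longleftrightarrow> (\<forall>i<n. \<forall>f. arr f \<and> dm f = ob X (Suc i) \<and> f \<bullet> df X i = zr (ob X i) (cd f) \<longrightarrow>
     (\<exists>g. arr g \<and> dm g = ob X (Suc (Suc i)) \<and> cd g = cd f \<and> f = g \<bullet> df X (Suc i)))"

text \<open>
  Since \<open>v\<^sup>0 = 0\<close>, exactness produces recursively maps \<open>k\<close> with \<open>v = d k + k d\<close> in all degrees up
  to \<open>n\<close>, but not in degree \<open>n + 1\<close>, where \<open>d k\<close> may fail to vanish. Multiplying by \<open>v\<close> repairs this
  because \<open>v\<^sup>n\<^sup>+\<^sup>1 = 0\<close>: the family \<open>k v\<close> has boundary \<open>v v\<close> in every degree.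
\<close>

lemma endo_zero_ends_square_null:
  assumes X: "is_cpx n C X" and ex: "coexact n X" and v: "cpx_mor n C X X v"
    and v0: "v 0 = zr (ob X 0) (ob X 0)" and vn: "v (Suc n) = zr (ob X (Suc n)) (ob X (Suc n))"
  obtains h where "graded_down n X X h" "\<And>i. i \<le> Suc n \<Longrightarrow> v i \<bullet> v i = bd n X X h i"
proof -
  note [simp] = is_cpxD[OF X] cpx_morD[OF v X X]
  \<comment> \<open>\<open>P\<close> is what the recursion carries: \<open>d x d = d v\<close> lets \<open>v\<^sup>j\<^sup>+\<^sup>1 - d x\<close> factor through the next differential.\<close>
  define P where "P j x \<longleftrightarrow> (j \<le> n \<longrightarrow> arr x \<and> dm x = ob X (Suc j) \<and> cd x = ob X j \<and>
    (j = 0 \<longrightarrow> x = zr (ob X 1) (ob X 0)) \<and> df X j \<bullet> (x \<bullet> df X j) = df X j \<bullet> v j)" for j x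
  define Q where "Q j x y \<longleftrightarrow> (Suc j \<le> n \<longrightarrow> v (Suc j) = df X j \<bullet> x \<boxplus> y \<bullet> df X (Suc j))" for j x y
  have "\<exists>x. P 0 x" using v0 by (auto simp: P_def)
  moreover have "\<exists>y. P (Suc j) y \<and> Q j x y" if "P j x" for j x
  proof (cases "Suc j \<le> n")
    case False
    then show ?thesis by (simp add: P_def Q_def)
  next
    case True
    have x [simp]: "arr x" "dm x = ob X (Suc j)" "cd x = ob X j"
      and xd: "df X j \<bullet> (x \<bullet> df X j) = df X j \<bullet> v j"
      using that True by (auto simp: P_def)
    define w where "w = v (Suc j) \<boxplus> mi (df X j \<bullet> x)"
    have w [simp]: "arr w" "dm w = ob X (Suc j)" "cd w = ob X (Suc j)"
      using True by (simp_all add: w_def)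
    have "w \<bullet> df X j = zr (ob X j) (cd w)"
    proof -
      have "v (Suc j) \<bullet> df X j = df X j \<bullet> v j" using True by simp
      then have "w \<bullet> df X j = df X j \<bullet> v j \<boxplus> mi (df X j \<bullet> v j)"
        using True xd by (simp add: w_def del: pl_mi cpx_morD(4)[OF v X X])
      then show ?thesis using True by simp
    qed
    then obtain y where y: "arr y" "dm y = ob X (Suc (Suc j))" "cd y = ob X (Suc j)"
      "w = y \<bullet> df X (Suc j)"
      using ex True unfolding coexact_def by (metis Suc_le_eq w)
    have "v (Suc j) = df X j \<bullet> x \<boxplus> w"
      using True pl_left_comm[of "df X j \<bullet> x" "v (Suc j)" "mi (df X j \<bullet> x)"] by (simp add: w_def)
    then have "Q j x y" by (simp add: Q_def y(4))
    moreover have "df X (Suc j) \<bullet> w = df X (Suc j) \<bullet> v (Suc j)"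
    proof -
      have "df X (Suc j) \<bullet> (df X j \<bullet> x) = zr (ob X j) (ob X (Suc (Suc j))) \<bullet> x"
        using True by (intro cmp_rewrite) simp_all
      then show ?thesis using True
        by (simp add: w_def del: cpx_morD(4)[OF v X X])
    qed
    then have "P (Suc j) y" using y by (simp add: P_def)
    ultimately show ?thesis by blast
  qed
  ultimately obtain \<kappa> where \<kappa>: "\<And>j. P j (\<kappa> j)" "\<And>j. Q j (\<kappa> j) (\<kappa> (Suc j))"
    using dependent_nat_choice[of P Q] by blast
  define k where "k i = \<kappa> (i - 1)" for i
  have kd: "graded_down n X X k" using \<kappa>(1) by (auto simp: graded_down_def k_def P_def)
  note [simp] = graded_downD[OF kd]
  have k: "bd n X X k i = v i" if "i \<le> n" for i
  proof (cases i)
    case 0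
    then show ?thesis using that \<kappa>(1)[of 0] v0 by (simp add: bd_def k_def P_def)
  next
    case (Suc j)
    then show ?thesis using that \<kappa>(2)[of j] by (simp add: bd_def k_def Q_def)
  qed
  have "bd n X X (\<lambda>i. k i \<bullet> v i) i = v i \<bullet> v i" if i: "i \<le> Suc n" for i
  proof (cases "i \<le> n")
    case True
    then show ?thesis using bd_cmp_right[OF X X X kd v i] k by simp
  next
    case False
    then have "i = Suc n" using i by simp
    then show ?thesis using bd_cmp_right[OF X X X kd v i] vn gradedD[OF graded_bd[OF X X kd] i]
      by simp
  qed
  moreover have "graded_down n X X (\<lambda>i. k i \<bullet> v i)" by (simp add: graded_down_def)
  ultimately show thesis using that by metis
qed

text \<open>
  With \<open>v = u - 1\<close> one has \<open>2 u - u\<^sup>2 = 1 - v\<^sup>2\<close>, and \<open>v\<^sup>2\<close> is null-homotopic.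
\<close>

lemma homotopic_twice_minus_square:
  assumes X: "is_cpx n C X" and ex: "coexact n X" and u: "cpx_mor n C X X u"
    and u0: "u 0 = Idm C (ob X 0)" and un: "u (Suc n) = Idm C (ob X (Suc n))"
  shows "homotopic n C X X (\<lambda>i. (u i \<boxplus> u i) \<boxplus> mi (u i \<bullet> u i)) (\<lambda>i. Idm C (ob X i))"
proof -
  note [simp] = is_cpxD[OF X] cpx_morD[OF u X X]
  define v where "v i = u i \<boxplus> mi (Idm C (ob X i))" for i
  have v: "cpx_mor n C X X v"
    using X unfolding cpx_mor_iff[OF X X] by (auto simp: graded_def v_def)
  obtain h where h: "graded_down n X X h" "\<And>i. i \<le> Suc n \<Longrightarrow> v i \<bullet> v i = bd n X X h i"
    using endo_zero_ends_square_null[OF X ex v] u0 un by (auto simp: v_def)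
  have "(u i \<boxplus> u i) \<boxplus> mi (u i \<bullet> u i) = Idm C (ob X i) \<boxplus> bd n X X (\<lambda>i. mi (h i)) i"
    if i: "i \<le> Suc n" for i
  proof -
    have uu: "arr (u i)" "dm (u i) = ob X i" "cd (u i) = ob X i" "ob X i \<in> Ob C" using i by simp_all
    have "Idm C (ob X i) \<boxplus> bd n X X (\<lambda>i. mi (h i)) i = Idm C (ob X i) \<boxplus> mi (v i \<bullet> v i)"
      using i h by (simp add: bd_mi[OF X X])
    also have "\<dots> = Idm C (ob X i) \<boxplus> ((mi (u i \<bullet> u i) \<boxplus> u i) \<boxplus> (u i \<boxplus> mi (Idm C (ob X i))))"
      using uu by (simp add: v_def)
    also have "(mi (u i \<bullet> u i) \<boxplus> u i) \<boxplus> (u i \<boxplus> mi (Idm C (ob X i)))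
        = (mi (u i \<bullet> u i) \<boxplus> (u i \<boxplus> u i)) \<boxplus> mi (Idm C (ob X i))"
      using uu by (simp add: pl_assoc)
    also have "\<dots> = mi (Idm C (ob X i)) \<boxplus> (mi (u i \<bullet> u i) \<boxplus> (u i \<boxplus> u i))"
      by (rule pl_comm) (use uu in simp_all)
    also have "mi (u i \<bullet> u i) \<boxplus> (u i \<boxplus> u i) = (u i \<boxplus> u i) \<boxplus> mi (u i \<bullet> u i)"
      by (rule pl_comm) (use uu in simp_all)
    also have "Idm C (ob X i) \<boxplus> (mi (Idm C (ob X i)) \<boxplus> ((u i \<boxplus> u i) \<boxplus> mi (u i \<bullet> u i)))
        = (u i \<boxplus> u i) \<boxplus> mi (u i \<bullet> u i)" using uu by simp
    finally show ?thesis by simp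
  qed
  moreover have "graded_down n X X (\<lambda>i. mi (h i))"
    using graded_downD[OF h(1)] by (simp add: graded_down_def)
  moreover have "graded n X X (\<lambda>i. Idm C (ob X i))" by (simp add: graded_def)
  ultimately show ?thesis using homotopic_iff[OF X X] by blast
qed

text \<open>
  The given maps need not be mutually inverse up to homotopy. Replacing \<open>g\<close> by
  \<open>g' = 2 g - g f g\<close> turns both composites into \<open>2 u - u\<^sup>2\<close>, for \<open>u = g f\<close> and for \<open>u = f g\<close>.
\<close>

lemma homotopy_equivalentI:
  assumes XA: "X \<in> cpx_between n C A Z" and YA: "Y \<in> cpx_between n C A Z"
    and ex: "coexact n X" "coexact n Y"
    and f: "cpx_mor_between n C A Z X Y f" and g: "cpx_mor_between n C A Z Y X g"
  shows "homotopy_equivalent n C A Z X Y"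
proof -
  have X: "is_cpx n C X" and Y: "is_cpx n C Y" and e: "ob X 0 = A" "ob Y 0 = A"
    "ob X (Suc n) = Z" "ob Y (Suc n) = Z"
    using XA YA by (auto simp: cpx_between_def)
  have m: "cpx_mor n C X Y f" "cpx_mor n C Y X g" "f 0 = Idm C A" "g 0 = Idm C A"
    "f (Suc n) = Idm C Z" "g (Suc n) = Idm C Z"
    using f g by (auto simp: cpx_mor_between_def)
  have AZ: "A \<in> Ob C" "Z \<in> Ob C" using is_cpxD(1)[OF X, of 0] is_cpxD(1)[OF X, of "Suc n"] e by auto
  note [simp] = is_cpxD[OF X] is_cpxD[OF Y] cpx_morD[OF m(1) X Y] cpx_morD[OF m(2) Y X]
  define g' where "g' i = (g i \<boxplus> g i) \<boxplus> mi (g i \<bullet> (f i \<bullet> g i))" for i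
  have "df X i \<bullet> (g i \<bullet> (f i \<bullet> g i)) = g (Suc i) \<bullet> (f (Suc i) \<bullet> (g (Suc i) \<bullet> df Y i))" if "i \<le> n" for i
    using cpx_morD(4)[OF cpx_mor_cmp[OF m(2) cpx_mor_cmp[OF m(1,2) X Y X] Y X X] Y X that]
    using that by simp
  then have g'm: "cpx_mor n C Y X g'"
    unfolding cpx_mor_iff[OF Y X] by (simp add: graded_def g'_def)
  moreover have "g' 0 = Idm C A" "g' (Suc n) = Idm C Z"
    using m AZ by (simp_all add: g'_def pl_assoc)
  ultimately have "cpx_mor_between n C A Z Y X g'" by (simp add: cpx_mor_between_def)
  moreover have "homotopic n C X X (\<lambda>i. g' i \<bullet> f i) (\<lambda>i. Idm C (ob X i))"
  proof (rule homotopic_cong[OF X X _ _ _ homotopic_twice_minus_square[OF X ex(1)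
          cpx_mor_cmp[OF m(1,2) X Y X]]])
    show "graded n X X (\<lambda>i. Idm C (ob X i))" by (simp add: graded_def)
  qed (use m AZ e in \<open>simp_all add: g'_def\<close>)
  moreover have "homotopic n C Y Y (\<lambda>i. f i \<bullet> g' i) (\<lambda>i. Idm C (ob Y i))"
  proof (rule homotopic_cong[OF Y Y _ _ _ homotopic_twice_minus_square[OF Y ex(2)
          cpx_mor_cmp[OF m(2,1) Y X Y]]])
    show "graded n Y Y (\<lambda>i. Idm C (ob Y i))" by (simp add: graded_def)
  qed (use m AZ e in \<open>simp_all add: g'_def\<close>)
  ultimately show ?thesis using f unfolding homotopy_equivalent_def by blast
qed

subsection \<open>Direct sums of complexes\<close>

lemma ob_cpx_sum [simp]: "ob (cpx_sum C X Y) i = osum C (ob X i) (ob Y i)"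
  by (simp add: cpx_sum_def)

lemma df_cpx_sum:
  assumes X: "is_cpx n C X" and Y: "is_cpx n C Y" and i: "i \<le> n"
  shows "arr (df (cpx_sum C X Y) i)" "dm (df (cpx_sum C X Y) i) = osum C (ob X i) (ob Y i)"
    "cd (df (cpx_sum C X Y) i) = osum C (ob X (Suc i)) (ob Y (Suc i))"
    "df (cpx_sum C X Y) i \<bullet> i1 (ob X i) (ob Y i) = i1 (ob X (Suc i)) (ob Y (Suc i)) \<bullet> df X i"
    "df (cpx_sum C X Y) i \<bullet> i2 (ob X i) (ob Y i) = i2 (ob X (Suc i)) (ob Y (Suc i)) \<bullet> df Y i"
    "p1 (ob X (Suc i)) (ob Y (Suc i)) \<bullet> df (cpx_sum C X Y) i = df X i \<bullet> p1 (ob X i) (ob Y i)"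
    "p2 (ob X (Suc i)) (ob Y (Suc i)) \<bullet> df (cpx_sum C X Y) i = df Y i \<bullet> p2 (ob X i) (ob Y i)"
proof -
  note [simp] = is_cpxD[OF X] is_cpxD[OF Y]
  have d: "df (cpx_sum C X Y) i = i1 (ob X (Suc i)) (ob Y (Suc i)) \<bullet> (df X i \<bullet> p1 (ob X i) (ob Y i)) \<boxplus>
     i2 (ob X (Suc i)) (ob Y (Suc i)) \<bullet> (df Y i \<bullet> p2 (ob X i) (ob Y i))"
    using i by (simp add: cpx_sum_def mat22_def)
  show "arr (df (cpx_sum C X Y) i)" "dm (df (cpx_sum C X Y) i) = osum C (ob X i) (ob Y i)"
    "cd (df (cpx_sum C X Y) i) = osum C (ob X (Suc i)) (ob Y (Suc i))"
    "df (cpx_sum C X Y) i \<bullet> i1 (ob X i) (ob Y i) = i1 (ob X (Suc i)) (ob Y (Suc i)) \<bullet> df X i"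
    "df (cpx_sum C X Y) i \<bullet> i2 (ob X i) (ob Y i) = i2 (ob X (Suc i)) (ob Y (Suc i)) \<bullet> df Y i"
    "p1 (ob X (Suc i)) (ob Y (Suc i)) \<bullet> df (cpx_sum C X Y) i = df X i \<bullet> p1 (ob X i) (ob Y i)"
    "p2 (ob X (Suc i)) (ob Y (Suc i)) \<bullet> df (cpx_sum C X Y) i = df Y i \<bullet> p2 (ob X i) (ob Y i)"
    using i by (simp_all add: d)
qed

lemma is_cpx_cpx_sum:
  assumes X: "is_cpx n C X" and Y: "is_cpx n C Y"
  shows "is_cpx n C (cpx_sum C X Y)"
proof -
  note [simp] = is_cpxD[OF X] is_cpxD[OF Y] df_cpx_sum[OF X Y]
  let ?S = "cpx_sum C X Y"
  have "df ?S (Suc i) \<bullet> df ?S i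
      = zr (osum C (ob X i) (ob Y i)) (osum C (ob X (Suc (Suc i))) (ob Y (Suc (Suc i))))"
    if i: "i < n" for i
  proof (rule from_osum_eqI[of _ _ "ob X i" "ob Y i"])
    have "df ?S (Suc i) \<bullet> (i1 (ob X (Suc i)) (ob Y (Suc i)) \<bullet> df X i)
        = (i1 (ob X (Suc (Suc i))) (ob Y (Suc (Suc i))) \<bullet> df X (Suc i)) \<bullet> df X i"
      using i by (intro cmp_rewrite) simp_all
    then show "df ?S (Suc i) \<bullet> df ?S i \<bullet> i1 (ob X i) (ob Y i)
        = zr (osum C (ob X i) (ob Y i)) (osum C (ob X (Suc (Suc i))) (ob Y (Suc (Suc i))))
          \<bullet> i1 (ob X i) (ob Y i)"
      using i by simp
    have "df ?S (Suc i) \<bullet> (i2 (ob X (Suc i)) (ob Y (Suc i)) \<bullet> df Y i)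
        = (i2 (ob X (Suc (Suc i))) (ob Y (Suc (Suc i))) \<bullet> df Y (Suc i)) \<bullet> df Y i"
      using i by (intro cmp_rewrite) simp_all
    then show "df ?S (Suc i) \<bullet> df ?S i \<bullet> i2 (ob X i) (ob Y i)
        = zr (osum C (ob X i) (ob Y i)) (osum C (ob X (Suc (Suc i))) (ob Y (Suc (Suc i))))
          \<bullet> i2 (ob X i) (ob Y i)"
      using i by simp
  qed (use i in simp_all)
  then show ?thesis by (simp add: is_cpx_iff)
qed

lemma coexact_cpx_sum:
  assumes X: "is_cpx n C X" and Y: "is_cpx n C Y" and ex: "coexact n X" "coexact n Y"
  shows "coexact n (cpx_sum C X Y)"
  unfolding coexact_def
proof (intro allI impI, elim conjE)
  note [simp] = is_cpxD[OF X] is_cpxD[OF Y] df_cpx_sum[OF X Y]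
  fix i f assume i: "i < n" and f [simp]: "arr f" and "dm f = ob (cpx_sum C X Y) (Suc i)"
    and f0: "f \<bullet> df (cpx_sum C X Y) i = zr (ob (cpx_sum C X Y) i) (cd f)"
  then have fd [simp]: "dm f = osum C (ob X (Suc i)) (ob Y (Suc i))" by simp
  let ?f1 = "f \<bullet> i1 (ob X (Suc i)) (ob Y (Suc i))" and ?f2 = "f \<bullet> i2 (ob X (Suc i)) (ob Y (Suc i))"
  have "?f1 \<bullet> df X i = (f \<bullet> df (cpx_sum C X Y) i) \<bullet> i1 (ob X i) (ob Y i)" using i by simp
  then have "?f1 \<bullet> df X i = zr (ob X i) (cd ?f1)" using i unfolding f0 by simp
  moreover have "arr ?f1" "dm ?f1 = ob X (Suc i)" using i by simp_all
  ultimately obtain g1 where g1: "arr g1" "dm g1 = ob X (Suc (Suc i))" "cd g1 = cd ?f1"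
    "?f1 = g1 \<bullet> df X (Suc i)"
    using ex(1) i unfolding coexact_def by blast
  have "?f2 \<bullet> df Y i = (f \<bullet> df (cpx_sum C X Y) i) \<bullet> i2 (ob X i) (ob Y i)" using i by simp
  then have "?f2 \<bullet> df Y i = zr (ob Y i) (cd ?f2)" using i unfolding f0 by simp
  moreover have "arr ?f2" "dm ?f2 = ob Y (Suc i)" using i by simp_all
  ultimately obtain g2 where g2: "arr g2" "dm g2 = ob Y (Suc (Suc i))" "cd g2 = cd ?f2"
    "?f2 = g2 \<bullet> df Y (Suc i)"
    using ex(2) i unfolding coexact_def by blast
  have g12 [simp]: "arr g1" "dm g1 = ob X (Suc (Suc i))" "cd g1 = cd f"
    "arr g2" "dm g2 = ob Y (Suc (Suc i))" "cd g2 = cd f" using g1(1-3) g2(1-3) i by simp_all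
  define g where "g = g1 \<bullet> p1 (ob X (Suc (Suc i))) (ob Y (Suc (Suc i))) \<boxplus>
    g2 \<bullet> p2 (ob X (Suc (Suc i))) (ob Y (Suc (Suc i)))"
  have "f = g \<bullet> df (cpx_sum C X Y) (Suc i)"
    by (rule from_osum_eqI[of _ _ "ob X (Suc i)" "ob Y (Suc i)"])
      (use i g1(4) g2(4) in \<open>simp_all add: g_def\<close>)
  moreover have "arr g" "dm g = ob (cpx_sum C X Y) (Suc (Suc i))" "cd g = cd f"
    using i by (simp_all add: g_def)
  ultimately show "\<exists>g. arr g \<and> dm g = ob (cpx_sum C X Y) (Suc (Suc i)) \<and> cd g = cd f \<and>
      f = g \<bullet> df (cpx_sum C X Y) (Suc i)"
    by blast
qed

lemma cpx_mor_from_sum: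
  assumes X: "is_cpx n C X" and Y: "is_cpx n C Y" and V: "is_cpx n C V"
    and f: "cpx_mor n C X V f" and g: "cpx_mor n C Y V g"
  shows "cpx_mor n C (cpx_sum C X Y) V
    (\<lambda>i. f i \<bullet> p1 (ob X i) (ob Y i) \<boxplus> g i \<bullet> p2 (ob X i) (ob Y i))"
proof -
  note [simp] = is_cpxD[OF X] is_cpxD[OF Y] is_cpxD[OF V] df_cpx_sum[OF X Y]
    cpx_morD[OF f X V] cpx_morD[OF g Y V]
  have "df V i \<bullet> (f i \<bullet> p1 (ob X i) (ob Y i)) = (f (Suc i) \<bullet> df X i) \<bullet> p1 (ob X i) (ob Y i)"
    "df V i \<bullet> (g i \<bullet> p2 (ob X i) (ob Y i)) = (g (Suc i) \<bullet> df Y i) \<bullet> p2 (ob X i) (ob Y i)"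
    if "i \<le> n" for i
    by (rule cmp_rewrite; use that in simp)+
  then show ?thesis unfolding cpx_mor_iff[OF is_cpx_cpx_sum[OF X Y] V]
    by (simp add: graded_def)
qed

lemma cpx_mor_into_sum:
  assumes X: "is_cpx n C X" and Y: "is_cpx n C Y" and V: "is_cpx n C V"
    and f: "cpx_mor n C V X f" and g: "cpx_mor n C V Y g"
  shows "cpx_mor n C V (cpx_sum C X Y)
    (\<lambda>i. i1 (ob X i) (ob Y i) \<bullet> f i \<boxplus> i2 (ob X i) (ob Y i) \<bullet> g i)"
proof -
  note [simp] = is_cpxD[OF X] is_cpxD[OF Y] is_cpxD[OF V] df_cpx_sum[OF X Y]
    cpx_morD[OF f V X] cpx_morD[OF g V Y]
  let ?S = "cpx_sum C X Y"
  have "df ?S i \<bullet> (i1 (ob X i) (ob Y i) \<bullet> f i) = (i1 (ob X (Suc i)) (ob Y (Suc i)) \<bullet> df X i) \<bullet> f i"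
    "df ?S i \<bullet> (i2 (ob X i) (ob Y i) \<bullet> g i) = (i2 (ob X (Suc i)) (ob Y (Suc i)) \<bullet> df Y i) \<bullet> g i"
    if "i \<le> n" for i
    by (rule cmp_rewrite; use that in simp)+
  then show ?thesis unfolding cpx_mor_iff[OF V is_cpx_cpx_sum[OF X Y]]
    by (simp add: graded_def)
qed

end

section \<open>Extensions\<close>

context additive_bifunctor
begin

lemma Emap_closed:
  "\<lbrakk>\<delta> \<in> carrier (Ext E Z A); arr c; cd c = Z; dm c = Z'; arr a; dm a = A; cd a = A'\<rbrakk>
    \<Longrightarrow> Emap E c a \<delta> \<in> carrier (Ext E Z' A')"
  using Emap_hom[of Z Z' A A' c a] by (auto simp: hom_def in_Hom_iff)

lemma Emap_Emap:
  "\<lbrakk>\<delta> \<in> carrier (Ext E Z A); arr c; cd c = Z; arr c'; cd c' = dm c; arr a; dm a = A;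
    arr a'; dm a' = cd a\<rbrakk> \<Longrightarrow> Emap E c' a' (Emap E c a \<delta>) = Emap E (c \<bullet> c') (a' \<bullet> a) \<delta>"
  using Emap_Comp[of Z "dm c" "dm c'" A "cd a" "cd a'" c c' a a' \<delta>] by (auto simp: in_Hom_iff)

lemma Emap_Idm: "\<lbrakk>\<delta> \<in> carrier (Ext E Z A); Z \<in> Ob C; A \<in> Ob C\<rbrakk>
    \<Longrightarrow> Emap E (Idm C Z) (Idm C A) \<delta> = \<delta>"
  by (simp add: Emap_Id)

lemma Emap_mult:
  assumes "\<delta> \<in> carrier (Ext E Z A)" "\<epsilon> \<in> carrier (Ext E Z A)" "arr c" "cd c = Z" "dm c = Z'"
    "arr a" "dm a = A" "cd a = A'"
  shows "Emap E c a (\<delta> \<otimes>\<^bsub>Ext E Z A\<^esub> \<epsilon>) = Emap E c a \<delta> \<otimes>\<^bsub>Ext E Z' A'\<^esub> Emap E c a \<epsilon>"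
  using Emap_hom[of Z Z' A A' c a] assms by (auto simp: hom_def in_Hom_iff)

lemma Emap_one:
  assumes "arr c" "cd c = Z" "dm c = Z'" "arr a" "dm a = A" "cd a = A'"
  shows "Emap E c a \<one>\<^bsub>Ext E Z A\<^esub> = \<one>\<^bsub>Ext E Z' A'\<^esub>"
proof -
  have O: "Z \<in> Ob C" "Z' \<in> Ob C" "A \<in> Ob C" "A' \<in> Ob C" using assms by auto
  interpret G: comm_group "Ext E Z A" using Ext_group O by blast
  interpret H: comm_group "Ext E Z' A'" using Ext_group O by blast
  have "Emap E c a \<in> hom (Ext E Z A) (Ext E Z' A')"
    using Emap_hom[of Z Z' A A' c a] assms O by (auto simp: in_Hom_iff)
  then show ?thesis using hom_one G.group_axioms H.group_axioms by blast
qed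

lemma Emap_pl_left:
  "\<lbrakk>\<delta> \<in> carrier (Ext E Z A); arr c; arr c'; cd c = Z; cd c' = Z; dm c = Z'; dm c' = Z';
    arr a; dm a = A; cd a = A'\<rbrakk>
    \<Longrightarrow> Emap E (c \<boxplus> c') a \<delta> = Emap E c a \<delta> \<otimes>\<^bsub>Ext E Z' A'\<^esub> Emap E c' a \<delta>"
  using Emap_add_left[of Z Z' A A' c c' a \<delta>] by (auto simp: in_Hom_iff)

lemma Emap_pl_right:
  "\<lbrakk>\<delta> \<in> carrier (Ext E Z A); arr c; cd c = Z; dm c = Z'; arr a; arr a'; dm a = A; dm a' = A;
    cd a = A'; cd a' = A'\<rbrakk>
    \<Longrightarrow> Emap E c (a \<boxplus> a') \<delta> = Emap E c a \<delta> \<otimes>\<^bsub>Ext E Z' A'\<^esub> Emap E c a' \<delta>"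
  using Emap_add_right[of Z Z' A A' c a a' \<delta>] by (auto simp: in_Hom_iff)

lemma Ext_idem:
  assumes "\<epsilon> \<in> carrier (Ext E Z A)" "Z \<in> Ob C" "A \<in> Ob C" "\<epsilon> = \<epsilon> \<otimes>\<^bsub>Ext E Z A\<^esub> \<epsilon>"
  shows "\<epsilon> = \<one>\<^bsub>Ext E Z A\<^esub>"
proof -
  interpret G: comm_group "Ext E Z A" using Ext_group assms by blast
  show ?thesis using assms(1,4) G.l_cancel_one by metis
qed

lemma Emap_zr_left:
  assumes "\<delta> \<in> carrier (Ext E Z A)" "Z \<in> Ob C" "Z' \<in> Ob C" "arr a" "dm a = A" "cd a = A'"
  shows "Emap E (zr Z' Z) a \<delta> = \<one>\<^bsub>Ext E Z' A'\<^esub>"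
proof (rule Ext_idem)
  show "Emap E (zr Z' Z) a \<delta> \<in> carrier (Ext E Z' A')"
    using assms by (intro Emap_closed) simp_all
  show "Emap E (zr Z' Z) a \<delta> = Emap E (zr Z' Z) a \<delta> \<otimes>\<^bsub>Ext E Z' A'\<^esub> Emap E (zr Z' Z) a \<delta>"
    using Emap_pl_left[of \<delta> Z A "zr Z' Z" "zr Z' Z" Z' a A'] assms by simp
qed (use assms in auto)

lemma Emap_zr_right:
  assumes "\<delta> \<in> carrier (Ext E Z A)" "A \<in> Ob C" "A' \<in> Ob C" "arr c" "cd c = Z" "dm c = Z'"
  shows "Emap E c (zr A A') \<delta> = \<one>\<^bsub>Ext E Z' A'\<^esub>"
proof (rule Ext_idem)
  show "Emap E c (zr A A') \<delta> \<in> carrier (Ext E Z' A')"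
    using assms by (intro Emap_closed) simp_all
  show "Emap E c (zr A A') \<delta> = Emap E c (zr A A') \<delta> \<otimes>\<^bsub>Ext E Z' A'\<^esub> Emap E c (zr A A') \<delta>"
    using Emap_pl_right[of \<delta> Z A c Z' "zr A A'" "zr A A'" A'] assms by simp
qed (use assms in auto)

lemma Ext_mult_one [simp]:
  assumes "\<delta> \<in> carrier (Ext E Z A)" "Z \<in> Ob C" "A \<in> Ob C"
  shows "\<delta> \<otimes>\<^bsub>Ext E Z A\<^esub> \<one>\<^bsub>Ext E Z A\<^esub> = \<delta>" "\<one>\<^bsub>Ext E Z A\<^esub> \<otimes>\<^bsub>Ext E Z A\<^esub> \<delta> = \<delta>"
proof -
  interpret G: comm_group "Ext E Z A" using Ext_group assms by blast
  show "\<delta> \<otimes>\<^bsub>Ext E Z A\<^esub> \<one>\<^bsub>Ext E Z A\<^esub> = \<delta>" "\<one>\<^bsub>Ext E Z A\<^esub> \<otimes>\<^bsub>Ext E Z A\<^esub> \<delta> = \<delta>"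
    using assms by simp_all
qed

lemma Ext_mult_closed:
  assumes "\<delta> \<in> carrier (Ext E Z A)" "\<epsilon> \<in> carrier (Ext E Z A)" "Z \<in> Ob C" "A \<in> Ob C"
  shows "\<delta> \<otimes>\<^bsub>Ext E Z A\<^esub> \<epsilon> \<in> carrier (Ext E Z A)"
proof -
  interpret G: comm_group "Ext E Z A" using Ext_group assms by blast
  show ?thesis using assms by simp
qed

lemma Ext_one_closed: "\<lbrakk>Z \<in> Ob C; A \<in> Ob C\<rbrakk> \<Longrightarrow> \<one>\<^bsub>Ext E Z A\<^esub> \<in> carrier (Ext E Z A)"
  using Ext_group comm_groupE(2) by blast

lemma ext_sum_closed:
  assumes "\<delta> \<in> carrier (Ext E Z A)" "\<rho> \<in> carrier (Ext E Z' A')"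
    "Z \<in> Ob C" "A \<in> Ob C" "Z' \<in> Ob C" "A' \<in> Ob C"
  shows "ext_sum C E Z A \<delta> Z' A' \<rho> \<in> carrier (Ext E (osum C Z Z') (osum C A A'))"
  unfolding ext_sum_def using assms by (auto intro!: Ext_mult_closed Emap_closed)

text \<open>
  The injections are morphisms of extensions \<open>\<delta> \<rightarrow> \<delta> \<oplus> \<rho>\<close> and \<open>\<rho> \<rightarrow> \<delta> \<oplus> \<rho>\<close>; this and the dual
  statement for the projections are what is lifted to realizations.
\<close>

lemma ext_sum_in:
  assumes "\<delta> \<in> carrier (Ext E Z A)" "\<rho> \<in> carrier (Ext E Z' A')"
    "Z \<in> Ob C" "A \<in> Ob C" "Z' \<in> Ob C" "A' \<in> Ob C"
  shows "Emap E (i1 Z Z') (Idm C (osum C A A')) (ext_sum C E Z A \<delta> Z' A' \<rho>) = Emap E (Idm C Z) (i1 A A') \<delta>"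
    "Emap E (i2 Z Z') (Idm C (osum C A A')) (ext_sum C E Z A \<delta> Z' A' \<rho>) = Emap E (Idm C Z') (i2 A A') \<rho>"
  unfolding ext_sum_def using assms
  by (simp_all add: Emap_mult[where A = "osum C A A'" and Z = "osum C Z Z'" and A' = "osum C A A'"]
      Emap_closed Emap_Emap[where Z = Z and A = A] Emap_Emap[where Z = Z' and A = A']
      Emap_zr_left[where A = A] Emap_zr_left[where A = A'])

lemma ext_sum_pr:
  assumes "\<delta> \<in> carrier (Ext E Z A)" "\<rho> \<in> carrier (Ext E Z' A')"
    "Z \<in> Ob C" "A \<in> Ob C" "Z' \<in> Ob C" "A' \<in> Ob C"
  shows "Emap E (Idm C (osum C Z Z')) (p1 A A') (ext_sum C E Z A \<delta> Z' A' \<rho>) = Emap E (p1 Z Z') (Idm C A) \<delta>"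
    "Emap E (Idm C (osum C Z Z')) (p2 A A') (ext_sum C E Z A \<delta> Z' A' \<rho>) = Emap E (p2 Z Z') (Idm C A') \<rho>"
  unfolding ext_sum_def using assms
  by (simp_all add: Emap_mult[where A = "osum C A A'" and Z = "osum C Z Z'"]
      Emap_closed Emap_Emap[where Z = Z and A = A] Emap_Emap[where Z = Z' and A = A']
      Emap_zr_right[where Z = Z] Emap_zr_right[where Z = Z'])

end

section \<open>Distinguished exangles\<close>

context exact_realization
begin

abbreviation D :: "(('o, 'm) cpx \<times> 'e) set" where
  "D \<equiv> distinguished n C E s"

lemma distinguishedD:
  assumes "(X, \<delta>) \<in> D"
  shows "is_cpx n C X" "\<delta> \<in> carrier (Ext E (ob X (Suc n)) (ob X 0))"
  using assms by (simp_all add: distinguished_def)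

lemma ex_distinguished:
  assumes "\<delta> \<in> carrier (Ext E Z A)" "Z \<in> Ob C" "A \<in> Ob C"
  obtains X where "(X, \<delta>) \<in> D" "ob X 0 = A" "ob X (Suc n) = Z"
  using realizes[of A Z \<delta>] assms that by (auto simp: distinguished_def cpx_between_def)

lemma coexact_distinguished:
  assumes "(X, \<delta>) \<in> D"
  shows "coexact n X"
  unfolding coexact_def
proof (intro allI impI, elim conjE)
  fix i f assume i: "i < n" and f: "arr f" "dm f = ob X (Suc i)" "f \<bullet> df X i = zr (ob X i) (cd f)"
  note [simp] = is_cpxD[OF distinguishedD(1)[OF assms]]
  have "{f' \<in> carrier (Hom C (ob X (Suc i)) (cd f)). f' \<bullet> df X i = zr (ob X i) (cd f)} =
      (\<lambda>g. g \<bullet> df X (Suc i)) ` carrier (Hom C (ob X (Suc (Suc i))) (cd f))"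
    using R1[OF assms, unfolded n_exangle_def, THEN conjunct2, THEN conjunct2, THEN bspec,
        OF cd_Ob[OF f(1)], THEN conjunct2, THEN conjunct2, THEN conjunct1, THEN spec, of "Suc i"] i
    by simp
  moreover have "f \<in> {f' \<in> carrier (Hom C (ob X (Suc i)) (cd f)). f' \<bullet> df X i = zr (ob X i) (cd f)}"
    using f i by (simp add: in_Hom_iff)
  ultimately have "f \<in> (\<lambda>g. g \<bullet> df X (Suc i)) ` carrier (Hom C (ob X (Suc (Suc i))) (cd f))"
    by simp
  then show "\<exists>g. arr g \<and> dm g = ob X (Suc (Suc i)) \<and> cd g = cd f \<and> f = g \<bullet> df X (Suc i)"
    using i f(1) by (simp add: image_iff Bex_def in_Hom_iff)
qed

lemma pull_zero_iff:
  assumes "(X, \<delta>) \<in> D" "arr f" "cd f = ob X (Suc n)"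
  shows "Emap E f (Idm C (ob X 0)) \<delta> = \<one>\<^bsub>Ext E (dm f) (ob X 0)\<^esub> \<longleftrightarrow>
    (\<exists>g. arr g \<and> dm g = dm f \<and> cd g = ob X n \<and> f = df X n \<bullet> g)"
proof -
  note [simp] = is_cpxD[OF distinguishedD(1)[OF assms(1)]]
  have "{f' \<in> carrier (Hom C (dm f) (ob X (Suc n))).
        Emap E f' (Idm C (ob X 0)) \<delta> = \<one>\<^bsub>Ext E (dm f) (ob X 0)\<^esub>} =
      (\<lambda>g. df X n \<bullet> g) ` carrier (Hom C (dm f) (ob X n))"
    using R1[OF assms(1), unfolded n_exangle_def, THEN conjunct2, THEN conjunct2, THEN bspec,
        OF dm_Ob[OF assms(2)], THEN conjunct2, THEN conjunct1]
    by (simp only: pull_def Suc_eq_plus1)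
  moreover have "f \<in> carrier (Hom C (dm f) (ob X (Suc n)))"
    using assms by (simp add: in_Hom_iff)
  ultimately have "Emap E f (Idm C (ob X 0)) \<delta> = \<one>\<^bsub>Ext E (dm f) (ob X 0)\<^esub> \<longleftrightarrow>
      f \<in> (\<lambda>g. df X n \<bullet> g) ` carrier (Hom C (dm f) (ob X n))" by blast
  then show ?thesis using assms(2) by (simp add: image_iff Bex_def in_Hom_iff)
qed

lemma push_zero_iff:
  assumes "(X, \<delta>) \<in> D" "arr f" "dm f = ob X 0"
  shows "Emap E (Idm C (ob X (Suc n))) f \<delta> = \<one>\<^bsub>Ext E (ob X (Suc n)) (cd f)\<^esub> \<longleftrightarrow>
    (\<exists>g. arr g \<and> dm g = ob X (Suc 0) \<and> cd g = cd f \<and> f = g \<bullet> df X 0)"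
proof -
  note [simp] = is_cpxD[OF distinguishedD(1)[OF assms(1)]]
  have "{f' \<in> carrier (Hom C (ob X 0) (cd f)).
        Emap E (Idm C (ob X (Suc n))) f' \<delta> = \<one>\<^bsub>Ext E (ob X (Suc n)) (cd f)\<^esub>} =
      (\<lambda>g. g \<bullet> df X 0) ` carrier (Hom C (ob X (Suc 0)) (cd f))"
    using R1[OF assms(1), unfolded n_exangle_def, THEN conjunct2, THEN conjunct2, THEN bspec,
        OF cd_Ob[OF assms(2)], THEN conjunct2, THEN conjunct2, THEN conjunct2]
    by (simp only: push_def flip: Suc_eq_plus1) (simp only: One_nat_def)
  moreover have "f \<in> carrier (Hom C (ob X 0) (cd f))"
    using assms by (simp add: in_Hom_iff)
  ultimately have "Emap E (Idm C (ob X (Suc n))) f \<delta> = \<one>\<^bsub>Ext E (ob X (Suc n)) (cd f)\<^esub> \<longleftrightarrow>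
      f \<in> (\<lambda>g. g \<bullet> df X 0) ` carrier (Hom C (ob X (Suc 0)) (cd f))" by blast
  then show ?thesis using assms(2) by (simp add: image_iff Bex_def in_Hom_iff)
qed

lemma pull_deflation:
  assumes "(X, \<delta>) \<in> D"
  shows "Emap E (df X n) (Idm C (ob X 0)) \<delta> = \<one>\<^bsub>Ext E (ob X n) (ob X 0)\<^esub>"
proof -
  note [simp] = is_cpxD[OF distinguishedD(1)[OF assms]]
  have "\<exists>g. arr g \<and> dm g = dm (df X n) \<and> cd g = ob X n \<and> df X n = df X n \<bullet> g"
    by (rule exI[of _ "Idm C (ob X n)"]) simp
  then show ?thesis using pull_zero_iff[OF assms, of "df X n"] by simp
qed

lemma push_inflation:
  assumes "(X, \<delta>) \<in> D"
  shows "Emap E (Idm C (ob X (Suc n))) (df X 0) \<delta> = \<one>\<^bsub>Ext E (ob X (Suc n)) (ob X (Suc 0))\<^esub>"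
proof -
  note [simp] = is_cpxD[OF distinguishedD(1)[OF assms]]
  have "\<exists>g. arr g \<and> dm g = ob X (Suc 0) \<and> cd g = cd (df X 0) \<and> df X 0 = g \<bullet> df X 0"
    by (rule exI[of _ "Idm C (ob X 1)"]) simp
  then show ?thesis using push_zero_iff[OF assms, of "df X 0"] by simp
qed

lemma lift_exists:
  assumes "(X, \<delta>) \<in> D" "(Y, \<rho>) \<in> D" "arr a" "dm a = ob X 0" "cd a = ob Y 0"
    "arr c" "dm c = ob X (Suc n)" "cd c = ob Y (Suc n)"
    and "Emap E (Idm C (ob X (Suc n))) a \<delta> = Emap E c (Idm C (ob Y 0)) \<rho>"
  obtains f where "cpx_mor n C X Y f" "f 0 = a" "f (Suc n) = c"
proof -
  note [simp] = is_cpxD[OF distinguishedD(1)[OF assms(1)]] is_cpxD[OF distinguishedD(1)[OF assms(2)]]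
  have "ext_mor C E (ob X (n+1)) (ob X 0) \<delta> (ob Y (n+1)) (ob Y 0) \<rho> a c"
    using assms by (simp add: ext_mor_def push_def pull_def in_Hom_iff)
  from R0[OF assms(1,2) this] that show thesis by auto
qed

text \<open>
  Axiom (R0) lifts the pair of identities.
\<close>

lemma distinguished_same_ends:
  assumes "(X, \<delta>) \<in> D" "(Y, \<delta>) \<in> D" "ob X 0 = ob Y 0" "ob X (Suc n) = ob Y (Suc n)"
  obtains f where "weak_isomorphism n C E X \<delta> Y \<delta> f"
proof -
  note [simp] = is_cpxD[OF distinguishedD(1)[OF assms(1)]] is_cpxD[OF distinguishedD(1)[OF assms(2)]]
  have O: "ob Y 0 \<in> Ob C" "ob Y (Suc n) \<in> Ob C" by simp_all
  obtain f where f: "cpx_mor n C X Y f" "f 0 = Idm C (ob Y 0)" "f (Suc n) = Idm C (ob Y (Suc n))"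
    by (rule lift_exists[OF assms(1,2), of "Idm C (ob Y 0)" "Idm C (ob Y (Suc n))"])
      (use assms O in simp_all)
  have iso: "isomorphism C A A (Idm C A)" if "A \<in> Ob C" for A
    unfolding isomorphism_def using that Id_in_Hom[OF that] by (auto intro!: bexI[of _ "Idm C A"])
  have "weak_isomorphism n C E X \<delta> Y \<delta> f"
    using f assms O iso by (simp add: weak_isomorphism_def exangle_mor_def push_def pull_def)
  then show thesis by (rule that)
qed

text \<open>
  The summand inclusions \<open>X \<rightarrow> W \<leftarrow> Y\<close> and projections \<open>X \<leftarrow> W \<rightarrow> Y\<close> of a realization \<open>W\<close> of
  \<open>\<delta> \<oplus> \<rho>\<close>, obtained from (R0), assemble to chain maps between \<open>X \<oplus> Y\<close> and \<open>W\<close> that are identities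
  at the ends.
\<close>

lemma cpx_sum_distinguished:
  assumes X: "(X, \<delta>) \<in> D" and Y: "(Y, \<rho>) \<in> D"
  shows "(cpx_sum C X Y, ext_sum C E (ob X (n+1)) (ob X 0) \<delta> (ob Y (n+1)) (ob Y 0) \<rho>) \<in> D"
proof -
  let ?A = "osum C (ob X 0) (ob Y 0)" and ?Z = "osum C (ob X (Suc n)) (ob Y (Suc n))"
  let ?S = "cpx_sum C X Y"
  define \<theta> where "\<theta> = ext_sum C E (ob X (Suc n)) (ob X 0) \<delta> (ob Y (Suc n)) (ob Y 0) \<rho>"
  have cX: "is_cpx n C X" and cY: "is_cpx n C Y" using distinguishedD X Y by auto
  note [simp] = is_cpxD(1)[OF cX] is_cpxD(1)[OF cY]
  note de = distinguishedD(2)[OF X] distinguishedD(2)[OF Y]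
  have \<theta>: "\<theta> \<in> carrier (Ext E ?Z ?A)" unfolding \<theta>_def using de by (intro ext_sum_closed) simp_all
  then obtain W where W: "W \<in> cpx_between n C ?A ?Z" "s ?Z ?A \<theta> = hclass n C ?A ?Z W"
    using realizes[of ?A ?Z \<theta>] by auto
  then have Wd: "(W, \<theta>) \<in> D" and W0: "ob W 0 = ?A" "ob W (Suc n) = ?Z" and cW: "is_cpx n C W"
    using \<theta> by (auto simp: distinguished_def cpx_between_def)
  have cS: "is_cpx n C ?S" by (rule is_cpx_cpx_sum[OF cX cY])
  then have S: "?S \<in> cpx_between n C ?A ?Z" by (simp add: cpx_between_def)
  obtain f where f: "cpx_mor n C X W f" "f 0 = i1 (ob X 0) (ob Y 0)"
    "f (Suc n) = i1 (ob X (Suc n)) (ob Y (Suc n))"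
    by (rule lift_exists[OF X Wd, of "i1 (ob X 0) (ob Y 0)" "i1 (ob X (Suc n)) (ob Y (Suc n))"])
      (use W0 de in \<open>simp_all add: \<theta>_def ext_sum_in\<close>)
  obtain g where g: "cpx_mor n C Y W g" "g 0 = i2 (ob X 0) (ob Y 0)"
    "g (Suc n) = i2 (ob X (Suc n)) (ob Y (Suc n))"
    by (rule lift_exists[OF Y Wd, of "i2 (ob X 0) (ob Y 0)" "i2 (ob X (Suc n)) (ob Y (Suc n))"])
      (use W0 de in \<open>simp_all add: \<theta>_def ext_sum_in\<close>)
  obtain f' where f': "cpx_mor n C W X f'" "f' 0 = p1 (ob X 0) (ob Y 0)"
    "f' (Suc n) = p1 (ob X (Suc n)) (ob Y (Suc n))"
    by (rule lift_exists[OF Wd X, of "p1 (ob X 0) (ob Y 0)" "p1 (ob X (Suc n)) (ob Y (Suc n))"])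
      (use W0 de in \<open>simp_all add: \<theta>_def ext_sum_pr\<close>)
  obtain g' where g': "cpx_mor n C W Y g'" "g' 0 = p2 (ob X 0) (ob Y 0)"
    "g' (Suc n) = p2 (ob X (Suc n)) (ob Y (Suc n))"
    by (rule lift_exists[OF Wd Y, of "p2 (ob X 0) (ob Y 0)" "p2 (ob X (Suc n)) (ob Y (Suc n))"])
      (use W0 de in \<open>simp_all add: \<theta>_def ext_sum_pr\<close>)
  have "homotopy_equivalent n C ?A ?Z W ?S"
  proof (rule homotopy_equivalentI[OF W(1) S])
    show "coexact n W" by (rule coexact_distinguished[OF Wd])
    show "coexact n ?S"
      by (rule coexact_cpx_sum[OF cX cY coexact_distinguished[OF X] coexact_distinguished[OF Y]])
    show "cpx_mor_between n C ?A ?Z ?S W (\<lambda>i. f i \<bullet> p1 (ob X i) (ob Y i) \<boxplus> g i \<bullet> p2 (ob X i) (ob Y i))"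
      using cpx_mor_from_sum[OF cX cY cW f(1) g(1)] f g by (simp add: cpx_mor_between_def)
    show "cpx_mor_between n C ?A ?Z W ?S (\<lambda>i. i1 (ob X i) (ob Y i) \<bullet> f' i \<boxplus> i2 (ob X i) (ob Y i) \<bullet> g' i)"
      using cpx_mor_into_sum[OF cX cY cW f'(1) g'(1)] f' g' by (simp add: cpx_mor_between_def)
  qed
  then have "s ?Z ?A \<theta> = hclass n C ?A ?Z ?S" using hclass_eqI[OF W(1) S] W(2) by simp
  then show ?thesis using cS \<theta> by (simp add: distinguished_def \<theta>_def)
qed

end

section \<open>The long exact sequences\<close>

context n_exangulated_category
begin

text \<open>
  Exactness of \<open>\<C>(-, X\<^sup>n\<^sup>+\<^sup>1) \<rightarrow> \<E>(-, X\<^sup>0) \<rightarrow> \<E>(-, X\<^sup>1)\<close> at the middle term. Put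
  \<open>\<theta> = [\<delta>  \<epsilon>] \<in> \<E>(X\<^sup>n\<^sup>+\<^sup>1 \<oplus> G, X\<^sup>0)\<close>, so that \<open>\<delta>\<close> is the restriction of \<open>\<theta>\<close> to the first summand.
  The mapping cone given by (EA2) for that restriction has extension \<open>(d\<^sub>X)\<^sub>* \<theta> = 0\<close>, so its last map
  \<open>[i\<^sub>1  d\<^sub>W]\<close> is a split epimorphism. Hence \<open>i\<^sub>2 = i\<^sub>1 u + d\<^sub>W w\<close>, and pulling \<open>\<theta>\<close> back along both
  sides gives \<open>\<epsilon> = u\<^sup>* \<delta>\<close>.
\<close>

lemma ext_killed_by_inflation:
  assumes n: "n \<ge> 1" and X: "(X, \<delta>) \<in> D" and \<epsilon>: "\<epsilon> \<in> carrier (Ext E G (ob X 0))" and G: "G \<in> Ob C"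
    and 0: "Emap E (Idm C G) (df X 0) \<epsilon> = \<one>\<^bsub>Ext E G (ob X (Suc 0))\<^esub>"
  obtains u where "arr u" "dm u = G" "cd u = ob X (Suc n)" "\<epsilon> = Emap E u (Idm C (ob X 0)) \<delta>"
proof -
  let ?A = "ob X 0" and ?Q = "ob X (Suc n)"
  let ?QG = "osum C ?Q G"
  have cX: "is_cpx n C X" using distinguishedD X by auto
  note [simp] = is_cpxD[OF cX] G
  note \<delta> = distinguishedD(2)[OF X]
  define \<theta> where "\<theta> = Emap E (p1 ?Q G) (Idm C ?A) \<delta> \<otimes>\<^bsub>Ext E ?QG ?A\<^esub> Emap E (p2 ?Q G) (Idm C ?A) \<epsilon>"
  have \<theta>: "\<theta> \<in> carrier (Ext E ?QG ?A)"
    unfolding \<theta>_def using \<delta> \<epsilon> by (auto intro!: Ext_mult_closed Emap_closed)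
  have cl: "Emap E (p1 ?Q G) (Idm C ?A) \<delta> \<in> carrier (Ext E ?QG ?A)"
    "Emap E (p2 ?Q G) (Idm C ?A) \<epsilon> \<in> carrier (Ext E ?QG ?A)"
    by (rule Emap_closed[OF \<delta>] Emap_closed[OF \<epsilon>]; simp)+
  have \<theta>1: "Emap E (i1 ?Q G) (Idm C ?A) \<theta> = \<delta>"
    by (simp add: \<theta>_def Emap_mult[OF cl] Emap_Emap[OF \<delta>] Emap_Emap[OF \<epsilon>] Emap_Idm[OF \<delta>]
        Emap_zr_left[OF \<epsilon>] \<delta>)
  have \<theta>2: "Emap E (i2 ?Q G) (Idm C ?A) \<theta> = \<epsilon>"
    by (simp add: \<theta>_def Emap_mult[OF cl] Emap_Emap[OF \<delta>] Emap_Emap[OF \<epsilon>] Emap_Idm[OF \<epsilon>]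
        Emap_zr_left[OF \<delta>] \<epsilon>)
  have \<theta>3: "Emap E (Idm C ?QG) (df X 0) \<theta> = \<one>\<^bsub>Ext E ?QG (ob X (Suc 0))\<^esub>"
  proof -
    have "Emap E (p1 ?Q G) (df X 0) \<delta> = Emap E (p1 ?Q G) (Idm C (ob X (Suc 0))) (Emap E (Idm C ?Q) (df X 0) \<delta>)"
      by (simp add: Emap_Emap[OF \<delta>])
    then have 1: "Emap E (p1 ?Q G) (df X 0) \<delta> = \<one>\<^bsub>Ext E ?QG (ob X (Suc 0))\<^esub>"
      by (simp add: push_inflation[OF X] Emap_one)
    have "Emap E (p2 ?Q G) (df X 0) \<epsilon> = Emap E (p2 ?Q G) (Idm C (ob X (Suc 0))) (Emap E (Idm C G) (df X 0) \<epsilon>)"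
      by (simp add: Emap_Emap[OF \<epsilon>])
    then have 2: "Emap E (p2 ?Q G) (df X 0) \<epsilon> = \<one>\<^bsub>Ext E ?QG (ob X (Suc 0))\<^esub>"
      by (simp add: 0 Emap_one)
    show ?thesis
      by (simp add: \<theta>_def Emap_mult[OF cl] Emap_Emap[OF \<delta>] Emap_Emap[OF \<epsilon>] 1 2 Ext_one_closed)
  qed
  obtain W where W: "(W, \<theta>) \<in> D" "ob W 0 = ?A" "ob W (Suc n) = ?QG"
    using ex_distinguished[OF \<theta>] by auto
  have cW: "is_cpx n C W" using distinguishedD W by auto
  note [simp] = is_cpxD[OF cW] W(2,3)
  have "(X, pull C E (ob W 0) (i1 ?Q G) \<theta>) \<in> D" using \<theta>1 X by (simp add: pull_def)
  moreover have "i1 ?Q G \<in> carrier (Hom C (ob X (n+1)) (ob W (n+1)))" by (simp add: in_Hom_iff)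
  ultimately obtain f where f: "cpx_mor n C X W f" "f 0 = Idm C ?A" "f (n+1) = i1 ?Q G"
    and M: "(mapping_cone n C X W f, push C E (ob W (n+1)) (df X 0) \<theta>) \<in> D"
    using EA2[OF _ W(1)] W(2) by metis
  define K where "K = mapping_cone n C X W f"
  have K: "(K, \<one>\<^bsub>Ext E ?QG (ob X (Suc 0))\<^esub>) \<in> D" using M \<theta>3 by (simp add: push_def K_def)
  have Kob: "ob K (Suc n) = ?QG" "ob K 0 = ob X (Suc 0)" "ob K n = osum C ?Q (ob W n)"
    using n by (auto simp: K_def mapping_cone_def)
  have Kdf: "df K n = i1 ?Q G \<bullet> p1 ?Q (ob W n) \<boxplus> df W n \<bullet> p2 ?Q (ob W n)"
    using n f by (simp add: K_def mapping_cone_def)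
  have "\<exists>g. arr g \<and> dm g = ?QG \<and> cd g = ob K n \<and> Idm C ?QG = df K n \<bullet> g"
    using pull_zero_iff[OF K, of "Idm C ?QG"] Kob by (simp add: Emap_one)
  then obtain r where r: "arr r" "dm r = ?QG" "cd r = osum C ?Q (ob W n)" "Idm C ?QG = df K n \<bullet> r"
    using Kob by auto
  let ?u = "p1 ?Q (ob W n) \<bullet> (r \<bullet> i2 ?Q G)" and ?w = "p2 ?Q (ob W n) \<bullet> (r \<bullet> i2 ?Q G)"
  have "i2 ?Q G = (df K n \<bullet> r) \<bullet> i2 ?Q G" using r(4) by (simp flip: r(4))
  also have "\<dots> = i1 ?Q G \<bullet> ?u \<boxplus> df W n \<bullet> ?w" using r(1-3) by (simp add: Kdf)
  finally have i2: "i2 ?Q G = i1 ?Q G \<bullet> ?u \<boxplus> df W n \<bullet> ?w" .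
  have w: "Emap E (df W n \<bullet> ?w) (Idm C ?A) \<theta> = \<one>\<^bsub>Ext E G ?A\<^esub>"
  proof -
    have "Emap E (df W n \<bullet> ?w) (Idm C ?A) \<theta> = Emap E ?w (Idm C ?A) (Emap E (df W n) (Idm C ?A) \<theta>)"
      using r(1-3) by (simp add: Emap_Emap[OF \<theta>])
    then show ?thesis using pull_deflation[OF W(1)] r(1-3) by (simp add: Emap_one)
  qed
  have u: "Emap E (i1 ?Q G \<bullet> ?u) (Idm C ?A) \<theta> = Emap E ?u (Idm C ?A) \<delta>"
  proof -
    have "Emap E (i1 ?Q G \<bullet> ?u) (Idm C ?A) \<theta> = Emap E ?u (Idm C ?A) (Emap E (i1 ?Q G) (Idm C ?A) \<theta>)"
      using r(1-3) by (simp add: Emap_Emap[OF \<theta>])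
    then show ?thesis by (simp add: \<theta>1)
  qed
  have "\<epsilon> = Emap E (i1 ?Q G \<bullet> ?u \<boxplus> df W n \<bullet> ?w) (Idm C ?A) \<theta>" using \<theta>2 i2 by simp
  also have "\<dots> = Emap E ?u (Idm C ?A) \<delta> \<otimes>\<^bsub>Ext E G ?A\<^esub> \<one>\<^bsub>Ext E G ?A\<^esub>"
    using r(1-3) by (subst Emap_pl_left[OF \<theta>]) (simp_all add: u w)
  also have "\<dots> = Emap E ?u (Idm C ?A) \<delta>"
    using r(1-3) Emap_closed[OF \<delta>, of ?u G "Idm C ?A" ?A] by simp
  finally show thesis using that[of ?u] r(1-3) by simp
qed

text \<open>
  The dual statement, with \<open>\<theta> \<in> \<E>(X\<^sup>n\<^sup>+\<^sup>1, X\<^sup>0 \<oplus> G)\<close>, the first projection and a mapping cocone whose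
  first map is a split monomorphism.
\<close>

lemma ext_killed_by_deflation:
  assumes n: "n \<ge> 1" and X: "(X, \<delta>) \<in> D" and \<epsilon>: "\<epsilon> \<in> carrier (Ext E (ob X (Suc n)) G)" and G: "G \<in> Ob C"
    and 0: "Emap E (df X n) (Idm C G) \<epsilon> = \<one>\<^bsub>Ext E (ob X n) G\<^esub>"
  obtains u where "arr u" "dm u = ob X 0" "cd u = G" "\<epsilon> = Emap E (Idm C (ob X (Suc n))) u \<delta>"
proof -
  let ?A = "ob X 0" and ?Q = "ob X (Suc n)"
  let ?AG = "osum C ?A G"
  have cX: "is_cpx n C X" using distinguishedD X by auto
  note [simp] = is_cpxD[OF cX] G
  note \<delta> = distinguishedD(2)[OF X]
  define \<theta> where "\<theta> = Emap E (Idm C ?Q) (i1 ?A G) \<delta> \<otimes>\<^bsub>Ext E ?Q ?AG\<^esub> Emap E (Idm C ?Q) (i2 ?A G) \<epsilon>"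
  have \<theta>: "\<theta> \<in> carrier (Ext E ?Q ?AG)"
    unfolding \<theta>_def using \<delta> \<epsilon> by (auto intro!: Ext_mult_closed Emap_closed)
  have cl: "Emap E (Idm C ?Q) (i1 ?A G) \<delta> \<in> carrier (Ext E ?Q ?AG)"
    "Emap E (Idm C ?Q) (i2 ?A G) \<epsilon> \<in> carrier (Ext E ?Q ?AG)"
    by (rule Emap_closed[OF \<delta>] Emap_closed[OF \<epsilon>]; simp)+
  have \<theta>1: "Emap E (Idm C ?Q) (p1 ?A G) \<theta> = \<delta>"
    by (simp add: \<theta>_def Emap_mult[OF cl] Emap_Emap[OF \<delta>] Emap_Emap[OF \<epsilon>] Emap_Idm[OF \<delta>]
        Emap_zr_right[OF \<epsilon>] \<delta>)
  have \<theta>2: "Emap E (Idm C ?Q) (p2 ?A G) \<theta> = \<epsilon>"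
    by (simp add: \<theta>_def Emap_mult[OF cl] Emap_Emap[OF \<delta>] Emap_Emap[OF \<epsilon>] Emap_Idm[OF \<epsilon>]
        Emap_zr_right[OF \<delta>] \<epsilon>)
  have \<theta>3: "Emap E (df X n) (Idm C ?AG) \<theta> = \<one>\<^bsub>Ext E (ob X n) ?AG\<^esub>"
  proof -
    have "Emap E (df X n) (i1 ?A G) \<delta> = Emap E (Idm C (ob X n)) (i1 ?A G) (Emap E (df X n) (Idm C ?A) \<delta>)"
      by (simp add: Emap_Emap[OF \<delta>])
    then have 1: "Emap E (df X n) (i1 ?A G) \<delta> = \<one>\<^bsub>Ext E (ob X n) ?AG\<^esub>"
      by (simp add: pull_deflation[OF X] Emap_one)
    have "Emap E (df X n) (i2 ?A G) \<epsilon> = Emap E (Idm C (ob X n)) (i2 ?A G) (Emap E (df X n) (Idm C G) \<epsilon>)"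
      by (simp add: Emap_Emap[OF \<epsilon>])
    then have 2: "Emap E (df X n) (i2 ?A G) \<epsilon> = \<one>\<^bsub>Ext E (ob X n) ?AG\<^esub>"
      by (simp add: 0 Emap_one)
    show ?thesis
      by (simp add: \<theta>_def Emap_mult[OF cl] Emap_Emap[OF \<delta>] Emap_Emap[OF \<epsilon>] 1 2 Ext_one_closed)
  qed
  obtain W where W: "(W, \<theta>) \<in> D" "ob W 0 = ?AG" "ob W (Suc n) = ?Q"
    using ex_distinguished[OF \<theta>] by auto
  have cW: "is_cpx n C W" using distinguishedD W by auto
  note [simp] = is_cpxD[OF cW] W(2,3)
  have "(X, push C E (ob W (n+1)) (p1 ?A G) \<theta>) \<in> D" using \<theta>1 X by (simp add: push_def)
  moreover have "p1 ?A G \<in> carrier (Hom C (ob W 0) (ob X 0))" by (simp add: in_Hom_iff)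
  ultimately obtain h where h: "cpx_mor n C W X h" "h 0 = p1 ?A G" "h (n+1) = Idm C (ob W (n+1))"
    and M: "(mapping_cocone n C W X h, pull C E (ob W 0) (df X n) \<theta>) \<in> D"
    using EA2_op[OF W(1)] W(3) by (metis Suc_eq_plus1)
  define K where "K = mapping_cocone n C W X h"
  have K: "(K, \<one>\<^bsub>Ext E (ob X n) ?AG\<^esub>) \<in> D" using M \<theta>3 by (simp add: pull_def K_def)
  have Kob: "ob K (Suc n) = ob X n" "ob K 0 = ?AG" "ob K (Suc 0) = osum C (ob W (Suc 0)) ?A"
    using n by (auto simp: K_def mapping_cocone_def)
  have Kdf: "df K 0 = i1 (ob W (Suc 0)) ?A \<bullet> mi (df W 0) \<boxplus> i2 (ob W (Suc 0)) ?A \<bullet> p1 ?A G"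
    using n h by (simp add: K_def mapping_cocone_def)
  have "\<exists>g. arr g \<and> dm g = ob K (Suc 0) \<and> cd g = ?AG \<and> Idm C ?AG = g \<bullet> df K 0"
    using push_zero_iff[OF K, of "Idm C ?AG"] Kob by (simp add: Emap_one)
  then obtain r where r: "arr r" "dm r = osum C (ob W (Suc 0)) ?A" "cd r = ?AG" "Idm C ?AG = r \<bullet> df K 0"
    using Kob by auto
  let ?u = "p2 ?A G \<bullet> (r \<bullet> i2 (ob W (Suc 0)) ?A)"
  let ?w = "p2 ?A G \<bullet> (r \<bullet> (i1 (ob W (Suc 0)) ?A))"
  have "p2 ?A G = p2 ?A G \<bullet> (r \<bullet> df K 0)" by (simp flip: r(4))
  also have "\<dots> = mi ?w \<bullet> df W 0 \<boxplus> ?u \<bullet> p1 ?A G" using r(1-3) by (simp add: Kdf)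
  finally have p2: "p2 ?A G = mi ?w \<bullet> df W 0 \<boxplus> ?u \<bullet> p1 ?A G" .
  have w: "Emap E (Idm C ?Q) (mi ?w \<bullet> df W 0) \<theta> = \<one>\<^bsub>Ext E ?Q G\<^esub>"
  proof -
    have "Emap E (Idm C ?Q) (mi ?w \<bullet> df W 0) \<theta>
        = Emap E (Idm C ?Q) (mi ?w) (Emap E (Idm C ?Q) (df W 0) \<theta>)"
      using r(1-3) by (simp add: Emap_Emap[OF \<theta>])
    then show ?thesis using push_inflation[OF W(1)] r(1-3) by (simp add: Emap_one)
  qed
  have u: "Emap E (Idm C ?Q) (?u \<bullet> p1 ?A G) \<theta> = Emap E (Idm C ?Q) ?u \<delta>"
  proof -
    have "Emap E (Idm C ?Q) (?u \<bullet> p1 ?A G) \<theta> = Emap E (Idm C ?Q) ?u (Emap E (Idm C ?Q) (p1 ?A G) \<theta>)"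
      using r(1-3) by (simp add: Emap_Emap[OF \<theta>])
    then show ?thesis by (simp add: \<theta>1)
  qed
  have "\<epsilon> = Emap E (Idm C ?Q) (mi ?w \<bullet> df W 0 \<boxplus> ?u \<bullet> p1 ?A G) \<theta>" using \<theta>2 p2 by simp
  also have "\<dots> = Emap E (Idm C ?Q) (mi ?w \<bullet> df W 0) \<theta> \<otimes>\<^bsub>Ext E ?Q G\<^esub>
      Emap E (Idm C ?Q) (?u \<bullet> p1 ?A G) \<theta>"
    using r(1-3) by (intro Emap_pl_right[OF \<theta>]) simp_all
  also have "\<dots> = \<one>\<^bsub>Ext E ?Q G\<^esub> \<otimes>\<^bsub>Ext E ?Q G\<^esub> Emap E (Idm C ?Q) ?u \<delta>"
    by (simp only: u w)
  also have "\<dots> = Emap E (Idm C ?Q) ?u \<delta>"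
    using r(1-3) Emap_closed[OF \<delta>, of "Idm C ?Q" ?Q ?u G] by simp
  finally show thesis using that[of ?u] r(1-3) by simp
qed

end

section \<open>Restriction to a class of distinguished exangles\<close>

locale exangle_class = n_exangulated_category C E n s
  for C :: "('o, 'm) acat" and E :: "('o, 'm, 'e) bifun" and n :: nat
    and s :: "('o, 'm, 'e) realiz" +
  fixes \<xi> :: "(('o, 'm) cpx \<times> 'e) set"
  assumes n_pos: "1 \<le> n"
    and class_distinguished: "\<xi> \<subseteq> distinguished n C E s"
    and weak_iso_closed: "closed_under_weak_isos n C E s \<xi>"
begin

abbreviation E\<xi> :: "('o, 'm, 'e) bifun" where
  "E\<xi> \<equiv> restrict_bifun n E \<xi>"

abbreviation s\<xi> :: "('o, 'm, 'e) realiz" where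
  "s\<xi> \<equiv> restrict_realiz n E s \<xi>"

lemma carrier_restrict: "\<delta> \<in> carrier (Ext E\<xi> Z A) \<longleftrightarrow>
    \<delta> \<in> carrier (Ext E Z A) \<and> (\<exists>X. (X, \<delta>) \<in> \<xi> \<and> ob X 0 = A \<and> ob X (Suc n) = Z)"
  by (simp add: restrict_bifun_def)

lemma restrict_simps [simp]:
  "mult (Ext E\<xi> Z A) = mult (Ext E Z A)" "\<one>\<^bsub>Ext E\<xi> Z A\<^esub> = \<one>\<^bsub>Ext E Z A\<^esub>"
  "Emap E\<xi> = Emap E" "push C E\<xi> = push C E" "pull C E\<xi> = pull C E"
  "ext_mor C E\<xi> = ext_mor C E" "ext_sum C E\<xi> = ext_sum C E"
  by (simp_all add: restrict_bifun_def push_def pull_def ext_mor_def ext_sum_def fun_eq_iff)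

text \<open>
  Membership in \<open>\<xi>\<close> is a property of the extension: another realization with the same ends is
  weakly isomorphic.
\<close>

lemma in_class_iff:
  assumes "(X, \<delta>) \<in> D"
  shows "(X, \<delta>) \<in> \<xi> \<longleftrightarrow> \<delta> \<in> carrier (Ext E\<xi> (ob X (Suc n)) (ob X 0))"
proof
  assume "(X, \<delta>) \<in> \<xi>"
  then show "\<delta> \<in> carrier (Ext E\<xi> (ob X (Suc n)) (ob X 0))"
    using distinguishedD(2)[OF assms] by (auto simp: carrier_restrict)
next
  assume "\<delta> \<in> carrier (Ext E\<xi> (ob X (Suc n)) (ob X 0))"
  then obtain Y where Y: "(Y, \<delta>) \<in> \<xi>" "ob Y 0 = ob X 0" "ob Y (Suc n) = ob X (Suc n)"
    by (auto simp: carrier_restrict)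
  then have "(Y, \<delta>) \<in> D" using class_distinguished by auto
  with distinguished_same_ends[OF _ assms Y(2,3)] Y(1) assms show "(X, \<delta>) \<in> \<xi>"
    using weak_iso_closed unfolding closed_under_weak_isos_def by metis
qed

lemma distinguished_restrict: "distinguished n C E\<xi> s\<xi> = \<xi>"
proof -
  have "(X, \<delta>) \<in> distinguished n C E\<xi> s\<xi> \<longleftrightarrow> (X, \<delta>) \<in> D \<and> \<delta> \<in> carrier (Ext E\<xi> (ob X (Suc n)) (ob X 0))"
    for X \<delta>
    by (auto simp: distinguished_def restrict_realiz_def carrier_restrict)
  then show ?thesis using in_class_iff class_distinguished by auto
qed

lemma exact_realization_restrict:
  assumes "additive_bifunctor C E\<xi>"
  shows "exact_realization C E\<xi> n s\<xi>"
proof -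
  interpret R: additive_bifunctor C E\<xi> by fact
  have zero: "\<one>\<^bsub>Ext E Z A\<^esub> \<in> carrier (Ext E\<xi> Z A)" if "Z \<in> Ob C" "A \<in> Ob C" for Z A
    using R.Ext_one_closed[OF that] by simp
  have eq: "s\<xi> Z A \<delta> = s Z A \<delta>" if "\<delta> \<in> carrier (Ext E\<xi> Z A)" for Z A \<delta>
    using that by (simp add: restrict_realiz_def)
  show ?thesis
  proof unfold_locales
    fix A Z \<delta> assume "A \<in> Ob C" "Z \<in> Ob C" "\<delta> \<in> carrier (Ext E\<xi> Z A)"
    then show "\<exists>X\<in>cpx_between n C A Z. s\<xi> Z A \<delta> = hclass n C A Z X"
      using realizes[of A Z \<delta>] eq by (simp add: carrier_restrict)
  next
    fix X \<delta> Y \<rho> a c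
    assume "(X, \<delta>) \<in> distinguished n C E\<xi> s\<xi>" "(Y, \<rho>) \<in> distinguished n C E\<xi> s\<xi>"
      "ext_mor C E\<xi> (ob X (n+1)) (ob X 0) \<delta> (ob Y (n+1)) (ob Y 0) \<rho> a c"
    then show "\<exists>f. cpx_mor n C X Y f \<and> f 0 = a \<and> f (n+1) = c"
      using R0 class_distinguished unfolding distinguished_restrict restrict_simps by blast
  next
    fix X \<delta> assume "(X, \<delta>) \<in> distinguished n C E\<xi> s\<xi>"
    then have X: "(X, \<delta>) \<in> \<xi>" "(X, \<delta>) \<in> D"
      using class_distinguished unfolding distinguished_restrict by auto
    have "n_exangle n C E X \<delta>" by (rule R1[OF X(2)])
    moreover have "\<delta> \<in> carrier (Ext E\<xi> (ob X (n+1)) (ob X 0))" using in_class_iff[OF X(2)] X(1) by simp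
    ultimately show "n_exangle n C E\<xi> X \<delta>"
      unfolding n_exangle_def restrict_simps by (elim conjE, intro conjI) assumption+
  next
    fix A Z assume "A \<in> Ob C" "zero_object C Z"
    then show "s\<xi> Z A \<one>\<^bsub>Ext E\<xi> Z A\<^esub> = hclass n C A Z (triv_left C A Z)"
      "s\<xi> A Z \<one>\<^bsub>Ext E\<xi> A Z\<^esub> = hclass n C Z A (triv_right n C A Z)"
      using eq zero R2_left R2_right by (simp_all add: zero_object_def)
  qed
qed

text \<open>
  Given the bifunctor and (EA1), nothing is left to prove for (EA2): the lift and the distinguished
  mapping (co)cone exist for \<open>\<s>\<close>, and its extension is the image of a member of \<open>\<E>\<^sub>\<xi>\<close> under the action of a
  morphism.
\<close>

lemma n_exangulated_restrictI:
  assumes bif: "additive_bifunctor C E\<xi>"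
    and infl: "\<And>f g. \<lbrakk>arr f; arr g; dm g = cd f; f \<in> inflations \<xi>; g \<in> inflations \<xi>\<rbrakk>
      \<Longrightarrow> g \<bullet> f \<in> inflations \<xi>"
    and defl: "\<And>f g. \<lbrakk>arr f; arr g; dm g = cd f; f \<in> deflations n \<xi>; g \<in> deflations n \<xi>\<rbrakk>
      \<Longrightarrow> g \<bullet> f \<in> deflations n \<xi>"
  shows "n_exangulated_category C E\<xi> n s\<xi>"
proof -
  interpret R: exact_realization C E\<xi> n s\<xi> by (rule exact_realization_restrict[OF bif])
  have inD: "p \<in> D" if "p \<in> \<xi>" for p using that class_distinguished by auto
  show ?thesis
  proof (unfold_locales, unfold distinguished_restrict restrict_simps)
    fix A B K f g
    assume "A \<in> Ob C" "B \<in> Ob C" "K \<in> Ob C" "f \<in> carrier (Hom C A B)" "g \<in> carrier (Hom C B K)"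
    then have fg: "arr f" "arr g" "dm g = cd f" by (auto simp: in_Hom_iff)
    show "g \<bullet> f \<in> inflations \<xi>" if "f \<in> inflations \<xi>" "g \<in> inflations \<xi>" by (rule infl[OF fg that])
    show "g \<bullet> f \<in> deflations n \<xi>" if "f \<in> deflations n \<xi>" "g \<in> deflations n \<xi>" by (rule defl[OF fg that])
  next
    fix X Y c \<rho>
    assume X: "(X, pull C E (ob Y 0) c \<rho>) \<in> \<xi>" and Y: "(Y, \<rho>) \<in> \<xi>" and e: "ob X 0 = ob Y 0"
      and c: "c \<in> carrier (Hom C (ob X (n+1)) (ob Y (n+1)))"
    obtain f where f: "cpx_mor n C X Y f" "f 0 = Idm C (ob X 0)" "f (n+1) = c"
      and M: "(mapping_cone n C X Y f, push C E (ob Y (n+1)) (df X 0) \<rho>) \<in> D"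
      using EA2[OF inD[OF X] inD[OF Y] e c] by blast
    note [simp] = is_cpxD[OF distinguishedD(1)[OF inD[OF X]]] is_cpxD[OF distinguishedD(1)[OF inD[OF Y]]]
    have "\<rho> \<in> carrier (Ext E\<xi> (ob Y (Suc n)) (ob Y 0))" using in_class_iff[OF inD[OF Y]] Y by simp
    then have "push C E (ob Y (n+1)) (df X 0) \<rho> \<in> carrier (Ext E\<xi> (ob Y (Suc n)) (ob X (Suc 0)))"
      using R.Emap_closed[of \<rho> "ob Y (Suc n)" "ob Y 0" "Idm C (ob Y (Suc n))" _ "df X 0"] e
      by (simp add: push_def)
    then have "(mapping_cone n C X Y f, push C E (ob Y (n+1)) (df X 0) \<rho>) \<in> \<xi>"
      using in_class_iff[OF M] by (simp add: mapping_cone_def)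
    then show "\<exists>f. cpx_mor n C X Y f \<and> f 0 = Idm C (ob X 0) \<and> f (n+1) = c \<and>
        (mapping_cone n C X Y f, push C E (ob Y (n+1)) (df X 0) \<rho>) \<in> \<xi>"
      using f by blast
  next
    fix X Y a \<rho>
    assume X: "(X, \<rho>) \<in> \<xi>" and Y: "(Y, push C E (ob X (n+1)) a \<rho>) \<in> \<xi>" and e: "ob X (n+1) = ob Y (n+1)"
      and a: "a \<in> carrier (Hom C (ob X 0) (ob Y 0))"
    obtain h where h: "cpx_mor n C X Y h" "h 0 = a" "h (n+1) = Idm C (ob X (n+1))"
      and M: "(mapping_cocone n C X Y h, pull C E (ob X 0) (df Y n) \<rho>) \<in> D"
      using EA2_op[OF inD[OF X] inD[OF Y] e a] by blast
    note [simp] = is_cpxD[OF distinguishedD(1)[OF inD[OF X]]] is_cpxD[OF distinguishedD(1)[OF inD[OF Y]]]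
    have "\<rho> \<in> carrier (Ext E\<xi> (ob X (Suc n)) (ob X 0))" using in_class_iff[OF inD[OF X]] X by simp
    then have "pull C E (ob X 0) (df Y n) \<rho> \<in> carrier (Ext E\<xi> (ob Y n) (ob X 0))"
      using R.Emap_closed[of \<rho> "ob X (Suc n)" "ob X 0" "df Y n" _ "Idm C (ob X 0)"] e
      by (simp add: pull_def)
    then have "(mapping_cocone n C X Y h, pull C E (ob X 0) (df Y n) \<rho>) \<in> \<xi>"
      using in_class_iff[OF M] by (simp add: mapping_cocone_def)
    then show "\<exists>h. cpx_mor n C X Y h \<and> h 0 = a \<and> h (n+1) = Idm C (ob X (n+1)) \<and>
        (mapping_cocone n C X Y h, pull C E (ob X 0) (df Y n) \<rho>) \<in> \<xi>"
      using h by blast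
  qed
qed

text \<open>
  The extension \<open>\<nu>\<close> is killed by \<open>d\<^sub>V\<close>, so also by \<open>d\<^sub>V c\<close>. As \<open>d\<^sub>V c\<close> is the deflation of some
  \<open>\<langle>U, \<mu>\<rangle> \<in> \<xi>\<close>, exactness makes \<open>\<nu>\<close> a pushforward of \<open>\<mu>\<close>. This is saturation with composability of
  \<open>\<xi>\<close>-deflations taken as a hypothesis, and for \<open>c = 1\<close> it recovers membership in \<open>\<xi>\<close> from the deflation
  alone.
\<close>

lemma deflation_factor_in_class:
  assumes bif: "additive_bifunctor C E\<xi>" and V: "(V, \<nu>) \<in> D" and c: "arr c" "cd c = ob V n"
    and d: "df V n \<bullet> c \<in> deflations n \<xi>"
  shows "(V, \<nu>) \<in> \<xi>"
proof -
  interpret R: additive_bifunctor C E\<xi> by fact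
  from d obtain U \<mu> where U: "(U, \<mu>) \<in> \<xi>" "df V n \<bullet> c = df U n" by (auto simp: deflations_def)
  then have UD: "(U, \<mu>) \<in> D" using class_distinguished by auto
  have cU: "is_cpx n C U" and cV: "is_cpx n C V" using distinguishedD(1) UD V by auto
  note [simp] = is_cpxD[OF cV] is_cpxD[OF cU] c
  have Un: "ob U n = dm c" and US: "ob U (Suc n) = ob V (Suc n)"
    using arg_cong[OF U(2), of dm] arg_cong[OF U(2), of cd] by simp_all
  note \<nu> = distinguishedD(2)[OF V]
  have "Emap E (df V n \<bullet> c) (Idm C (ob V 0)) \<nu> =
      Emap E c (Idm C (ob V 0)) (Emap E (df V n) (Idm C (ob V 0)) \<nu>)"
    by (simp add: Emap_Emap[OF \<nu>])
  also have "\<dots> = \<one>\<^bsub>Ext E (dm c) (ob V 0)\<^esub>" by (simp add: pull_deflation[OF V] Emap_one)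
  finally have "Emap E (df U n) (Idm C (ob V 0)) \<nu> = \<one>\<^bsub>Ext E (ob U n) (ob V 0)\<^esub>"
    by (simp add: U(2) Un)
  then obtain u where u: "arr u" "dm u = ob U 0" "cd u = ob V 0"
    "\<nu> = Emap E (Idm C (ob U (Suc n))) u \<mu>"
    using ext_killed_by_deflation[OF n_pos UD, of \<nu> "ob V 0"] \<nu> US by auto
  have "\<mu> \<in> carrier (Ext E\<xi> (ob V (Suc n)) (ob U 0))" using in_class_iff[OF UD] U(1) US by simp
  then have "\<nu> \<in> carrier (Ext E\<xi> (ob V (Suc n)) (ob V 0))"
    using R.Emap_closed[of \<mu> "ob V (Suc n)" "ob U 0" "Idm C (ob V (Suc n))" "ob V (Suc n)" u "ob V 0"] u US
    by simp
  then show ?thesis using in_class_iff[OF V] by simp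
qed

section \<open>Proper classes restrict to exangulated structures\<close>

lemma triv_right_distinguished:
  assumes "A \<in> Ob C" "zero_object C Z"
  shows "(triv_right n C A Z, \<one>\<^bsub>Ext E A Z\<^esub>) \<in> D"
proof -
  have Z: "Z \<in> Ob C" using assms by (simp add: zero_object_def)
  have "is_cpx n C (triv_right n C A Z)"
    using assms(1) Z by (auto simp: is_cpx_iff triv_right_def Let_def)
  then show ?thesis using R2_right[OF assms] n_pos Ext_one_closed[OF assms(1) Z]
    by (simp add: distinguished_def) (simp add: triv_right_def Let_def)
qed

context
  assumes proper: "n_proper_class n C E s \<xi>"
begin

lemma pull_in_class:
  assumes "\<delta> \<in> carrier (Ext E\<xi> Z A)" "arr c" "cd c = Z"
  shows "Emap E c (Idm C A) \<delta> \<in> carrier (Ext E\<xi> (dm c) A)"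
proof -
  obtain X where X: "(X, \<delta>) \<in> \<xi>" "ob X 0 = A" "ob X (Suc n) = Z"
    using assms by (auto simp: carrier_restrict)
  then have XD: "(X, \<delta>) \<in> D" using class_distinguished by auto
  note [simp] = is_cpxD[OF distinguishedD(1)[OF XD]]
  have A: "A \<in> Ob C" using X(2) is_cpxD(1)[OF distinguishedD(1)[OF XD], of 0] by simp
  have "Emap E c (Idm C A) \<delta> \<in> carrier (Ext E (dm c) A)"
    using assms A by (intro Emap_closed[of \<delta> Z A]) (simp_all add: carrier_restrict)
  then obtain Y where Y: "(Y, Emap E c (Idm C A) \<delta>) \<in> D" "ob Y 0 = A" "ob Y (Suc n) = dm c"
    using ex_distinguished A assms(2) by (metis dm_Ob)
  have "c \<in> carrier (Hom C (ob Y (n+1)) (ob X (n+1)))"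
    using assms(2,3) X(3) Y(3) by (auto simp: in_Hom_iff)
  then have "(Y, Emap E c (Idm C A) \<delta>) \<in> \<xi>"
    using proper X Y unfolding n_proper_class_def closed_under_base_change_def pull_def by metis
  then show ?thesis using in_class_iff[OF Y(1)] Y(2,3) by simp
qed

lemma push_in_class:
  assumes "\<delta> \<in> carrier (Ext E\<xi> Z A)" "arr a" "dm a = A"
  shows "Emap E (Idm C Z) a \<delta> \<in> carrier (Ext E\<xi> Z (cd a))"
proof -
  obtain X where X: "(X, \<delta>) \<in> \<xi>" "ob X 0 = A" "ob X (Suc n) = Z"
    using assms by (auto simp: carrier_restrict)
  then have XD: "(X, \<delta>) \<in> D" using class_distinguished by auto
  have Z: "Z \<in> Ob C" using X(3) is_cpxD(1)[OF distinguishedD(1)[OF XD], of "Suc n"] by simp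
  have "Emap E (Idm C Z) a \<delta> \<in> carrier (Ext E Z (cd a))"
    using assms Z by (intro Emap_closed[of \<delta> Z A]) (simp_all add: carrier_restrict)
  then obtain Y where Y: "(Y, Emap E (Idm C Z) a \<delta>) \<in> D" "ob Y 0 = cd a" "ob Y (Suc n) = Z"
    using ex_distinguished Z assms(2) by (metis cd_Ob)
  have "a \<in> carrier (Hom C (ob X 0) (ob Y 0))"
    using assms(2,3) X(2) Y(2) by (auto simp: in_Hom_iff)
  then have "(Y, Emap E (Idm C Z) a \<delta>) \<in> \<xi>"
    using proper X Y unfolding n_proper_class_def closed_under_cobase_change_def push_def
    by (metis Suc_eq_plus1)
  then show ?thesis using in_class_iff[OF Y(1)] Y(2,3) by simp
qed

lemma Emap_in_class:
  assumes \<delta>: "\<delta> \<in> carrier (Ext E\<xi> Z A)" and "arr c" "cd c = Z" "dm c = Z'" "arr a" "dm a = A" "cd a = A'"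
  shows "Emap E c a \<delta> \<in> carrier (Ext E\<xi> Z' A')"
proof -
  have "\<delta> \<in> carrier (Ext E Z A)" using \<delta> by (simp add: carrier_restrict)
  then have "Emap E c a \<delta> = Emap E (Idm C (dm c)) a (Emap E c (Idm C A) \<delta>)"
    using assms by (subst Emap_Emap[of \<delta> Z A]) auto
  then show ?thesis using push_in_class[OF pull_in_class[OF \<delta>], of c a] assms by simp
qed

lemma zero_in_class:
  assumes "Z \<in> Ob C" "A \<in> Ob C"
  shows "\<one>\<^bsub>Ext E Z A\<^esub> \<in> carrier (Ext E\<xi> Z A)"
proof -
  obtain X where X: "(X, \<one>\<^bsub>Ext E Z A\<^esub>) \<in> D" "ob X 0 = A" "ob X (Suc n) = Z"
    using ex_distinguished[OF Ext_one_closed[OF assms] assms] by blast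
  then have "(X, \<one>\<^bsub>Ext E Z A\<^esub>) \<in> split_exangles n C E s" by (simp add: split_exangles_def)
  then have "(X, \<one>\<^bsub>Ext E Z A\<^esub>) \<in> \<xi>" using proper by (auto simp: n_proper_class_def)
  then show ?thesis using in_class_iff[OF X(1)] X(2,3) by simp
qed

text \<open>
  Here \<open>\<delta> + \<epsilon>\<close> is obtained from \<open>\<delta> \<oplus> \<epsilon>\<close> by the diagonal \<open>i\<^sub>1 + i\<^sub>2\<close> of \<open>Z\<close> and the codiagonal
  \<open>p\<^sub>1 + p\<^sub>2\<close> of \<open>A\<close>.
\<close>

lemma sum_in_class:
  assumes \<delta>: "\<delta> \<in> carrier (Ext E\<xi> Z A)" and \<epsilon>: "\<epsilon> \<in> carrier (Ext E\<xi> Z A)"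
    and [simp]: "Z \<in> Ob C" "A \<in> Ob C"
  shows "\<delta> \<otimes>\<^bsub>Ext E Z A\<^esub> \<epsilon> \<in> carrier (Ext E\<xi> Z A)"
proof -
  obtain X where X: "(X, \<delta>) \<in> \<xi>" "ob X 0 = A" "ob X (Suc n) = Z"
    using \<delta> by (auto simp: carrier_restrict)
  obtain Y where Y: "(Y, \<epsilon>) \<in> \<xi>" "ob Y 0 = A" "ob Y (Suc n) = Z"
    using \<epsilon> by (auto simp: carrier_restrict)
  have d: "\<delta> \<in> carrier (Ext E Z A)" "\<epsilon> \<in> carrier (Ext E Z A)"
    using \<delta> \<epsilon> by (auto simp: carrier_restrict)
  define \<theta> where "\<theta> = ext_sum C E Z A \<delta> Z A \<epsilon>"
  let ?ZZ = "osum C Z Z" and ?AA = "osum C A A"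
  have \<theta>: "\<theta> \<in> carrier (Ext E ?ZZ ?AA)" unfolding \<theta>_def using d by (intro ext_sum_closed) simp_all
  have "(cpx_sum C X Y, \<theta>) \<in> \<xi>"
    using proper X Y unfolding n_proper_class_def closed_under_coproducts_def \<theta>_def
    by (metis Suc_eq_plus1)
  then have \<theta>\<xi>: "\<theta> \<in> carrier (Ext E\<xi> ?ZZ ?AA)"
    using \<theta> X Y by (auto simp: carrier_restrict intro!: exI[of _ "cpx_sum C X Y"])
  let ?N = "p1 A A \<boxplus> p2 A A"
  have "Emap E (i1 Z Z) ?N \<theta> = Emap E (Idm C Z) ?N (Emap E (i1 Z Z) (Idm C ?AA) \<theta>)"
    by (simp add: Emap_Emap[OF \<theta>])
  also have "\<dots> = \<delta>"
    unfolding \<theta>_def ext_sum_in(1)[OF d(1,2) assms(3,4,3,4)]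
    by (simp add: Emap_Emap[OF d(1)] Emap_Idm[OF d(1)])
  finally have 1: "Emap E (i1 Z Z) ?N \<theta> = \<delta>" .
  have "Emap E (i2 Z Z) ?N \<theta> = Emap E (Idm C Z) ?N (Emap E (i2 Z Z) (Idm C ?AA) \<theta>)"
    by (simp add: Emap_Emap[OF \<theta>])
  also have "\<dots> = \<epsilon>"
    unfolding \<theta>_def ext_sum_in(2)[OF d(1,2) assms(3,4,3,4)]
    by (simp add: Emap_Emap[OF d(2)] Emap_Idm[OF d(2)])
  finally have 2: "Emap E (i2 Z Z) ?N \<theta> = \<epsilon>" .
  have "Emap E (i1 Z Z \<boxplus> i2 Z Z) ?N \<theta> = \<delta> \<otimes>\<^bsub>Ext E Z A\<^esub> \<epsilon>"
    by (subst Emap_pl_left[OF \<theta>, where Z' = Z and A' = A]) (simp_all add: 1 2)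
  moreover have "Emap E (i1 Z Z \<boxplus> i2 Z Z) ?N \<theta> \<in> carrier (Ext E\<xi> Z A)"
    by (rule Emap_in_class[OF \<theta>\<xi>]) simp_all
  ultimately show ?thesis by simp
qed

lemma additive_bifunctor_restrict: "additive_bifunctor C E\<xi>"
proof (intro additive_bifunctor.intro additive_bifunctor_axioms.intro)
  show "additive_category C" by (rule additive_category_axioms)
next
  fix Z A assume ZA [simp]: "Z \<in> Ob C" "A \<in> Ob C"
  interpret G: comm_group "Ext E Z A" using Ext_group ZA by blast
  have c: "\<delta> \<in> carrier (Ext E Z A)" if "\<delta> \<in> carrier (Ext E\<xi> Z A)" for \<delta>
    using that by (simp add: carrier_restrict)
  show "comm_group (Ext E\<xi> Z A)"
  proof (rule comm_groupI)
    fix \<delta> assume \<delta>: "\<delta> \<in> carrier (Ext E\<xi> Z A)"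
    \<comment> \<open>The inverse is the pushforward along \<open>-1\<close>.\<close>
    let ?m = "Emap E (Idm C Z) (mi (Idm C A)) \<delta>"
    have "?m \<otimes>\<^bsub>Ext E Z A\<^esub> Emap E (Idm C Z) (Idm C A) \<delta> = Emap E (Idm C Z) (mi (Idm C A) \<boxplus> Idm C A) \<delta>"
      by (rule Emap_pl_right[OF c[OF \<delta>], symmetric]) simp_all
    also have "\<dots> = \<one>\<^bsub>Ext E Z A\<^esub>" by (simp add: Emap_zr_right[OF c[OF \<delta>]])
    finally have "?m \<otimes>\<^bsub>Ext E Z A\<^esub> \<delta> = \<one>\<^bsub>Ext E Z A\<^esub>" by (simp add: Emap_Idm[OF c[OF \<delta>]])
    moreover have "?m \<in> carrier (Ext E\<xi> Z A)" by (rule Emap_in_class[OF \<delta>]) simp_all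
    ultimately show "\<exists>y\<in>carrier (Ext E\<xi> Z A). y \<otimes>\<^bsub>Ext E\<xi> Z A\<^esub> \<delta> = \<one>\<^bsub>Ext E\<xi> Z A\<^esub>" by auto
  qed (auto simp: sum_in_class zero_in_class dest!: c intro: G.m_assoc G.m_comm)
next
  fix Z Z' A A' c a
  assume "Z \<in> Ob C" "Z' \<in> Ob C" "A \<in> Ob C" "A' \<in> Ob C"
    "c \<in> carrier (Hom C Z' Z)" "a \<in> carrier (Hom C A A')"
  then have ca: "arr c" "cd c = Z" "dm c = Z'" "arr a" "dm a = A" "cd a = A'"
    by (auto simp: in_Hom_iff)
  show "Emap E\<xi> c a \<in> hom (Ext E\<xi> Z A) (Ext E\<xi> Z' A')"
  proof (rule homI)
    show "Emap E\<xi> c a x \<in> carrier (Ext E\<xi> Z' A')" if "x \<in> carrier (Ext E\<xi> Z A)" for x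
      using Emap_in_class[OF that ca] by simp
    show "Emap E\<xi> c a (x \<otimes>\<^bsub>Ext E\<xi> Z A\<^esub> y) = Emap E\<xi> c a x \<otimes>\<^bsub>Ext E\<xi> Z' A'\<^esub> Emap E\<xi> c a y"
      if "x \<in> carrier (Ext E\<xi> Z A)" "y \<in> carrier (Ext E\<xi> Z A)" for x y
      using Emap_mult[OF _ _ ca, of x y] that by (simp add: carrier_restrict)
  qed
qed (simp_all add: carrier_restrict Emap_Id Emap_Comp Emap_add_left Emap_add_right)

lemma saturatedD:
  assumes "arr a" "arr b" "arr c" "arr d" "dm b = cd a" "dm c = dm a" "dm d = cd c" "cd d = cd b"
    and "b \<bullet> a = d \<bullet> c" "a \<in> deflations n \<xi>" "b \<in> deflations n \<xi>" "d \<in> deflations n D"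
  shows "d \<in> deflations n \<xi>"
proof -
  have "{a, b, d} \<subseteq> deflations n D"
    using assms(10-12) class_distinguished by (auto simp: deflations_def)
  then have *: "b \<bullet> a = d \<bullet> c \<and> {a, b, d} \<subseteq> deflations n D \<and> a \<in> deflations n \<xi> \<and> b \<in> deflations n \<xi>"
    using assms(9-11) by blast
  have m: "dm a \<in> Ob C" "cd a \<in> Ob C" "cd c \<in> Ob C" "cd b \<in> Ob C"
    "a \<in> carrier (Hom C (dm a) (cd a))" "b \<in> carrier (Hom C (cd a) (cd b))"
    "c \<in> carrier (Hom C (dm a) (cd c))" "d \<in> carrier (Hom C (cd c) (cd b))"
    using assms(1-8) by (simp_all add: in_Hom_iff)
  have "saturated n C E s \<xi>" using proper by (simp add: n_proper_class_def)
  from this[unfolded saturated_def, rule_format, OF m *] show ?thesis .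
qed

text \<open>
  Saturation applied to the square \<open>g f = (g f) 1\<close>.
\<close>

lemma deflation_cmp_in_class:
  assumes "arr f" "arr g" "dm g = cd f" "f \<in> deflations n \<xi>" "g \<in> deflations n \<xi>"
  shows "g \<bullet> f \<in> deflations n \<xi>"
proof -
  have "f \<in> deflations n D" "g \<in> deflations n D"
    using assms class_distinguished by (auto simp: deflations_def)
  then have "g \<bullet> f \<in> deflations n D"
    using EA1_deflation[of "dm f" "cd f" "cd g" f g] assms(1-3) by (simp add: in_Hom_iff)
  then show ?thesis
    using saturatedD[of f g "Idm C (dm f)" "g \<bullet> f"] assms by simp
qed

text \<open>
  Let \<open>X\<close>, \<open>Y\<close>, \<open>Z\<close> start with \<open>f\<close>, \<open>g\<close> and \<open>g f\<close>. The cone of a lift \<open>\<phi> : X \<rightarrow> Z\<close> of \<open>(1, c)\<close> has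
  extension \<open>f\<^sub>* \<tau> = e\<^sup>* \<rho>\<close>, which lies in \<open>\<E>\<^sub>\<xi>\<close>, so \<open>[c  d\<^sub>Z] : X\<^sup>n\<^sup>+\<^sup>1 \<oplus> Z\<^sup>n \<rightarrow> Z\<^sup>n\<^sup>+\<^sup>1\<close> is a
  \<open>\<xi>\<close>-deflation. So is \<open>d\<^sub>X \<oplus> 1 : X\<^sup>n \<oplus> Z\<^sup>n \<rightarrow> X\<^sup>n\<^sup>+\<^sup>1 \<oplus> Z\<^sup>n\<close>, and their composite is
  \<open>[c d\<^sub>X  d\<^sub>Z] = d\<^sub>Z [\<phi>\<^sup>n  1]\<close>. By saturation \<open>d\<^sub>Z\<close> is a \<open>\<xi>\<close>-deflation.
\<close>

lemma inflation_cmp_in_class: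
  assumes f: "arr f" and g: "arr g" and gf: "dm g = cd f"
    and "f \<in> inflations \<xi>" "g \<in> inflations \<xi>"
  shows "g \<bullet> f \<in> inflations \<xi>"
proof -
  obtain X \<delta> where X: "(X, \<delta>) \<in> \<xi>" and fX: "f = df X 0" using assms by (auto simp: inflations_def)
  obtain Y \<rho> where Y: "(Y, \<rho>) \<in> \<xi>" and gY: "g = df Y 0" using assms by (auto simp: inflations_def)
  have XD: "(X, \<delta>) \<in> D" and YD: "(Y, \<rho>) \<in> D" using X Y class_distinguished by auto
  have "f \<in> inflations D" "g \<in> inflations D"
    using assms class_distinguished by (auto simp: inflations_def)
  then have "g \<bullet> f \<in> inflations D"
    using EA1_inflation[of "dm f" "cd f" "cd g" f g] f g gf by (simp add: in_Hom_iff)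
  then obtain Z \<tau> where ZD: "(Z, \<tau>) \<in> D" and gfZ: "g \<bullet> f = df Z 0" by (auto simp: inflations_def)
  have cX: "is_cpx n C X" and cY: "is_cpx n C Y" and cZ: "is_cpx n C Z"
    using distinguishedD(1) XD YD ZD by auto
  note [simp] = is_cpxD[OF cX] is_cpxD[OF cY] is_cpxD[OF cZ]
  have fd: "dm f = ob X 0" "cd f = ob X (Suc 0)" by (simp_all add: fX)
  have Y0: "ob Y 0 = ob X (Suc 0)" using gf fX gY by simp
  have Z0: "ob Z 0 = ob X 0" "ob Z (Suc 0) = ob Y (Suc 0)"
    using arg_cong[OF gfZ, of dm] arg_cong[OF gfZ, of cd] f g gf by (simp_all add: fX gY)
  have gd: "dm g = ob X (Suc 0)" "cd g = ob Y (Suc 0)" using Y0 by (simp_all add: gY)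
  note \<delta> = distinguishedD(2)[OF XD] and \<tau> = distinguishedD(2)[OF ZD]
  note [simp] = fX[symmetric] gY[symmetric] gfZ[symmetric] fd gd f g Y0 Z0
  \<comment> \<open>Since \<open>(g f)\<^sub>* \<delta> = 0\<close>, the extension \<open>\<delta>\<close> is pulled back from \<open>\<tau>\<close>.\<close>
  have "Emap E (Idm C (ob X (Suc n))) (g \<bullet> f) \<delta>
      = Emap E (Idm C (ob X (Suc n))) g (Emap E (Idm C (ob X (Suc n))) f \<delta>)"
    by (simp add: Emap_Emap[OF \<delta>])
  then have "Emap E (Idm C (ob X (Suc n))) (df Z 0) \<delta> = \<one>\<^bsub>Ext E (ob X (Suc n)) (ob Z (Suc 0))\<^esub>"
    using push_inflation[OF XD] by (simp add: Emap_one)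
  then obtain c where c: "arr c" "dm c = ob X (Suc n)" "cd c = ob Z (Suc n)"
    "\<delta> = Emap E c (Idm C (ob Z 0)) \<tau>"
    using ext_killed_by_inflation[OF n_pos ZD, of \<delta> "ob X (Suc n)"] \<delta> by auto
  \<comment> \<open>Since \<open>g\<^sub>* f\<^sub>* \<tau> = 0\<close>, the extension \<open>f\<^sub>* \<tau>\<close> is pulled back from \<open>\<rho>\<close>.\<close>
  let ?f\<tau> = "Emap E (Idm C (ob Z (Suc n))) f \<tau>"
  have f\<tau>: "?f\<tau> \<in> carrier (Ext E (ob Z (Suc n)) (ob Y 0))"
    by (rule Emap_closed[OF \<tau>]) simp_all
  have "Emap E (Idm C (ob Z (Suc n))) (df Y 0) ?f\<tau> = \<one>\<^bsub>Ext E (ob Z (Suc n)) (ob Y (Suc 0))\<^esub>"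
    using push_inflation[OF ZD] by (simp add: Emap_Emap[OF \<tau>])
  then obtain e where e: "arr e" "dm e = ob Z (Suc n)" "cd e = ob Y (Suc n)"
    "?f\<tau> = Emap E e (Idm C (ob Y 0)) \<rho>"
    using ext_killed_by_inflation[OF n_pos YD f\<tau>] by auto
  have "\<rho> \<in> carrier (Ext E\<xi> (ob Y (Suc n)) (ob Y 0))" using in_class_iff[OF YD] Y by simp
  then have f\<tau>\<xi>: "?f\<tau> \<in> carrier (Ext E\<xi> (ob Z (Suc n)) (ob X (Suc 0)))"
    unfolding e(4) using e(1-3) by (intro Emap_in_class) simp_all
  have "(X, pull C E (ob Z 0) c \<tau>) \<in> D" using XD c(4) by (simp add: pull_def)
  moreover have "c \<in> carrier (Hom C (ob X (n+1)) (ob Z (n+1)))" using c by (simp add: in_Hom_iff)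
  ultimately obtain \<phi> where \<phi>: "cpx_mor n C X Z \<phi>" "\<phi> (n+1) = c"
    and M: "(mapping_cone n C X Z \<phi>, push C E (ob Z (n+1)) (df X 0) \<tau>) \<in> D"
    using EA2[OF _ ZD] Z0(1) by metis
  define K where "K = mapping_cone n C X Z \<phi>"
  note [simp] = cpx_morD[OF \<phi>(1) cX cZ]
  have K: "(K, ?f\<tau>) \<in> D" using M by (simp add: K_def push_def)
  have Kob: "ob K (Suc n) = ob Z (Suc n)" "ob K 0 = ob X (Suc 0)"
    by (simp_all add: K_def mapping_cone_def)
  let ?Q = "ob X (Suc n)" and ?W = "ob Z n"
  have Kdf: "df K n = c \<bullet> p1 ?Q ?W \<boxplus> df Z n \<bullet> p2 ?Q ?W"
    using n_pos \<phi>(2) c by (simp add: K_def mapping_cone_def)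
  have "(K, ?f\<tau>) \<in> \<xi>" using in_class_iff[OF K] Kob f\<tau>\<xi> by simp
  then have b: "df K n \<in> deflations n \<xi>" by (auto simp: deflations_def)
  \<comment> \<open>The split exangle \<open>0 \<rightarrow> \<dots> \<rightarrow> Z\<^sup>n = Z\<^sup>n\<close> supplies the summand \<open>1\<close> of \<open>d\<^sub>X \<oplus> 1\<close>.\<close>
  obtain N where N: "zero_object C N" using ex_zero_object by blast
  define T where "T = triv_right n C ?W N"
  have TD: "(T, \<one>\<^bsub>Ext E ?W N\<^esub>) \<in> D" unfolding T_def by (rule triv_right_distinguished) (simp_all add: N)
  have Tn: "ob T n = ?W" "ob T (Suc n) = ?W" "df T n = Idm C ?W" "ob T 0 = N"
    using n_pos by (simp_all add: T_def triv_right_def Let_def)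
  have "(T, \<one>\<^bsub>Ext E ?W N\<^esub>) \<in> \<xi>"
    using proper TD Tn by (auto simp: n_proper_class_def split_exangles_def)
  then have "df (cpx_sum C X T) n \<in> deflations n \<xi>"
    using proper X unfolding n_proper_class_def closed_under_coproducts_def deflations_def by blast
  moreover define a where "a = df (cpx_sum C X T) n"
  ultimately have a: "a \<in> deflations n \<xi>" by simp
  have cT: "is_cpx n C T" using distinguishedD(1)[OF TD] .
  note as = df_cpx_sum[OF cX cT, of n, folded a_def, unfolded Tn, simplified]
  define c' where "c' = \<phi> n \<bullet> p1 (ob X n) ?W \<boxplus> p2 (ob X n) ?W"
  have "df K n \<bullet> a = df Z n \<bullet> c'"
    by (rule from_osum_eqI[of _ _ "ob X n" ?W])
      (use c \<phi>(2) in \<open>simp_all add: Kdf c'_def as\<close>)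
  then have "df Z n \<in> deflations n \<xi>"
    by (intro saturatedD[of a "df K n" c' "df Z n"])
      (use a b c ZD in \<open>auto simp: as Kdf c'_def deflations_def\<close>)
  then have "(Z, \<tau>) \<in> \<xi>"
    using deflation_factor_in_class[OF additive_bifunctor_restrict ZD, of "Idm C ?W"] by simp
  then have "df Z 0 \<in> inflations \<xi>" unfolding inflations_def by blast
  then show ?thesis by (simp only: gfZ)
qed

lemma n_exangulated_restrict: "n_exangulated_category C E\<xi> n s\<xi>"
  by (rule n_exangulated_restrictI[OF additive_bifunctor_restrict inflation_cmp_in_class deflation_cmp_in_class])

end

section \<open>Exangulated restrictions come from proper classes\<close>

lemma n_proper_of_restrict:
  assumes "n_exangulated_category C E\<xi> n s\<xi>"
  shows "n_proper_class n C E s \<xi>"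
proof -
  interpret R: n_exangulated_category C E\<xi> n s\<xi> by fact
  have bif: "additive_bifunctor C E\<xi>" by (rule R.additive_bifunctor_axioms)
  have inD: "p \<in> D" if "p \<in> \<xi>" for p using that class_distinguished by auto
  have split: "split_exangles n C E s \<subseteq> \<xi>"
  proof clarify
    fix X \<delta> assume "(X, \<delta>) \<in> split_exangles n C E s"
    then have X: "(X, \<delta>) \<in> D" and \<delta>: "\<delta> = \<one>\<^bsub>Ext E (ob X (Suc n)) (ob X 0)\<^esub>"
      by (auto simp: split_exangles_def)
    have "\<delta> \<in> carrier (Ext E\<xi> (ob X (Suc n)) (ob X 0))"
      using R.Ext_one_closed[of "ob X (Suc n)" "ob X 0"] \<delta> is_cpxD(1)[OF distinguishedD(1)[OF X]]
      by simp
    then show "(X, \<delta>) \<in> \<xi>" using in_class_iff[OF X] by simp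
  qed
  have coprod: "closed_under_coproducts n C E \<xi>"
    unfolding closed_under_coproducts_def
  proof (intro allI impI, elim conjE)
    fix X \<delta> Y \<rho> assume X: "(X, \<delta>) \<in> \<xi>" and Y: "(Y, \<rho>) \<in> \<xi>"
    let ?S = "cpx_sum C X Y"
    let ?\<theta> = "ext_sum C E (ob X (n+1)) (ob X 0) \<delta> (ob Y (n+1)) (ob Y 0) \<rho>"
    have S: "(?S, ?\<theta>) \<in> D" by (rule cpx_sum_distinguished[OF inD[OF X] inD[OF Y]])
    have "\<delta> \<in> carrier (Ext E\<xi> (ob X (Suc n)) (ob X 0))" "\<rho> \<in> carrier (Ext E\<xi> (ob Y (Suc n)) (ob Y 0))"
      using in_class_iff inD X Y by blast+
    from R.ext_sum_closed[OF this] have "?\<theta> \<in> carrier (Ext E\<xi> (ob ?S (Suc n)) (ob ?S 0))"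
      using is_cpxD(1)[OF distinguishedD(1)[OF inD[OF X]]] is_cpxD(1)[OF distinguishedD(1)[OF inD[OF Y]]]
      by simp
    then show "(?S, ?\<theta>) \<in> \<xi>" using in_class_iff[OF S] by simp
  qed
  have base: "closed_under_base_change n C E s \<xi>"
    unfolding closed_under_base_change_def
  proof (intro allI impI, elim conjE)
    fix X \<delta> Y c assume X: "(X, \<delta>) \<in> \<xi>" and c: "c \<in> carrier (Hom C (ob Y (n+1)) (ob X (n+1)))"
      and e: "ob Y 0 = ob X 0" and Y: "(Y, pull C E (ob X 0) c \<delta>) \<in> D"
    note [simp] = is_cpxD[OF distinguishedD(1)[OF inD[OF X]]] is_cpxD[OF distinguishedD(1)[OF Y]]
    have "\<delta> \<in> carrier (Ext E\<xi> (ob X (Suc n)) (ob X 0))" using in_class_iff[OF inD[OF X]] X by simp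
    then have "pull C E (ob X 0) c \<delta> \<in> carrier (Ext E\<xi> (ob Y (Suc n)) (ob Y 0))"
      using R.Emap_closed[of \<delta> "ob X (Suc n)" "ob X 0" c "ob Y (Suc n)" "Idm C (ob X 0)" "ob X 0"] c e
      by (simp add: pull_def in_Hom_iff)
    then show "(Y, pull C E (ob X 0) c \<delta>) \<in> \<xi>" using in_class_iff[OF Y] by simp
  qed
  have cobase: "closed_under_cobase_change n C E s \<xi>"
    unfolding closed_under_cobase_change_def
  proof (intro allI impI, elim conjE)
    fix X \<delta> Y a assume X: "(X, \<delta>) \<in> \<xi>" and a: "a \<in> carrier (Hom C (ob X 0) (ob Y 0))"
      and e: "ob Y (n+1) = ob X (n+1)" and Y: "(Y, push C E (ob X (n+1)) a \<delta>) \<in> D"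
    note [simp] = is_cpxD[OF distinguishedD(1)[OF inD[OF X]]] is_cpxD[OF distinguishedD(1)[OF Y]]
    have "\<delta> \<in> carrier (Ext E\<xi> (ob X (Suc n)) (ob X 0))" using in_class_iff[OF inD[OF X]] X by simp
    then have "push C E (ob X (n+1)) a \<delta> \<in> carrier (Ext E\<xi> (ob Y (Suc n)) (ob Y 0))"
      using R.Emap_closed[of \<delta> "ob X (Suc n)" "ob X 0" "Idm C (ob X (Suc n))" "ob X (Suc n)" a "ob Y 0"] a e
      by (simp add: push_def in_Hom_iff)
    then show "(Y, push C E (ob X (n+1)) a \<delta>) \<in> \<xi>" using in_class_iff[OF Y] by simp
  qed
  have sat: "saturated n C E s \<xi>"
    unfolding saturated_def
  proof (intro ballI impI, elim conjE)
    fix A B K L a b c d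
    assume O: "A \<in> Ob C" "B \<in> Ob C" "K \<in> Ob C" "L \<in> Ob C"
      and a: "a \<in> carrier (Hom C A B)" and b: "b \<in> carrier (Hom C B L)"
      and c: "c \<in> carrier (Hom C A K)" and d: "d \<in> carrier (Hom C K L)"
      and sq: "b \<bullet> a = d \<bullet> c" and ds: "{a, b, d} \<subseteq> deflations n D"
      and ab: "a \<in> deflations n \<xi>" "b \<in> deflations n \<xi>"
    obtain V \<nu> where V: "(V, \<nu>) \<in> D" "d = df V n" using ds by (auto simp: deflations_def)
    have "cd c = ob V n" "arr c"
      using c d O V(2) is_cpxD(2,3)[OF distinguishedD(1)[OF V(1)], of n] by (auto simp: in_Hom_iff)
    moreover have "df V n \<bullet> c \<in> deflations n \<xi>"
      using R.EA1_deflation[OF O(1,2,4) a b] ab sq V(2) unfolding distinguished_restrict by simp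
    ultimately have "(V, \<nu>) \<in> \<xi>" using deflation_factor_in_class[OF bif V(1)] by blast
    then show "d \<in> deflations n \<xi>" using V(2) by (auto simp: deflations_def)
  qed
  show ?thesis
    unfolding n_proper_class_def
    using class_distinguished split weak_iso_closed coprod base cobase sat by blast
qed

end

section \<open>The characterization\<close>

theorem theorem4p5:
  fixes n :: nat
    and C :: "('o, 'm) acat"
    and E :: "('o, 'm, 'e) bifun"
    and s :: "('o, 'm, 'e) realiz"
    and \<xi> :: "(('o, 'm) cpx \<times> 'e) set"
  assumes "n \<ge> 1"
    and "n_exangulated_category C E n s"
    and "\<xi> \<subseteq> distinguished n C E s"
    and "closed_under_weak_isos n C E s \<xi>"
  shows "n_proper_class n C E s \<xi> \<longleftrightarrow>
         n_exangulated_category C (restrict_bifun n E \<xi>) n (restrict_realiz n E s \<xi>)"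
proof -
  interpret exangle_class C E n s \<xi>
    using assms by (simp add: exangle_class_def exangle_class_axioms_def)
  show ?thesis using n_exangulated_restrict n_proper_of_restrict by blast
qed

end
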